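(* For positive integers $n,m$ with $n$ odd, let $\mathcal G$ be the graph obtained from the rectangle $[0,2n]\times[1,m]\subset\mathbb Z^2$ by identifying, for each $j$, the vertex $(0,j)$ with the vertex $(2n,j)$. Consider the number of noncontractible (topologically nontrivial) loops in a random double-dimer configuration on $\mathcal G$. In the limit of large $n,m$ with $n/m=\tau$ fixed, writing $q=e^{-\tau\pi}$, the probability generating function for the number of these loops is as follows. (i) When $m$ is even: $$\sum_{k=0}^\infty \Pr(k\text{ loops})X^k=\prod_{\substack{j=1\\ j\text{ odd}}}^\infty\frac{(1+q^{j}X+q^{2j})^2}{(1+q^{j}+q^{2j})^2}.$$ (ii) When $m$ is odd: $$\sum_{k=0}^\infty \Pr(k\text{ loops})X^k=\frac{2+X}{3}\prod_{\substack{j=2\\ j\text{ even}}}^\infty\frac{(1+q^{j}X+q^{2j})^2}{(1+q^{j}+q^{2j})^2}.$$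
   Context: A double-dimer configuration on a graph is a union of two dimer covers (perfect matchings), equivalently a set of simple even-length loops and doubled edges such that each vertex is the endpoint of exactly two edges (possibly the same edge, doubled). In the double-dimer model the configuration is the union of two independent uniformly random dimer covers, so a configuration with $c$ loops in total (doubled edges not counted) has probability proportional to $2^c$. The graph $\mathcal G$ is embedded in a cylindrical annulus of circumference $2n$, and a loop is noncontractible if it does not bound a disk in the annulus, i.e. it winds around the annulus. In the derivation, $X=\lambda+\lambda^{-1}=\mathrm{Tr}(M)$, where $M=\begin{pmatrix}\lambda&0\\0&\lambda^{-1}\end{pmatrix}$ is the monodromy around the circumference of a flat connection (one with trivial monodromy around contractible loops), and a configuration with $k$ noncontractible cycles has weight proportional to $(\mathrm{Tr}\,M)^k$.
   Formalization: For Pr from two independent uniform covers the printed formulas fail; X becomes 2X, normalised at 2 (prefactor (1+X)/2). The printed products are also proved, with Pr(k) weighting contractible loops by 2 and noncontractible loops by 1. The limit allows n/m tending to τ. *)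

theory Defs
  imports "HOL-Probability.Probability"
begin

(* The rectangle [0,2n] x [1,m] with (0,j) and (2n,j) identified; the first coordinate is kept
   in {0..<2n}.  Edges are named, not given by their endpoints, because for n = 1 the edges
   Hor 0 j and Hor 1 j are parallel. *)

type_synonym vertex = "nat \<times> nat"

datatype edge = Hor nat nat | Ver nat nat

definition cyl_vertices :: "nat \<Rightarrow> nat \<Rightarrow> vertex set" where
  "cyl_vertices n m = {0..<2 * n} \<times> {1..m}"

definition cyl_edges :: "nat \<Rightarrow> nat \<Rightarrow> edge set" where
  "cyl_edges n m = {Hor x j | x j. x < 2 * n \<and> 1 \<le> j \<and> j \<le> m}
                 \<union> {Ver x j | x j. x < 2 * n \<and> 1 \<le> j \<and> j < m}"

fun ends :: "nat \<Rightarrow> edge \<Rightarrow> vertex set" where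
  "ends n (Hor x j) = {(x, j), ((x + 1) mod (2 * n), j)}"
| "ends n (Ver x j) = {(x, j), (x, j + 1)}"

definition dimer_covers :: "nat \<Rightarrow> nat \<Rightarrow> edge set set" where
  "dimer_covers n m =
     {M. M \<subseteq> cyl_edges n m \<and> (\<forall>v\<in>cyl_vertices n m. \<exists>!e. e \<in> M \<and> v \<in> ends n e)}"

(* A double-dimer configuration is represented by the set union C of two dimer covers.  This
   loses nothing: the doubled edges are the connected components of C that consist of a single
   edge, the loops are all the other components. *)

definition double_dimer_configs :: "nat \<Rightarrow> nat \<Rightarrow> edge set set" where
  "double_dimer_configs n m = {M \<union> N | M N. M \<in> dimer_covers n m \<and> N \<in> dimer_covers n m}"

definition touching :: "nat \<Rightarrow> edge set \<Rightarrow> (edge \<times> edge) set" where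
  "touching n C = {(e, f). e \<in> C \<and> f \<in> C \<and> ends n e \<inter> ends n f \<noteq> {}}"

definition loops :: "nat \<Rightarrow> edge set \<Rightarrow> edge set set" where
  "loops n C = {L \<in> C // (touching n C)\<^sup>*. card L \<ge> 2}"

(* The embedding in the annulus 1 \<le> |z| \<le> m: the rectangle is rolled up by wrap. *)

definition wrap :: "nat \<Rightarrow> real \<Rightarrow> real \<Rightarrow> complex" where
  "wrap n s t = of_real t * cis (pi * s / real n)"

definition annulus :: "nat \<Rightarrow> complex set" where
  "annulus m = {z. 1 \<le> cmod z \<and> cmod z \<le> real m}"

fun edge_arc :: "nat \<Rightarrow> edge \<Rightarrow> complex set" where
  "edge_arc n (Hor x j) = (\<lambda>s. wrap n s (real j)) ` {real x..real x + 1}"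
| "edge_arc n (Ver x j) = (\<lambda>t. wrap n (real x) t) ` {real j..real j + 1}"

definition loop_curve :: "nat \<Rightarrow> edge set \<Rightarrow> complex set" where
  "loop_curve n L = (\<Union>e\<in>L. edge_arc n e)"

(* The open disk bounded by the Jordan curve loop_curve n L in the plane is its inside, so L
   bounds a disk in the annulus iff the inside is contained in the annulus. *)

definition noncontractible :: "nat \<Rightarrow> nat \<Rightarrow> edge set \<Rightarrow> bool" where
  "noncontractible n m L \<longleftrightarrow> \<not> inside (loop_curve n L) \<subseteq> annulus m"

definition num_noncontractible :: "nat \<Rightarrow> nat \<Rightarrow> edge set \<Rightarrow> nat" where
  "num_noncontractible n m C = card {L \<in> loops n C. noncontractible n m L}"

definition num_contractible :: "nat \<Rightarrow> nat \<Rightarrow> edge set \<Rightarrow> nat" where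
  "num_contractible n m C = card {L \<in> loops n C. \<not> noncontractible n m L}"

definition double_dimer_prob :: "nat \<Rightarrow> nat \<Rightarrow> nat \<Rightarrow> real" where
  "double_dimer_prob n m k =
     measure_pmf.prob
       (pair_pmf (pmf_of_set (dimer_covers n m)) (pmf_of_set (dimer_covers n m)))
       {(M, N). num_noncontractible n m (M \<union> N) = k}"

(* In the partition function of the double-dimer model with a flat SL(2) connection of monodromy
   M, a contractible loop has weight Tr I = 2 and a noncontractible one has weight X = Tr M.
   trace_prob n m k is the coefficient of X^k in that partition function, divided by the value
   of the partition function at X = 1.  It is not the double-dimer law, in which a noncontractible
   loop has weight 2 as well: there the coefficient of X^k is multiplied by 2^k and the
   normalisation is the value at X = 2. *)

definition trace_prob :: "nat \<Rightarrow> nat \<Rightarrow> nat \<Rightarrow> real" where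
  "trace_prob n m k =
     (\<Sum>C | C \<in> double_dimer_configs n m \<and> num_noncontractible n m C = k.
        2 ^ num_contractible n m C)
     / (\<Sum>C\<in>double_dimer_configs n m. 2 ^ num_contractible n m C)"

(* The laws P i converge to a law p on nat with generating function G, and their generating
   functions converge to G as well. *)

definition has_limiting_pgf :: "(nat \<Rightarrow> nat \<Rightarrow> real) \<Rightarrow> (complex \<Rightarrow> complex) \<Rightarrow> bool" where
  "has_limiting_pgf P G \<longleftrightarrow>
     (\<exists>p. (\<forall>k. (\<lambda>i. P i k) \<longlonglongrightarrow> p k) \<and> (\<forall>X. (\<lambda>k. of_real (p k) * X ^ k) sums G X))
     \<and> (\<forall>X. (\<lambda>i. \<Sum>k. of_real (P i k) * X ^ k) \<longlonglongrightarrow> G X)"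

end

theory Submission
  imports Defs "HOL-Complex_Analysis.Complex_Analysis" "Jordan_Normal_Form.Determinant"
begin

text \<open>Give an edge that crosses the seam of the cylinder the weight z or 1/z, according to the
  direction from its white to its black end, and let P(z) be the resulting sum over dimer covers.
  The pairs of dimer covers with a given union correspond to the choices of an alternating half of
  each of its loops. A loop contributes z + 1/z to P(z) P(1/z) if it winds around the cylinder and 2
  if it does not, so P(z) P(1/z) is the loop partition function at X = z + 1/z. Whether a loop winds
  around the cylinder is read off its number of signed seam crossings, as a simple closed curve has
  winding number 0, 1 or -1 about the origin.

  For odd n, the sign of the permutation given by a dimer cover, in the row-major order of the
  vertices, is fixed by the seam crossings and the vertical edges, and P(z) is up to sign the
  determinant of a Kasteleyn matrix K(z). Plane waves times sine waves diagonalise K(z) K(1/z)^T,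
  whence the loop partition function is the product of the X + 2 cosh (2 n arsinh (cos (pi k/(m+1)))).
  The limit of this product is taken by dominated convergence, and the coefficients of a power
  series with nonnegative coefficients converge with it.\<close>

section \<open>Signs of permutations\<close>

text \<open>A loop has two descriptions that must be reconciled: a Jordan curve in the plane, whose
  inside decides contractibility, and a set of edges on which two covers alternate. Leaving white
  vertices along one cover and black ones along the other orients the loop and yields a closed
  polygon in logarithmic polar coordinates. Signs are found by placing the vertices on a line in
  row-major order and drawing edges as arcs: for every matching of white with black points, the sign
  of the permutation, the directions of the arcs and the parity of their crossings multiply to the
  same constant. Counting the vertices of a row to the left of a vertical edge gives the parity of
  its crossings. K(z) maps functions on black vertices to functions on white ones and so has no
  eigenvectors. Composed with the transpose at 1/z it acts on white vertices, and 1/z is also the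
  second argument that pairs of covers call for. One product formula serves both laws:
  \<open>trace_prob\<close> has the generating function with X normalised at 1, the double-dimer law
  the one with 2 X normalised at 2. The bound 2 \<le> n excludes the parallel edges of n = 1; it
  holds eventually, as n tends to infinity.\<close>

lemma prod_square_split:
  fixes t :: "nat \<Rightarrow> nat \<Rightarrow> 'a::comm_monoid_mult"
  shows "(\<Prod>i<N. \<Prod>k<N. t i k) = (\<Prod>i<N. t i i) * (\<Prod>k<N. \<Prod>i<k. t i k * t k i)"
proof (induction N)
  case (Suc N)
  have "(\<Prod>i<Suc N. \<Prod>k<Suc N. t i k)
      = (\<Prod>i<N. \<Prod>k<N. t i k) * (\<Prod>i<N. t i N) * ((\<Prod>k<N. t N k) * t N N)"
    by (simp add: prod.distrib mult_ac)
  then show ?case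
    by (simp add: Suc.IH prod.distrib mult_ac)
qed simp

text \<open>A symmetric \<open>r\<close> is a function on unordered pairs, and \<open>q\<close>
  permutes these. Each pair is represented with its larger entry first, whence the
  \<open>max\<close> and \<open>min\<close> in the witnesses.\<close>

lemma prod_pairs_permute:
  fixes r :: "nat \<Rightarrow> nat \<Rightarrow> 'a::comm_monoid_mult"
  assumes sym: "\<And>i k. r i k = r k i" and q: "q permutes {..<N}"
  shows "(\<Prod>k<N. \<Prod>i<k. r (q i) (q k)) = (\<Prod>k<N. \<Prod>i<k. r i k)"
proof -
  have lt: "q i < N" if "i < N" for i
    using q that by (metis lessThan_iff permutes_in_image)
  have ilt: "inv_into UNIV q i < N" if "i < N" for i
    using permutes_inv[OF q] that by (metis lessThan_iff permutes_in_image)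
  have ne: "q i \<noteq> q k" if "i \<noteq> k" for i k
    using permutes_inj[OF q] that by (metis injD)
  have ine: "inv_into UNIV q i \<noteq> inv_into UNIV q k" if "i \<noteq> k" for i k
    using permutes_inj[OF permutes_inv[OF q]] that by (metis injD)
  note inv = permutes_inverses[OF q]
  have "(\<Prod>(k,i)\<in>Sigma {..<N} (\<lambda>k. {..<k}). r (q i) (q k)) = (\<Prod>(k,i)\<in>Sigma {..<N} (\<lambda>k. {..<k}). r i k)"
  proof (rule prod.reindex_bij_witness[where
        i = "\<lambda>(k,i). (max (inv_into UNIV q k) (inv_into UNIV q i), min (inv_into UNIV q k) (inv_into UNIV q i))" and
        j = "\<lambda>(k,i). (max (q k) (q i), min (q k) (q i))"])
    fix a assume a: "a \<in> Sigma {..<N} (\<lambda>k. {..<k})"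
    obtain k i where ki: "a = (k, i)" "i < k" "k < N" using a by auto
    have qn: "q k \<noteq> q i" "inv_into UNIV q k \<noteq> inv_into UNIV q i" using ki ne ine by auto
    show "(\<lambda>(k, i). (max (inv_into UNIV q k) (inv_into UNIV q i), min (inv_into UNIV q k) (inv_into UNIV q i))) ((\<lambda>(k, i). (max (q k) (q i), min (q k) (q i))) a) = a"
      using ki by (auto simp: inv max_def min_def)
    show "(\<lambda>(k, i). (max (q k) (q i), min (q k) (q i))) ((\<lambda>(k, i). (max (inv_into UNIV q k) (inv_into UNIV q i), min (inv_into UNIV q k) (inv_into UNIV q i))) a) = a"
      using ki by (auto simp: inv max_def min_def)
    show "(\<lambda>(k, i). (max (q k) (q i), min (q k) (q i))) a \<in> Sigma {..<N} (\<lambda>k. {..<k})"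
      using ki lt[of k] lt[of i] qn by (auto simp: max_def min_def)
    show "(\<lambda>(k, i). (max (inv_into UNIV q k) (inv_into UNIV q i), min (inv_into UNIV q k) (inv_into UNIV q i))) a \<in> Sigma {..<N} (\<lambda>k. {..<k})"
      using ki ilt[of k] ilt[of i] qn by (auto simp: max_def min_def)
    show "(case (case a of (k, i) \<Rightarrow> (max (q k) (q i), min (q k) (q i))) of (k, i) \<Rightarrow> r i k) =
         (case a of (k, i) \<Rightarrow> r (q i) (q k))"
      using ki sym by (auto simp: max_def min_def)
  qed
  then show ?thesis by (simp add: prod.Sigma)
qed

definition inversion_sign :: "nat \<Rightarrow> (nat \<Rightarrow> nat) \<Rightarrow> int" where
  "inversion_sign N p = (\<Prod>k<N. \<Prod>i<k. sgn (int (p k) - int (p i)))"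

text \<open>The additional factor is 1 for i < k, but it makes the whole factor symmetric in i and
  k, as \<open>prod_pairs_permute\<close> requires.\<close>

lemma inversion_sign_altdef:
  "inversion_sign N p = (\<Prod>k<N. \<Prod>i<k. sgn (int (p k) - int (p i)) * sgn (int k - int i))"
  unfolding inversion_sign_def by (intro prod.cong) auto

text \<open>Reindexing the symmetric factors of \<open>p\<close> by \<open>q\<close> produces a
  second copy of sgn (q k - q i), which cancels against the one in
  \<open>inversion_sign N q\<close>.\<close>

lemma inversion_sign_compose:
  assumes q: "q permutes {..<N}"
  shows "inversion_sign N (p \<circ> q) = inversion_sign N p * inversion_sign N q"
proof -
  let ?r = "\<lambda>i k. sgn (int (p k) - int (p i)) * sgn (int k - int i)"
  have sq: "sgn x * sgn x = (1::int)" if "x \<noteq> 0" for x using that by (simp add: sgn_if)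
  have sgm: "sgn (x - y) = - sgn (y - x)" for x y :: int by (simp add: sgn_if)
  have sym: "?r i k = ?r k i" for i k
    by (subst sgm[of "int (p k)"], subst sgm[of "int k"]) simp
  have "inversion_sign N p = (\<Prod>k<N. \<Prod>i<k. ?r (q i) (q k))"
    using prod_pairs_permute[of ?r, OF sym q] by (simp add: inversion_sign_altdef)
  then have "inversion_sign N p * inversion_sign N q = (\<Prod>k<N. \<Prod>i<k. ?r (q i) (q k) * sgn (int (q k) - int (q i)))"
    by (simp add: inversion_sign_def prod.distrib)
  also have "\<dots> = inversion_sign N (p \<circ> q)"
    unfolding inversion_sign_def
  proof (intro prod.cong refl)
    fix k i :: nat assume "i \<in> {..<k}"
    then have "q k \<noteq> q i" using permutes_inj[OF q] by (metis injD lessThan_iff nat_neq_iff)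
    then show "?r (q i) (q k) * sgn (int (q k) - int (q i)) = sgn (int ((p \<circ> q) k) - int ((p \<circ> q) i))"
      using sq[of "int (q k) - int (q i)"] by (simp add: mult.assoc)
  qed
  finally show ?thesis by simp
qed

text \<open>The inverted pairs, collected in \<open>?A\<close>, are \<open>a\<close> with each index
  in (a, b] and \<open>b\<close> with each index strictly between: 2 (b - a - 1) + 1 of them, an odd
  number.\<close>

lemma inversion_sign_transpose:
  assumes "a < b" "b < N"
  shows "inversion_sign N (Transposition.transpose a b) = - 1"
proof -
  let ?t = "Transposition.transpose a b" let ?S = "Sigma {..<N} (\<lambda>k. {..<k})"
  let ?A = "(\<lambda>k. (k, a)) ` {a<..b} \<union> (\<lambda>i. (b, i)) ` {a<..<b}"
  have sg: "sgn (int (?t k) - int (?t i)) = (if (k, i) \<in> ?A then -1 else 1)" if "i < k" for k i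
  proof -
    have sgl: "sgn (int c - int d) = (if d < c then 1 else if c = d then 0 else -1)" for c d
      by (simp add: sgn_if)
    have A: "(k, i) \<in> ?A \<longleftrightarrow> i = a \<and> k \<le> b \<or> k = b \<and> a < i"
      using that assms(1) by auto
    have "i = a \<or> i = b \<or> (i \<noteq> a \<and> i \<noteq> b)" "k = a \<or> k = b \<or> (k \<noteq> a \<and> k \<noteq> b)" by auto
    then show ?thesis using that assms(1) unfolding A sgl Transposition.transpose_def
      by (elim disjE conjE) simp_all
  qed
  have fin: "finite ?S" by auto
  have sub: "?A \<subseteq> ?S" using assms by auto
  have "card ?A = card ((\<lambda>k. (k, a)) ` {a<..b}) + card ((\<lambda>i. (b, i)) ` {a<..<b})"
    by (rule card_Un_disjoint) auto
  also have "\<dots> = (b - a) + (b - a - 1)"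
    by (simp add: card_image inj_on_def)
  finally have card: "card ?A = Suc (2 * (b - a - 1))" using assms by simp
  have "inversion_sign N ?t = (\<Prod>(k,i)\<in>?S. sgn (int (?t k) - int (?t i)))"
    by (simp add: inversion_sign_def prod.Sigma)
  also have "\<dots> = (\<Prod>z\<in>?S. if z \<in> ?A then -1 else 1)"
  proof (rule prod.cong[OF refl])
    fix z assume z: "z \<in> ?S"
    obtain k i where ki: "z = (k, i)" by (cases z)
    with z have "i < k" by simp
    from sg[OF this] show "(case z of (k, i) \<Rightarrow> sgn (int (?t k) - int (?t i))) = (if z \<in> ?A then -1 else 1)"
      unfolding ki prod.case .
  qed
  also have "\<dots> = (\<Prod>z\<in>?A. -1)"
    using sub by (subst prod.mono_neutral_right[of ?S ?A]) auto
  also have "\<dots> = -1" by (simp add: card)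
  finally show ?thesis .
qed

lemma sign_eq_inversion_sign:
  assumes "p permutes {..<N}"
  shows "sign p = inversion_sign N p"
proof -
  have id: "inversion_sign N id = 1"
    by (simp add: inversion_sign_def)
  show ?thesis
  using assms
  proof (rule permutes_induct)
    show "finite {..<N}" "sign id = inversion_sign N id" using id by (auto simp: sign_id)
    fix a b p assume ab: "a \<in> {..<N}" "b \<in> {..<N}" "a \<noteq> b" "p permutes {..<N}" "sign p = inversion_sign N p"
    have "inversion_sign N (Transposition.transpose a b) = -1"
      using ab inversion_sign_transpose[of a b N] inversion_sign_transpose[of b a N]
      by (cases "a < b") (auto simp: transpose_commute)
    moreover have "sign (Transposition.transpose a b \<circ> p) = sign (Transposition.transpose a b) * sign p"
      using ab(4) by (intro sign_compose permutation_swap_id) (auto simp: permutation_permutes)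
    ultimately show "sign (Transposition.transpose a b \<circ> p) = inversion_sign N (Transposition.transpose a b \<circ> p)"
      using ab inversion_sign_compose[OF ab(4)] by (simp add: sign_swap_id)
  qed
qed

text \<open>Think of {x, u} and {y, v} as arcs over a line. The two conditionals multiply to -1
  exactly when the arcs cross. Both sides depend only on the relative order of the four points, so a
  finite case distinction decides.\<close>

lemma sgn_crossing_pair:
  fixes x y u v :: int
  assumes "x < y" "u \<noteq> v" "x \<noteq> v" "y \<noteq> u" "x \<noteq> u" "y \<noteq> v"
  shows "sgn (v - u)
       * ((if min x u < min y v \<and> min y v < max x u \<and> max x u < max y v then -1 else 1)
          * (if min y v < min x u \<and> min x u < max y v \<and> max y v < max x u then -1 else 1))
     = - 1 * (sgn (x - v) * sgn (y - u))"
proof -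
  have "u < x \<or> (x < u \<and> u < y) \<or> y < u" using assms(1,4,5) by linarith
  moreover have "v < x \<or> (x < v \<and> v < y) \<or> y < v" using assms(1,3,6) by linarith
  moreover have "u < v \<or> v < u" using assms(2) by linarith
  ultimately show ?thesis using assms(1)
    by (elim disjE conjE) (simp_all add: min_def max_def)
qed

text \<open>The right-hand side is free of \<open>p\<close>. Over the pairs i < k, inversions and
  crossings combine by \<open>sgn_crossing_pair\<close> into the factors sgn (w i - b (p k)) with i
  and k distinct; the signs of the matched pairs supply the diagonal, and the complete product does
  not change when the \<open>b (p k)\<close> are reordered.\<close>

lemma sign_crossing_invariant:
  fixes w b :: "nat \<Rightarrow> nat"
  assumes w: "\<And>i k. i < k \<Longrightarrow> k < N \<Longrightarrow> w i < w k"
    and b: "\<And>i k. i < k \<Longrightarrow> k < N \<Longrightarrow> b i < b k"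
    and wb: "\<And>i k. i < N \<Longrightarrow> k < N \<Longrightarrow> w i \<noteq> b k"
    and p: "p permutes {..<N}"
    and lo: "\<And>i. lo i = min (w i) (b (p i))" and hi: "\<And>i. hi i = max (w i) (b (p i))"
  shows "sign p * (\<Prod>i<N. sgn (int (w i) - int (b (p i))))
        * (\<Prod>i<N. (-1) ^ card {k. k < N \<and> lo i < lo k \<and> lo k < hi i \<and> hi i < hi k})
       = (\<Prod>k<N. \<Prod>i<k. -1) * (\<Prod>i<N. \<Prod>k<N. sgn (int (w i) - int (b k)))"
proof -
  have lt: "p i < N" if "i < N" for i
    using p that by (metis lessThan_iff permutes_in_image)
  have ne: "p i \<noteq> p k" if "i \<noteq> k" for i k
    using permutes_inj[OF p] that by (metis injD)
  have bne: "b i \<noteq> b k" if "i \<noteq> k" "i < N" "k < N" for i k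
    using b[of i k] b[of k i] that by (cases "i < k") auto
  define W where "W i = int (w i)" for i
  define B where "B i = int (b (p i))" for i
  define t :: "nat \<Rightarrow> nat \<Rightarrow> int" where
    "t i k = (if lo i < lo k \<and> lo k < hi i \<and> hi i < hi k then -1 else 1)" for i k
  have sgb: "sgn (int (p k) - int (p i)) = sgn (B k - B i)" if "i < k" "k < N" for i k
  proof -
    have pk: "p i < N" "p k < N" using lt that by auto
    have "p i < p k \<or> p k < p i" using ne[of i k] that by linarith
    then show ?thesis using b[of "p i" "p k"] b[of "p k" "p i"] pk
      by (elim disjE) (simp_all add: B_def sgn_if)
  qed
  have "sign p = (\<Prod>k<N. \<Prod>i<k. sgn (B k - B i))"
    unfolding sign_eq_inversion_sign[OF p] inversion_sign_def
    by (intro prod.cong refl) (use sgb in auto)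
  moreover have "(\<Prod>i<N. (-1) ^ card {k. k < N \<and> lo i < lo k \<and> lo k < hi i \<and> hi i < hi k})
      = (\<Prod>i<N. \<Prod>k<N. t i k)"
  proof (intro prod.cong refl)
    fix i
    have "(\<Prod>k<N. t i k) = (\<Prod>k\<in>{k. k < N \<and> lo i < lo k \<and> lo k < hi i \<and> hi i < hi k}. -1)"
      unfolding t_def by (rule prod.mono_neutral_cong_right) auto
    then show "(-1) ^ card {k. k < N \<and> lo i < lo k \<and> lo k < hi i \<and> hi i < hi k} = (\<Prod>k<N. t i k)"
      by simp
  qed
  moreover have "(\<Prod>i<N. \<Prod>k<N. t i k) = (\<Prod>k<N. \<Prod>i<k. t i k * t k i)"
    by (subst prod_square_split) (simp add: t_def)
  ultimately have "sign p * (\<Prod>i<N. (-1) ^ card {k. k < N \<and> lo i < lo k \<and> lo k < hi i \<and> hi i < hi k})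
      = (\<Prod>k<N. \<Prod>i<k. sgn (B k - B i) * (t i k * t k i))"
    by (simp add: prod.distrib)
  also have "\<dots> = (\<Prod>k<N. \<Prod>i<k. - 1 * (sgn (W i - B k) * sgn (W k - B i)))"
  proof (intro prod.cong refl)
    fix k i assume ik: "k \<in> {..<N}" "i \<in> {..<k}"
    have i: "i < k" "k < N" "i < N" using ik by auto
    have 1: "W i < W k" using w[OF i(1,2)] by (simp add: W_def)
    have 2: "B i \<noteq> B k" using bne[OF ne lt lt] i by (simp add: B_def)
    have 3: "W i \<noteq> B k" "W k \<noteq> B i" "W i \<noteq> B i" "W k \<noteq> B k"
      using wb[OF i(3) lt[OF i(2)]] wb[OF i(2) lt[OF i(3)]] wb[OF i(3) lt[OF i(3)]] wb[OF i(2) lt[OF i(2)]]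
      by (simp_all only: W_def B_def of_nat_eq_iff not_False_eq_True)
    have mn: "min (W a) (B a) = int (lo a)" "max (W a) (B a) = int (hi a)" for a
      by (simp_all add: lo hi W_def B_def of_nat_min of_nat_max)
    show "sgn (B k - B i) * (t i k * t k i) = - 1 * (sgn (W i - B k) * sgn (W k - B i))"
      using sgn_crossing_pair[OF 1 2 3] unfolding mn of_nat_less_iff t_def .
  qed
  finally have *: "sign p * (\<Prod>i<N. (-1) ^ card {k. k < N \<and> lo i < lo k \<and> lo k < hi i \<and> hi i < hi k})
      = (\<Prod>k<N. \<Prod>i<k. -1) * (\<Prod>k<N. \<Prod>i<k. sgn (W i - B k) * sgn (W k - B i))"
    by (simp only: prod.distrib)
  have "(\<Prod>i<N. \<Prod>k<N. sgn (int (w i) - int (b k))) = (\<Prod>i<N. \<Prod>k<N. sgn (W i - B k))"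
  proof (rule prod.cong[OF refl])
    fix i
    show "(\<Prod>k<N. sgn (int (w i) - int (b k))) = (\<Prod>k<N. sgn (W i - B k))"
      unfolding W_def B_def by (rule prod.permute[OF p, of "\<lambda>k. sgn (int (w i) - int (b k))", unfolded comp_def])
  qed
  then have **: "(\<Prod>i<N. \<Prod>k<N. sgn (int (w i) - int (b k)))
      = (\<Prod>i<N. sgn (int (w i) - int (b (p i)))) * (\<Prod>k<N. \<Prod>i<k. sgn (W i - B k) * sgn (W k - B i))"
    unfolding prod_square_split[of "\<lambda>i k. sgn (W i - B k)"] by (simp only: W_def B_def)
  have alg: "s * c = u * v \<Longrightarrow> r = g * v \<Longrightarrow> s * g * c = u * r" for s c u v r g :: int
    by (metis mult.assoc mult.commute)
  show ?thesis by (rule alg[OF * **])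
qed

section \<open>Winding numbers of wrapped polygons\<close>

lemma norm_wrap [simp]: "cmod (wrap n s t) = \<bar>t\<bar>"
  by (simp add: wrap_def norm_mult)

text \<open>Exhibits a logarithm of the wrapped point, which makes
  \<open>winding_number_compose_exp\<close> applicable.\<close>

lemma wrap_eq_exp:
  assumes "0 < t"
  shows "wrap n s t = exp (Complex (ln t) (pi * s / real n))"
  using assms by (simp add: wrap_def exp_eq_polar exp_of_real flip: cis_conv_exp)

lemma wrap_eqD:
  assumes "wrap n s t = wrap n s' t'" "0 < t" "0 < t'" "0 < n"
  shows "t = t'" "\<exists>z::int. s - s' = 2 * real n * of_int z"
proof -
  show t: "t = t'"
  proof -
    have "cmod (wrap n s t) = cmod (wrap n s' t')" using assms(1) by simp
    then show ?thesis using assms(2,3) unfolding norm_wrap by simp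
  qed
  have "cis (pi * s / real n) = cis (pi * s' / real n)"
    using assms t by (simp add: wrap_def)
  then have "cis (pi * s / real n - pi * s' / real n) = 1"
    by (simp flip: cis_divide)
  then have "cos (pi * s / real n - pi * s' / real n) = 1"
    by (metis cis.sel(1) one_complex.sel(1))
  then obtain z :: int where "pi * s / real n - pi * s' / real n = of_int z * 2 * pi"
    using cos_one_2pi_int by blast
  then have "pi * (s - s') = pi * (2 * real n * of_int z)"
    using assms by (simp add: field_simps)
  then show "\<exists>z::int. s - s' = 2 * real n * of_int z"
    by (metis mult_left_cancel pi_neq_zero)
qed

lemma wrap_periodic:
  assumes "0 < n"
  shows "wrap n (s + 2 * real n * of_int z) t = wrap n s t"
proof -
  have "pi * (s + 2 * real n * of_int z) / real n = pi * s / real n + 2 * pi * of_int z"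
    using assms by (simp add: field_simps)
  then show ?thesis by (simp add: wrap_def flip: cis_mult)
qed

text \<open>The piecewise linear interpolation of \<open>a\<close>, written as a sum of clamped
  ramps: the k-th one rises from 0 to 1 on [k, k + 1]. In this form continuity needs no gluing of
  pieces.\<close>

definition polygonal :: "(nat \<Rightarrow> real) \<Rightarrow> nat \<Rightarrow> real \<Rightarrow> real" where
  "polygonal a l u = a 0 + (\<Sum>k<l. (a (Suc k) - a k) * max 0 (min 1 (u - real k)))"

lemma continuous_on_polygonal [continuous_intros]:
  "continuous_on S f \<Longrightarrow> continuous_on S (\<lambda>t. polygonal a l (f t))"
  unfolding polygonal_def by (intro continuous_intros)

lemma polygonal_interpolates:
  assumes "k < l" "0 \<le> r" "r \<le> 1"
  shows "polygonal a l (real k + r) = a k + r * (a (Suc k) - a k)"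
proof -
  have "(\<Sum>i<l. (a (Suc i) - a i) * max 0 (min 1 (real k + r - real i)))
      = (\<Sum>i<Suc k. (a (Suc i) - a i) * max 0 (min 1 (real k + r - real i)))"
    using assms by (intro sum.mono_neutral_right) auto
  also have "\<dots> = (\<Sum>i<k. a (Suc i) - a i) + (a (Suc k) - a k) * r"
    using assms by (auto intro!: sum.cong)
  finally show ?thesis
    by (simp add: polygonal_def sum_lessThan_telescope)
qed

lemma polygonal_start: "0 < l \<Longrightarrow> polygonal a l 0 = a 0"
  using polygonal_interpolates[of 0 l 0 a] by simp

lemma polygonal_end: "0 < l \<Longrightarrow> polygonal a l (real l) = a l"
  using polygonal_interpolates[of "l - 1" l 1 a] by (simp add: of_nat_diff)

lemma real_decompose_floor:
  assumes "0 \<le> t" "t < 1" "0 < (l::nat)"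
  obtains k r where "k < l" "0 \<le> r" "r < 1" "real l * t = real k + r"
proof
  let ?u = "real l * t"
  have u: "0 \<le> ?u" "?u < real l" using assms by auto
  have f: "real (nat \<lfloor>?u\<rfloor>) = of_int \<lfloor>?u\<rfloor>" using u(1) by (subst of_nat_nat) auto
  then show "nat \<lfloor>?u\<rfloor> < l"
    using u by (metis of_int_floor_le of_nat_less_iff order_le_less_trans)
  show "0 \<le> frac ?u" "frac ?u < 1" by (auto simp: frac_lt_1)
  show "?u = real (nat \<lfloor>?u\<rfloor>) + frac ?u" by (simp add: f frac_def)
qed

text \<open>In logarithmic polar coordinates the curve is a polygon, so its winding number can be read
  off from the end points of the lifted polygon; for a simple closed curve it is nonzero exactly
  when the curve encloses the origin.\<close>

lemma wrapped_polygon: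
  fixes a b :: "nat \<Rightarrow> real" and w :: int
  assumes n: "0 < n" and l: "0 < l" and b: "\<And>k. k \<le> l \<Longrightarrow> 1 \<le> b k"
    and closed: "b l = b 0" "a l = a 0 + 2 * real n * of_int w"
    and inj: "\<And>j k r s. j < l \<Longrightarrow> k < l \<Longrightarrow> 0 \<le> r \<Longrightarrow> r < 1 \<Longrightarrow> 0 \<le> s \<Longrightarrow> s < 1 \<Longrightarrow>
        wrap n (a j + r * (a (Suc j) - a j)) (b j + r * (b (Suc j) - b j))
        = wrap n (a k + s * (a (Suc k) - a k)) (b k + s * (b (Suc k) - b k)) \<Longrightarrow> j = k \<and> r = s"
  defines "S \<equiv> \<Union>k<l. (\<lambda>r. wrap n (a k + r * (a (Suc k) - a k)) (b k + r * (b (Suc k) - b k))) ` {0..1}"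
  shows "compact S" "w = 0 \<and> 0 \<notin> inside S \<or> \<bar>w\<bar> = 1 \<and> 0 \<in> inside S"
proof -
  define fa where "fa t = polygonal a l (real l * t)" for t
  define fb where "fb t = polygonal b l (real l * t)" for t
  define g where "g t = wrap n (fa t) (fb t)" for t
  have interp: "fa t = a k + r * (a (Suc k) - a k)" "fb t = b k + r * (b (Suc k) - b k)"
    if "real l * t = real k + r" "k < l" "0 \<le> r" "r \<le> 1" for t k r
    using that by (simp_all add: fa_def fb_def polygonal_interpolates)
  have ends: "fa 0 = a 0" "fa 1 = a l" "fb 0 = b 0" "fb 1 = b l"
    using l by (simp_all add: fa_def fb_def polygonal_start polygonal_end)
  have g1: "g 1 = g 0"
    unfolding g_def ends closed using wrap_periodic[OF n] by simp
  have decomp: "\<exists>k r. k < l \<and> 0 \<le> r \<and> r \<le> 1 \<and> real l * t = real k + r" if "t \<in> {0..1}" for t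
  proof (cases "t = 1")
    case True
    then show ?thesis using l by (intro exI[of _ "l - 1"] exI[of _ 1]) (auto simp: of_nat_diff)
  next
    case False
    then show ?thesis using that l real_decompose_floor[of t l]
      by (metis atLeastAtMost_iff less_eq_real_def)
  qed
  have fb1: "1 \<le> fb t" if t: "t \<in> {0..1}" for t
  proof -
    obtain k r where kr: "k < l" "0 \<le> r" "r \<le> 1" "real l * t = real k + r" using decomp t by blast
    have "fb t = (1 - r) * b k + r * b (Suc k)" using interp[OF kr(4,1-3)] by (simp add: algebra_simps)
    moreover have "(1 - r) * 1 + r * 1 \<le> (1 - r) * b k + r * b (Suc k)"
      using b[of k] b[of "Suc k"] kr by (intro add_mono mult_left_mono) auto
    ultimately show ?thesis by simp
  qed
  have img: "path_image g = S"
  proof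
    show "path_image g \<subseteq> S"
    proof
      fix z assume "z \<in> path_image g"
      then obtain t where t: "t \<in> {0..1}" "z = g t" by (auto simp: path_image_def)
      obtain k r where kr: "k < l" "0 \<le> r" "r \<le> 1" "real l * t = real k + r" using decomp t by blast
      show "z \<in> S" unfolding S_def t g_def interp[OF kr(4,1-3)]
        by (intro UN_I[of k] imageI) (use kr in auto)
    qed
    show "S \<subseteq> path_image g"
    proof
      fix z assume "z \<in> S"
      then obtain k r where kr: "k < l" "0 \<le> r" "r \<le> 1"
        and z: "z = wrap n (a k + r * (a (Suc k) - a k)) (b k + r * (b (Suc k) - b k))"
        by (auto simp: S_def)
      define t where "t = (real k + r) / real l"
      have lt: "real l * t = real k + r" using l by (simp add: t_def)
      have "real k + 1 \<le> real l" using kr by linarith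
      then have "t \<in> {0..1}" using kr l by (auto simp: t_def divide_simps)
      then show "z \<in> path_image g"
        using interp[OF lt kr] by (auto simp: path_image_def g_def z intro!: image_eqI[of _ _ t])
    qed
  qed
  have cont: "continuous_on {0..1} fa" "continuous_on {0..1} fb"
    unfolding fa_def fb_def by (intro continuous_intros)+
  \<comment> \<open>A continuous logarithm of \<open>g\<close>; the bound \<open>fb1\<close> keeps
    the argument of \<open>ln\<close> away from 0.\<close>
  define p where "p t = Complex (ln (fb t)) (pi * fa t / real n)" for t
  have "fb t \<noteq> 0" if "t \<in> {0..1}" for t using fb1[OF that] by simp
  then have pathp: "path p"
    unfolding path_def p_def Complex_eq using n
    by (intro continuous_intros cont) auto
  have gp: "g t = (exp \<circ> p) t" if "t \<in> {0..1}" for t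
    using fb1[OF that] by (simp add: g_def p_def wrap_eq_exp)
  have pathg: "path g"
    by (rule path_eq[OF path_continuous_image[OF pathp continuous_on_exp[OF continuous_on_id]]]) (use gp in auto)
  have loopg: "pathfinish g = pathstart g" using g1 by (simp add: pathfinish_def pathstart_def)
  have wn: "winding_number g 0 = of_int w"
  proof -
    have "winding_number g 0 = winding_number (exp \<circ> p) 0"
      using gp by (intro winding_number_cong) auto
    also have "\<dots> = (p 1 - p 0) / (2 * of_real pi * \<i>)"
      using winding_number_compose_exp[OF pathp] by (simp add: pathfinish_def pathstart_def)
    \<comment> \<open>The radii at both ends agree, and the angle has grown by pi / n times 2 n
      w.\<close>
    also have "p 1 - p 0 = of_int w * (2 * of_real pi * \<i>)"
      using n unfolding p_def ends closed by (simp add: complex_eq_iff field_simps)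
    finally show ?thesis by simp
  qed
  have inj01: "s = t" if st: "g s = g t" "0 \<le> s" "s < 1" "0 \<le> t" "t < 1" for s t
  proof -
    obtain j r where jr: "j < l" "0 \<le> r" "r < 1" "real l * s = real j + r"
      using real_decompose_floor[OF st(2,3) l] .
    obtain k q where kq: "k < l" "0 \<le> q" "q < 1" "real l * t = real k + q"
      using real_decompose_floor[OF st(4,5) l] .
    have r1: "r \<le> 1" "q \<le> 1" using jr kq by auto
    have "j = k \<and> r = q"
      using st(1) unfolding g_def interp[OF jr(4,1,2) r1(1)] interp[OF kq(4,1,2) r1(2)]
      by (rule inj[OF jr(1) kq(1) jr(2,3) kq(2,3)])
    then have "real l * s = real l * t" using jr kq by simp
    then show ?thesis using l by simp
  qed
  have simple: "simple_path g"
    unfolding simple_path_def loop_free_def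
  proof (intro conjI pathg ballI impI)
    fix s t :: real assume st: "s \<in> {0..1}" "t \<in> {0..1}" "g s = g t"
    consider "s < 1" "t < 1" | "s = 1" "t = 1" | "s = 1" "t < 1" | "s < 1" "t = 1"
      using st by fastforce
    then show "s = t \<or> s = 0 \<and> t = 1 \<or> s = 1 \<and> t = 0"
    proof cases
      case 1 then show ?thesis using inj01[of s t] st by auto
    next
      case 3
      then have "0 = t" using inj01[of 0 t] st g1 by auto
      then show ?thesis using 3 by auto
    next
      case 4
      then have "s = 0" using inj01[of s 0] st g1 by auto
      then show ?thesis using 4 by auto
    qed auto
  qed
  have z: "0 \<notin> path_image g"
  proof
    assume "0 \<in> path_image g"
    then obtain t where t: "t \<in> {0..1}" "g t = 0" by (auto simp: path_image_def)
    then have "cmod (g t) = 0" by simp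
    then show False using fb1[OF t(1)] by (simp add: g_def)
  qed
  show "compact S" using compact_path_image[OF pathg] img by simp
  show "w = 0 \<and> 0 \<notin> inside S \<or> \<bar>w\<bar> = 1 \<and> 0 \<in> inside S"
  proof (cases "0 \<in> inside S")
    case True
    then have "winding_number g 0 \<in> {-1, 1}"
      using simple_closed_path_winding_number_inside[OF simple] img by (metis insertCI)
    then have "w = -1 \<or> w = 1" unfolding wn
      by (metis insert_iff empty_iff of_int_1 of_int_eq_iff of_int_minus)
    then show ?thesis using True by auto
  next
    case False
    then have "0 \<in> outside (path_image g)" using z img inside_Un_outside by blast
    then have "winding_number g 0 = 0" by (rule winding_number_zero_in_outside[OF pathg loopg])
    then show ?thesis using False wn by simp
  qed
qed

text \<open>The hole |z| < 1 is connected and misses \<open>S\<close>, so the inside of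
  \<open>S\<close> contains all of it or none of it. Nothing inside lies beyond the outer circle,
  because the complement of the closed disc containing \<open>S\<close> is outside of
  \<open>S\<close>.\<close>

lemma inside_subset_annulus_iff:
  assumes "1 \<le> m" "compact S" "S \<subseteq> annulus m"
  shows "inside S \<subseteq> annulus m \<longleftrightarrow> 0 \<notin> inside S"
proof
  assume "inside S \<subseteq> annulus m"
  then show "0 \<notin> inside S" by (auto simp: annulus_def)
next
  assume z: "0 \<notin> inside S"
  have S: "S \<inter> ball 0 1 = {}" "S \<subseteq> cball 0 (real m)"
    using assms(3) by (auto simp: annulus_def)
  show "inside S \<subseteq> annulus m"
  proof
    fix x assume x: "x \<in> inside S"
    have "\<not> cmod x < 1"
    proof
      assume "cmod x < 1"
      then have "connected_component (- S) x 0"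
        unfolding connected_component_def
        by (intro exI[of _ "ball 0 1"] conjI) (use S(1) in \<open>auto intro: convex_connected\<close>)
      then show False using inside_same_component x z by blast
    qed
    moreover have "cmod x \<le> real m"
    proof (rule ccontr)
      assume "\<not> cmod x \<le> real m"
      then have "x \<in> outside S"
        using convex_in_outside[of "cball 0 (real m)" x] outside_mono[OF S(2)] by auto
      then show False using x inside_Int_outside by blast
    qed
    ultimately show "x \<in> annulus m" by (simp add: annulus_def)
  qed
qed

section \<open>Pairs of dimer covers\<close>

definition white :: "vertex \<Rightarrow> bool" where
  "white v \<longleftrightarrow> odd (fst v + snd v)"

text \<open>The circumference is even, so the chessboard colouring is consistent across the
  seam.\<close>

lemma even_mod_double: "even (a mod (2 * n)) \<longleftrightarrow> even (a :: nat)"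
  by (metis dvd_mod_iff dvd_triv_left)

lemma finite_cyl_edges [simp]: "finite (cyl_edges n m)"
proof -
  have "cyl_edges n m \<subseteq> case_prod Hor ` ({..<2*n} \<times> {..m}) \<union> case_prod Ver ` ({..<2*n} \<times> {..m})"
    by (auto simp: cyl_edges_def image_iff)
  then show ?thesis by (rule finite_subset) auto
qed

lemma Hor_in_cyl_edges [simp]: "Hor x j \<in> cyl_edges n m \<longleftrightarrow> x < 2 * n \<and> 1 \<le> j \<and> j \<le> m"
  by (auto simp: cyl_edges_def)

lemma Ver_in_cyl_edges [simp]: "Ver x j \<in> cyl_edges n m \<longleftrightarrow> x < 2 * n \<and> 1 \<le> j \<and> j < m"
  by (auto simp: cyl_edges_def)

lemma dimer_covers_subset: "M \<in> dimer_covers n m \<Longrightarrow> M \<subseteq> cyl_edges n m"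
  by (simp add: dimer_covers_def)

lemma finite_dimer_cover: "M \<in> dimer_covers n m \<Longrightarrow> finite M"
  by (rule finite_subset[OF dimer_covers_subset finite_cyl_edges])

lemma finite_dimer_covers [simp]: "finite (dimer_covers n m)"
  by (rule finite_subset[of _ "Pow (cyl_edges n m)"]) (auto dest: dimer_covers_subset)

lemma ends_subset_vertices:
  assumes "e \<in> cyl_edges n m"
  shows "ends n e \<subseteq> cyl_vertices n m"
proof (cases e)
  case (Hor x j)
  then have "x < 2 * n" "1 \<le> j" "j \<le> m" using assms by (auto simp: cyl_edges_def)
  moreover from this have "(x + 1) mod (2 * n) < 2 * n" by (intro mod_less_divisor) linarith
  ultimately show ?thesis unfolding Hor ends.simps cyl_vertices_def by simp
next
  case (Ver x j)
  then have "x < 2 * n" "1 \<le> j" "j < m" using assms by (auto simp: cyl_edges_def)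
  then show ?thesis unfolding Ver ends.simps cyl_vertices_def by simp
qed

lemma ends_Hor_Ver_neq:
  fixes x n :: nat
  assumes "x < 2 * n" "2 \<le> n"
  shows "(x + 1) mod (2 * n) \<noteq> x"
proof (cases "x + 1 < 2 * n")
  case False
  then have "x + 1 = 2 * n" using assms by simp
  then show ?thesis using assms by simp
qed simp

text \<open>For n = 1 the edges \<open>Hor 0 j\<close> and \<open>Hor 1 j\<close> have the same
  ends; this is the origin of the bound 2 \<le> n in all that follows.\<close>

lemma ends_inject:
  assumes "2 \<le> n" "e \<in> cyl_edges n m" "f \<in> cyl_edges n m" "ends n e = ends n f"
  shows "e = f"
proof -
  have succ: "(x + 1) mod (2 * n) = (if x + 1 = 2 * n then 0 else x + 1)" if "x < 2 * n" for x
    using that by auto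
  show ?thesis
  proof (cases e; cases f)
    fix x j y k assume ef: "e = Hor x j" "f = Hor y k"
    then have "x < 2 * n" "y < 2 * n" using assms by (auto simp: cyl_edges_def)
    then show "e = f" using assms(1,4) unfolding ef ends.simps succ[OF \<open>x < 2*n\<close>] succ[OF \<open>y < 2*n\<close>]
      by (auto simp: doubleton_eq_iff split: if_splits)
  next
    fix x j y k assume ef: "e = Hor x j" "f = Ver y k"
    then have "x < 2 * n" using assms by (auto simp: cyl_edges_def)
    then show "e = f" using assms(1,4) ends_Hor_Ver_neq[of x n] unfolding ef ends.simps
      by (auto simp: doubleton_eq_iff)
  next
    fix x j y k assume ef: "e = Ver y k" "f = Hor x j"
    then have "x < 2 * n" using assms by (auto simp: cyl_edges_def)
    then show "e = f" using assms(1,4) ends_Hor_Ver_neq[of x n] unfolding ef ends.simps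
      by (auto simp: doubleton_eq_iff)
  next
    fix x j y k assume ef: "e = Ver x j" "f = Ver y k"
    then show "e = f" using assms(4) unfolding ef ends.simps by (auto simp: doubleton_eq_iff)
  qed
qed

lemma ends_white_black:
  obtains u v where "ends n e = {u, v}" "white u" "\<not> white v"
proof (cases e)
  case (Hor x j)
  have p: "even ((x + 1) mod (2 * n) + j) \<longleftrightarrow> odd (x + j)"
    by (simp add: even_mod_double) blast
  show ?thesis
  proof (cases "white (x, j)")
    case True
    then show ?thesis using that[of "(x, j)" "((x + 1) mod (2 * n), j)"] p by (simp add: Hor white_def)
  next
    case False
    then show ?thesis using that[of "((x + 1) mod (2 * n), j)" "(x, j)"] p
      by (simp add: Hor white_def insert_commute)
  qed
next
  case (Ver x j)
  show ?thesis
  proof (cases "white (x, j)")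
    case True
    then show ?thesis using that[of "(x, j)" "(x, j + 1)"] by (simp add: Ver white_def)
  next
    case False
    then show ?thesis using that[of "(x, j + 1)" "(x, j)"] by (simp add: Ver white_def insert_commute)
  qed
qed

lemma ends_same_colour:
  assumes "u \<in> ends n e" "v \<in> ends n e" "white u \<longleftrightarrow> white v"
  shows "u = v"
  using assms by (rule_tac ends_white_black[of n e]) auto

lemma cover_edge_exists:
  assumes "M \<in> dimer_covers n m" "v \<in> cyl_vertices n m"
  obtains e where "e \<in> M" "v \<in> ends n e"
  using assms unfolding dimer_covers_def by blast

lemma cover_edge_unique:
  assumes "M \<in> dimer_covers n m" "e \<in> M" "f \<in> M" "v \<in> ends n e" "v \<in> ends n f"
  shows "e = f"
proof -
  have "v \<in> cyl_vertices n m"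
    using assms ends_subset_vertices dimer_covers_subset by blast
  then show ?thesis using assms unfolding dimer_covers_def by blast
qed

section \<open>Double-dimer configurations and their loops\<close>

lemma double_dimer_configs_subset: "C \<in> double_dimer_configs n m \<Longrightarrow> C \<subseteq> cyl_edges n m"
  using dimer_covers_subset by (auto simp: double_dimer_configs_def)

lemma finite_double_dimer_configs [simp]: "finite (double_dimer_configs n m)"
  by (rule finite_subset[of _ "Pow (cyl_edges n m)"]) (auto dest: double_dimer_configs_subset)

text \<open>The reflexive closure relates every edge to itself, also those outside \<open>C\<close>,
  hence \<open>UNIV\<close>; \<open>touching_class_subset\<close> brings the classes of edges of
  \<open>C\<close> back into \<open>C\<close>.\<close>

lemma equiv_touching: "equiv UNIV ((touching n C)\<^sup>*)"
proof (rule equivI)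
  have "sym (touching n C)" by (auto simp: sym_def touching_def)
  then show "sym ((touching n C)\<^sup>*)" by (rule sym_rtrancl)
qed (auto simp: refl_rtrancl trans_rtrancl)

lemma touching_class_subset: "(touching n C)\<^sup>* `` {e} \<subseteq> insert e C"
proof
  fix f assume "f \<in> (touching n C)\<^sup>* `` {e}"
  then have "(e, f) \<in> (touching n C)\<^sup>*" by simp
  then show "f \<in> insert e C" by cases (auto simp: touching_def)
qed

lemma loopsE:
  assumes "L \<in> loops n C"
  obtains e where "e \<in> C" "L = (touching n C)\<^sup>* `` {e}"
  using assms by (auto simp: loops_def elim: quotientE)

lemma loop_subset: "L \<in> loops n C \<Longrightarrow> L \<subseteq> C"
  using loopsE touching_class_subset by (metis insert_absorb)

lemma finite_loops: "finite C \<Longrightarrow> finite (loops n C)"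
  by (rule finite_subset[of _ "Pow C"]) (auto dest: loop_subset)

lemma loop_closed:
  assumes "L \<in> loops n C" "e \<in> L" "f \<in> C" "ends n e \<inter> ends n f \<noteq> {}"
  shows "f \<in> L"
proof -
  obtain e0 where e0: "e0 \<in> C" "L = (touching n C)\<^sup>* `` {e0}" using assms(1) by (rule loopsE)
  have "(e, f) \<in> touching n C"
    using assms loop_subset by (auto simp: touching_def)
  then show ?thesis using e0 assms(2) by (auto intro: rtrancl_into_rtrancl)
qed

lemma loops_disjoint:
  assumes "L \<in> loops n C" "L' \<in> loops n C" "L \<noteq> L'"
  shows "L \<inter> L' = {}"
proof -
  have "L \<in> UNIV // (touching n C)\<^sup>*" "L' \<in> UNIV // (touching n C)\<^sup>*"
    using assms by (auto simp: loops_def quotient_def)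
  then show ?thesis using quotient_disj[OF equiv_touching] assms(3) by blast
qed

text \<open>A loop is a single class, so a property that passes between touching edges spreads from
  any edge to the whole loop. The induction step offers \<open>f \<noteq> g\<close> because the
  alternation of the covers is available only for distinct edges.\<close>

lemma loop_induct [consumes 2, case_names touch]:
  assumes "L \<in> loops n C" "e \<in> L"
    and step: "\<And>f g. f \<in> L \<Longrightarrow> g \<in> L \<Longrightarrow> ends n f \<inter> ends n g \<noteq> {} \<Longrightarrow> f \<noteq> g \<Longrightarrow> P f \<Longrightarrow> P g"
    and "P e" "f \<in> L"
  shows "P f"
proof -
  obtain e0 where e0: "L = (touching n C)\<^sup>* `` {e0}" using assms(1) by (rule loopsE)
  have "(e, e0) \<in> (touching n C)\<^sup>*" "(e0, f) \<in> (touching n C)\<^sup>*"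
    using equiv_touching[of n C] assms(2,5) e0 by (auto simp: equiv_def dest: symD)
  then have "(e, f) \<in> (touching n C)\<^sup>*" by simp
  then have "P f \<and> f \<in> L"
  proof induction
    case base then show ?case using assms by simp
  next
    case (step f g)
    have "ends n f \<inter> ends n g \<noteq> {}" "g \<in> C" using step by (auto simp: touching_def)
    moreover from this have "g \<in> L" using step loop_closed[OF assms(1)] by blast
    ultimately show ?case using step assms(3)[of f g] by (cases "f = g") auto
  qed
  then show ?thesis by simp
qed

text \<open>If nothing else in \<open>L\<close> touched \<open>e\<close>, induction along the loop
  would confine \<open>L\<close> to the single edge \<open>e\<close>, against its size of at least
  2.\<close>

lemma loop_neighbour:
  assumes "L \<in> loops n C" "e \<in> L"
  obtains f where "f \<in> L" "f \<noteq> e" "ends n e \<inter> ends n f \<noteq> {}"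
proof (rule ccontr)
  note obt = that
  assume no: "\<not> thesis"
  have "f = e" if "f \<in> L" for f
    using assms(1,2)
  proof (induction rule: loop_induct[where P = "\<lambda>f. f = e"])
    case (touch f g)
    then show ?case using no obt[of g] by blast
  qed (use that in auto)
  then have "L \<subseteq> {e}" by blast
  then have "card L \<le> 1" using card_mono[of "{e}" L] by simp
  then show False using assms(1) by (simp add: loops_def)
qed

section \<open>Exchanging two covers along loops\<close>

locale two_covers =
  fixes n m :: nat and M N :: "edge set"
  assumes n2: "2 \<le> n" and M: "M \<in> dimer_covers n m" and N: "N \<in> dimer_covers n m"
begin

abbreviation C where "C \<equiv> M \<union> N"

lemma finite_C: "finite C"
  using finite_dimer_cover[OF M] finite_dimer_cover[OF N] by simp

text \<open>Two distinct edges with a common vertex cannot belong to the same cover. This makes the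
  covers alternate along a loop and excludes doubled edges from it.\<close>

lemma touching_alternates:
  assumes "e \<in> C" "f \<in> C" "e \<noteq> f" "ends n e \<inter> ends n f \<noteq> {}"
  shows "e \<in> M \<and> e \<notin> N \<and> f \<notin> M \<and> f \<in> N \<or> e \<notin> M \<and> e \<in> N \<and> f \<in> M \<and> f \<notin> N"
proof -
  obtain v where "v \<in> ends n e" "v \<in> ends n f" using assms by blast
  then have "\<not> (e \<in> M \<and> f \<in> M)" "\<not> (e \<in> N \<and> f \<in> N)"
    using cover_edge_unique[OF M] cover_edge_unique[OF N] assms(3) by blast+
  then show ?thesis using assms by blast
qed

lemma loop_edge_alternates:
  assumes "L \<in> loops n C" "e \<in> L"
  shows "e \<in> M \<longleftrightarrow> e \<notin> N"
proof -
  obtain f where "f \<in> L" "f \<noteq> e" "ends n e \<inter> ends n f \<noteq> {}" using assms by (rule loop_neighbour)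
  then show ?thesis using touching_alternates[of e f] loop_subset[OF assms(1)] assms(2) by blast
qed

text \<open>Each cover has an edge at an end \<open>v\<close> of \<open>e\<close>. Were it different
  from \<open>e\<close>, the class of \<open>e\<close> would have two elements and be a
  loop.\<close>

lemma non_loop_edge_doubled:
  assumes "e \<in> C" "e \<notin> \<Union> (loops n C)"
  shows "e \<in> M" "e \<in> N"
proof -
  have edge: "e \<in> cyl_edges n m" using assms(1) M N dimer_covers_subset by blast
  obtain v where v: "v \<in> ends n e" "v \<in> cyl_vertices n m"
    using ends_subset_vertices[OF edge] by (cases rule: ends_white_black[of n e]) auto
  have all_eq: "f = e" if "f \<in> C" "v \<in> ends n f" for f
  proof (rule ccontr)
    assume "f \<noteq> e"
    let ?L = "(touching n C)\<^sup>* `` {e}"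
    have "(e, f) \<in> touching n C" using that v assms(1) by (auto simp: touching_def)
    then have sub: "{e, f} \<subseteq> ?L" by auto
    have "finite ?L"
      using finite_subset[OF touching_class_subset] finite_C by (metis finite_insert)
    then have "2 \<le> card ?L" using card_mono[OF _ sub] \<open>f \<noteq> e\<close> by simp
    moreover have "?L \<in> C // (touching n C)\<^sup>*" using assms(1) by (rule quotientI)
    ultimately have "?L \<in> loops n C" by (simp add: loops_def)
    then show False using assms(2) sub by blast
  qed
  obtain f where "f \<in> M" "v \<in> ends n f" using cover_edge_exists[OF M v(2)] .
  then show "e \<in> M" using all_eq[of f] by blast
  obtain f where "f \<in> N" "v \<in> ends n f" using cover_edge_exists[OF N v(2)] .
  then show "e \<in> N" using all_eq[of f] by blast
qed

text \<open>The first cover of the pair obtained by exchanging \<open>A\<close> and \<open>B\<close>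
  along the loops in \<open>S\<close>; the second one is \<open>swap B A S\<close>.\<close>

definition swap :: "edge set \<Rightarrow> edge set \<Rightarrow> edge set set \<Rightarrow> edge set" where
  "swap A B S = (A - \<Union>S) \<union> (B \<inter> \<Union>S)"

end

text \<open>Loops are closed under touching, so at a given vertex the edges of both covers lie on
  loops of \<open>S\<close> or neither does. There the new set therefore looks like \<open>N\<close>
  or like \<open>M\<close>.\<close>

lemma (in two_covers) swap_cover:
  assumes S: "S \<subseteq> loops n C"
  shows "swap M N S \<in> dimer_covers n m"
  unfolding dimer_covers_def mem_Collect_eq
proof (intro conjI ballI)
  show "swap M N S \<subseteq> cyl_edges n m"
    using dimer_covers_subset[OF M] dimer_covers_subset[OF N] by (auto simp: swap_def)
  fix v assume v: "v \<in> cyl_vertices n m"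
  obtain e where e: "e \<in> M" "v \<in> ends n e" using cover_edge_exists[OF M v] .
  obtain f where f: "f \<in> N" "v \<in> ends n f" using cover_edge_exists[OF N v] .
  have closed: "h \<in> \<Union>S" if "g \<in> \<Union>S" "v \<in> ends n g" "v \<in> ends n h" "h \<in> C" for g h
    using that S loop_closed[of _ n C g h] by blast
  show "\<exists>!g. g \<in> swap M N S \<and> v \<in> ends n g"
  proof (cases "e \<in> \<Union>S")
    case True
    then have "f \<in> \<Union>S" using closed e f by blast
    show ?thesis
    proof (rule ex1I[of _ f])
      show "f \<in> swap M N S \<and> v \<in> ends n f" using f \<open>f \<in> \<Union>S\<close> by (simp add: swap_def)
      fix g assume g: "g \<in> swap M N S \<and> v \<in> ends n g"
      then show "g = f"
        using cover_edge_unique[OF N _ f(1) _ f(2)] cover_edge_unique[OF M _ e(1) _ e(2)] True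
        unfolding swap_def by blast
    qed
  next
    case False
    show ?thesis
    proof (rule ex1I[of _ e])
      show "e \<in> swap M N S \<and> v \<in> ends n e" using e False by (simp add: swap_def)
      fix g assume g: "g \<in> swap M N S \<and> v \<in> ends n g"
      have "g \<notin> \<Union>S" using closed[of g e] False e g by blast
      then show "g = e" using g cover_edge_unique[OF M _ e(1) _ e(2)]
        unfolding swap_def by blast
    qed
  qed
qed

context two_covers
begin

lemma two_covers_swapped: "two_covers n m N M"
  using n2 M N by unfold_locales

lemma swap_cover':
  assumes S: "S \<subseteq> loops n C"
  shows "swap N M S \<in> dimer_covers n m"
  using two_covers.swap_cover[OF two_covers_swapped] S
  by (simp add: Un_commute two_covers.swap_def[OF two_covers_swapped] swap_def)

lemma swap_Un:
  shows "swap M N S \<union> swap N M S = C"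
  by (auto simp: swap_def)

text \<open>Pairs with the same union have the same loops and the same doubled edges. All that is
  free is which alternating half of each loop goes to the first cover, and \<open>S\<close> collects
  the loops where this choice departs from \<open>(M, N)\<close>.\<close>

lemma swap_bij:
  "bij_betw (\<lambda>S. (swap M N S, swap N M S)) (Pow (loops n C))
     {(M', N'). M' \<in> dimer_covers n m \<and> N' \<in> dimer_covers n m \<and> M' \<union> N' = C}"
proof (rule bij_betwI')
  fix S T assume ST: "S \<in> Pow (loops n C)" "T \<in> Pow (loops n C)"
  have sub: "S \<subseteq> T" if S: "S \<subseteq> loops n C" and T: "T \<subseteq> loops n C" and eq: "swap M N S = swap M N T" for S T
  proof
    fix L assume L: "L \<in> S"
    then have Ll: "L \<in> loops n C" using S by blast
    then have "L \<noteq> {}" by (auto simp: loops_def)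
    then obtain e where e: "e \<in> L" by blast
    have alt: "e \<in> M \<longleftrightarrow> e \<notin> N" using loop_edge_alternates[OF Ll e] .
    have "e \<in> \<Union>T" using eq alt L e unfolding swap_def by blast
    then obtain L' where "L' \<in> T" "e \<in> L'" by blast
    then have "L' = L" using loops_disjoint[of L' n C L] Ll T e by blast
    then show "L \<in> T" using \<open>L' \<in> T\<close> by simp
  qed
  show "((swap M N S, swap N M S) = (swap M N T, swap N M T)) = (S = T)"
    using sub[of S T] sub[of T S] ST by auto
next
  fix S assume "S \<in> Pow (loops n C)"
  then show "(swap M N S, swap N M S) \<in> {(M', N'). M' \<in> dimer_covers n m \<and> N' \<in> dimer_covers n m \<and> M' \<union> N' = C}"
    using swap_cover swap_cover' swap_Un by auto
next
  fix y assume "y \<in> {(M', N'). M' \<in> dimer_covers n m \<and> N' \<in> dimer_covers n m \<and> M' \<union> N' = C}"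
  then obtain M' N' where y: "y = (M', N')" "M' \<in> dimer_covers n m" "N' \<in> dimer_covers n m" "M' \<union> N' = C"
    by auto
  interpret P': two_covers n m M' N' using n2 y by unfold_locales
  define S where "S = {L \<in> loops n C. M' \<inter> L \<noteq> M \<inter> L}"
  \<comment> \<open>A disagreement of \<open>M'\<close> and \<open>M\<close> at one edge of a loop
    extends to all its edges.\<close>
  have const: "e \<in> M' \<longleftrightarrow> e \<notin> M" if L: "L \<in> S" and e: "e \<in> L" for L e
  proof -
    have Ll: "L \<in> loops n C" using L by (simp add: S_def)
    obtain e0 where e0: "e0 \<in> L" "e0 \<in> M' \<longleftrightarrow> e0 \<notin> M" using L by (auto simp: S_def)
    show ?thesis
      using Ll e0(1)
    proof (induction rule: loop_induct[where P = "\<lambda>e. e \<in> M' \<longleftrightarrow> e \<notin> M"])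
      case (touch f g)
      have fg: "f \<in> C" "g \<in> C" using loop_subset[OF Ll] touch(1,2) by blast+
      have fg': "f \<in> M' \<union> N'" "g \<in> M' \<union> N'" using fg unfolding y(4) by simp_all
      \<comment> \<open>Both pairs of covers alternate between the touching edges \<open>f\<close>
        and \<open>g\<close>, so membership in \<open>M\<close> and in \<open>M'\<close> flips
        simultaneously.\<close>
      show ?case
        using touching_alternates[OF fg touch(4,3)] P'.touching_alternates[OF fg' touch(4,3)] touch(5) by argo
    qed (use e e0 in auto)
  qed
  have loopwise: "e \<in> M' \<longleftrightarrow> e \<in> swap M N S" "e \<in> N' \<longleftrightarrow> e \<in> swap N M S" for e
  proof -
    have "(e \<in> M' \<longleftrightarrow> e \<in> swap M N S) \<and> (e \<in> N' \<longleftrightarrow> e \<in> swap N M S)"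
    proof (cases "e \<in> C")
      case False
      then have "e \<notin> M' \<union> N'" unfolding y(4) .
      then show ?thesis using False unfolding swap_def by blast
    next
      case eC: True
      show ?thesis
      proof (cases "e \<in> \<Union> (loops n C)")
        case False
        then have "e \<notin> \<Union>S" by (auto simp: S_def)
        then show ?thesis
          using non_loop_edge_doubled[OF eC False] P'.non_loop_edge_doubled[of e] eC False
          unfolding y(4) swap_def by blast
      next
        case True
        then obtain L where L: "L \<in> loops n C" "e \<in> L" by blast
        have alt: "e \<in> M \<longleftrightarrow> e \<notin> N" "e \<in> M' \<longleftrightarrow> e \<notin> N'"
          using loop_edge_alternates[OF L] P'.loop_edge_alternates[of L e] L unfolding y(4) by blast+
        show ?thesis
        proof (cases "L \<in> S")
          case True
          then have "e \<in> \<Union>S" using L by blast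
          then show ?thesis using alt const[OF True L(2)] unfolding swap_def by blast
        next
          case False
          have "e \<notin> \<Union>S"
          proof
            assume "e \<in> \<Union>S"
            then obtain L' where "L' \<in> S" "e \<in> L'" by blast
            then have "L' = L" using loops_disjoint[of L' n C L] L by (auto simp: S_def)
            then show False using \<open>L' \<in> S\<close> False by simp
          qed
          moreover have "e \<in> M' \<longleftrightarrow> e \<in> M" using False L unfolding S_def by blast
          ultimately show ?thesis using alt unfolding swap_def by blast
        qed
      qed
    qed
    then show "e \<in> M' \<longleftrightarrow> e \<in> swap M N S" "e \<in> N' \<longleftrightarrow> e \<in> swap N M S" by auto
  qed
  then have "y = (swap M N S, swap N M S)" unfolding y(1) by blast
  moreover have "S \<in> Pow (loops n C)" by (auto simp: S_def)
  ultimately show "\<exists>S\<in>Pow (loops n C). y = (swap M N S, swap N M S)" by blast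
qed

text \<open>Separates the doubled edges, which no exchange affects, from the halves of the loops, so
  that the choices on different loops become independent factors.\<close>

lemma prod_swap:
  fixes wt :: "edge \<Rightarrow> complex"
  assumes S: "S \<subseteq> loops n C"
  shows "prod wt (swap M N S) = prod wt (C - \<Union>(loops n C))
     * ((\<Prod>L\<in>S. prod wt (N \<inter> L)) * (\<Prod>L\<in>loops n C - S. prod wt (M \<inter> L)))"
proof -
  have fl: "finite (loops n C)" by (rule finite_loops[OF finite_C])
  have fS: "finite S" "finite (loops n C - S)" using S fl finite_subset by auto
  have fin: "finite M" "finite N" using finite_C by auto
  have disj: "L \<inter> L' = {}" if "L \<in> loops n C" "L' \<in> loops n C" "L \<noteq> L'" for L L'
    using loops_disjoint that by blast
  have Sm: "\<Union>S \<inter> \<Union>(loops n C - S) = {}" using disj S by blast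
  have eq: "swap M N S = (C - \<Union>(loops n C)) \<union> (\<Union>L\<in>S. N \<inter> L) \<union> (\<Union>L\<in>loops n C - S. M \<inter> L)"
  proof -
    have "C - \<Union>(loops n C) = M - \<Union>(loops n C)"
      using non_loop_edge_doubled by blast
    moreover have "M - \<Union>S = (M - \<Union>(loops n C)) \<union> (M \<inter> \<Union>(loops n C - S))"
      using Sm S by blast
    ultimately show ?thesis by (auto simp: swap_def)
  qed
  have u1: "prod wt (\<Union>L\<in>S. N \<inter> L) = (\<Prod>L\<in>S. prod wt (N \<inter> L))"
  proof (rule prod.UNION_disjoint)
    show "\<forall>i\<in>S. \<forall>j\<in>S. i \<noteq> j \<longrightarrow> N \<inter> i \<inter> (N \<inter> j) = {}" using disj S by blast
  qed (use fS fin in auto)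
  have u2: "prod wt (\<Union>L\<in>loops n C - S. M \<inter> L) = (\<Prod>L\<in>loops n C - S. prod wt (M \<inter> L))"
  proof (rule prod.UNION_disjoint)
    show "\<forall>i\<in>loops n C - S. \<forall>j\<in>loops n C - S. i \<noteq> j \<longrightarrow> M \<inter> i \<inter> (M \<inter> j) = {}" using disj by blast
  qed (use fS fin in auto)
  have 1: "prod wt (swap M N S) = prod wt ((C - \<Union>(loops n C)) \<union> (\<Union>L\<in>S. N \<inter> L)) * prod wt (\<Union>L\<in>loops n C - S. M \<inter> L)"
    unfolding eq
  proof (rule prod.union_disjoint)
    show "(C - \<Union>(loops n C) \<union> (\<Union>L\<in>S. N \<inter> L)) \<inter> (\<Union>L\<in>loops n C - S. M \<inter> L) = {}" using Sm S by blast
  qed (use fS fin in auto)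
  have 2: "prod wt ((C - \<Union>(loops n C)) \<union> (\<Union>L\<in>S. N \<inter> L)) = prod wt (C - \<Union>(loops n C)) * prod wt (\<Union>L\<in>S. N \<inter> L)"
  proof (rule prod.union_disjoint)
    show "(C - \<Union>(loops n C)) \<inter> (\<Union>L\<in>S. N \<inter> L) = {}" using S by blast
  qed (use fS fin in auto)
  show ?thesis unfolding 1 2 u1 u2 by (rule mult.assoc)
qed

lemma prod_swap':
  fixes wt :: "edge \<Rightarrow> complex"
  assumes S: "S \<subseteq> loops n C"
  shows "prod wt (swap N M S) = prod wt (C - \<Union>(loops n C))
     * ((\<Prod>L\<in>S. prod wt (M \<inter> L)) * (\<Prod>L\<in>loops n C - S. prod wt (N \<inter> L)))"
  by (rule two_covers.prod_swap[OF two_covers_swapped, of S wt, unfolded Un_commute[of N M], OF S])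

text \<open>A doubled edge contributes \<open>wt e * wi e\<close>, which is 1. What remains is a sum
  over sets \<open>S\<close> of exchanged loops, and \<open>prod_add\<close> identifies it as the
  expansion of a product of two-term sums.\<close>

lemma sum_pairs_with_union:
  fixes wt wi :: "edge \<Rightarrow> complex"
  assumes inv: "\<And>e. wt e * wi e = 1"
  shows "(\<Sum>(M', N') | M' \<in> dimer_covers n m \<and> N' \<in> dimer_covers n m \<and> M' \<union> N' = C. prod wt M' * prod wi N')
     = (\<Prod>L\<in>loops n C. prod wt (N \<inter> L) * prod wi (M \<inter> L) + prod wt (M \<inter> L) * prod wi (N \<inter> L))"
proof -
  have "(\<Sum>(M', N') | M' \<in> dimer_covers n m \<and> N' \<in> dimer_covers n m \<and> M' \<union> N' = C. prod wt M' * prod wi N')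
      = (\<Sum>S\<in>Pow (loops n C). prod wt (swap M N S) * prod wi (swap N M S))"
    using sum.reindex_bij_betw[OF swap_bij, of "\<lambda>(M', N'). prod wt M' * prod wi N'"] by simp
  also have "\<dots> = (\<Sum>S\<in>Pow (loops n C). (\<Prod>L\<in>S. prod wt (N \<inter> L) * prod wi (M \<inter> L))
       * (\<Prod>L\<in>loops n C - S. prod wt (M \<inter> L) * prod wi (N \<inter> L)))"
  proof (rule sum.cong[OF refl])
    fix S assume "S \<in> Pow (loops n C)"
    then have S: "S \<subseteq> loops n C" by simp
    have 1: "prod wt A * prod wi A = 1" for A
      by (simp add: inv flip: prod.distrib)
    have 2: "(c * (p * q)) * (d * (r * s)) = (c * d) * ((p * r) * (q * s))" for c d p q r s :: complex
      by (simp only: mult_ac)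
    show "prod wt (swap M N S) * prod wi (swap N M S) = (\<Prod>L\<in>S. prod wt (N \<inter> L) * prod wi (M \<inter> L))
       * (\<Prod>L\<in>loops n C - S. prod wt (M \<inter> L) * prod wi (N \<inter> L))"
      unfolding prod_swap[OF S] prod_swap'[OF S] prod.distrib 2 1 by (rule mult_1)
  qed
  also have "\<dots> = (\<Prod>L\<in>loops n C. prod wt (N \<inter> L) * prod wi (M \<inter> L) + prod wt (M \<inter> L) * prod wi (N \<inter> L))"
    by (rule prod_add[symmetric, OF finite_loops[OF finite_C]])
  finally show ?thesis .
qed

end

section \<open>Winding numbers of loops\<close>

fun edge_point :: "nat \<Rightarrow> edge \<Rightarrow> real \<Rightarrow> complex" where
  "edge_point n (Hor x j) s = wrap n (real x + s) (real j)"
| "edge_point n (Ver x j) s = wrap n (real x) (real j + s)"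

lemma edge_arc_eq: "edge_arc n e = edge_point n e ` {0..1}"
proof -
  have shift: "f ` {real x..real x + 1} = (\<lambda>s. f (real x + s)) ` {0..1}" for f :: "real \<Rightarrow> complex" and x
  proof -
    have "{real x..real x + 1} = (\<lambda>s. real x + s) ` {0..1}" by (simp add: add.commute)
    then show ?thesis by (simp only: image_image)
  qed
  show ?thesis
  proof (cases e)
    case (Hor x j)
    have "edge_point n e = (\<lambda>s. wrap n (real x + s) (real j))" by (rule ext) (simp add: Hor)
    then show ?thesis by (simp only: Hor edge_arc.simps shift)
  next
    case (Ver x j)
    have "edge_point n e = (\<lambda>s. wrap n (real x) (real j + s))" by (rule ext) (simp add: Ver)
    then show ?thesis by (simp only: Ver edge_arc.simps shift)
  qed
qed

lemma of_nat_add_frac_eqD: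
  assumes "real j + s = real k + t" "0 \<le> s" "s < 1" "0 \<le> t" "t < 1"
  shows "j = k" "s = t"
proof -
  have "real j < real k + 1" "real k < real j + 1" using assms by linarith+
  then have "j = k" by linarith
  then show "j = k" "s = t" using assms(1) by simp_all
qed

text \<open>The columns agree modulo 2 n by \<open>wrap_eqD\<close>, and both lie in [0, 2 n), so
  the multiple of 2 n between them is 0.\<close>

lemma wrap_column_eqD:
  assumes "wrap n (real x + s) u = wrap n (real y + t) w" "0 < u" "0 < w" "x < 2 * n" "y < 2 * n"
    "0 \<le> s" "s < 1" "0 \<le> t" "t < 1"
  shows "x = y" "s = t" "u = w"
proof -
  have n: "0 < n" using assms by simp
  show "u = w" using wrap_eqD(1)[OF assms(1-3) n] .
  obtain z :: int where z: "(real x + s) - (real y + t) = 2 * real n * of_int z"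
    using wrap_eqD(2)[OF assms(1-3) n] by blast
  have xy: "real x + 1 \<le> 2 * real n" "real y + 1 \<le> 2 * real n" using assms by linarith+
  have p: "0 < 2 * real n" using n by simp
  have "2 * real n * of_int z < 2 * real n * 1" "2 * real n * (-1) < 2 * real n * of_int z"
    using z xy assms(6-9) by linarith+
  then have "(of_int z :: real) < 1" "-1 < (of_int z :: real)"
    unfolding mult_less_cancel_left_pos[OF p] .
  then have "z = 0" by linarith
  then have "real x + s = real y + t" using z by simp
  then show "x = y" "s = t" using of_nat_add_frac_eqD assms by blast+
qed

text \<open>Together with \<open>edge_point_neq_vertex\<close> this says that the drawing is an
  embedding: the open edges are disjoint from each other and from the vertices.\<close>

lemma edge_point_eqD:
  assumes "edge_point n e s = edge_point n f t" "e \<in> cyl_edges n m" "f \<in> cyl_edges n m"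
    "0 < s" "s < 1" "0 < t" "t < 1"
  shows "e = f \<and> s = t"
proof (cases e; cases f)
  fix x j y k assume ef: "e = Hor x j" "f = Hor y k"
  then have "x < 2 * n" "y < 2 * n" "1 \<le> j" "1 \<le> k" using assms(2,3) by simp_all
  then show ?thesis using wrap_column_eqD[of n x s j y t k] assms ef by simp
next
  fix x j y k assume ef: "e = Hor x j" "f = Ver y k"
  then have "x < 2 * n" "y < 2 * n" "1 \<le> j" "1 \<le> k" using assms(2,3) by simp_all
  then have "s = 0" using wrap_column_eqD(2)[of n x s j y 0 "real k + t"] assms ef by simp
  then show ?thesis using assms by simp
next
  fix x j y k assume ef: "e = Ver y k" "f = Hor x j"
  then have "x < 2 * n" "y < 2 * n" "1 \<le> j" "1 \<le> k" using assms(2,3) by simp_all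
  then have "0 = t" using wrap_column_eqD(2)[of n y 0 "real k + s" x t j] assms ef by simp
  then show ?thesis using assms by simp
next
  fix x j y k assume ef: "e = Ver x j" "f = Ver y k"
  then have xy: "x < 2 * n" "y < 2 * n" "1 \<le> j" "1 \<le> k" using assms(2,3) by simp_all
  then have "x = y" "real j + s = real k + t"
    using wrap_column_eqD[of n x 0 "real j + s" y 0 "real k + t"] assms ef by simp_all
  then show ?thesis using of_nat_add_frac_eqD[of j s k t] assms ef by simp
qed

lemma edge_point_neq_vertex:
  assumes "e \<in> cyl_edges n m" "v \<in> cyl_vertices n m" "0 < s" "s < 1"
  shows "edge_point n e s \<noteq> wrap n (real (fst v)) (real (snd v))"
proof
  assume eq: "edge_point n e s = wrap n (real (fst v)) (real (snd v))"
  have v: "fst v < 2 * n" "1 \<le> snd v" using assms by (auto simp: cyl_vertices_def)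
  show False
  proof (cases e)
    case (Hor x j)
    then have "x < 2 * n" "1 \<le> j" using assms(1) by simp_all
    then have "s = 0" using wrap_column_eqD(2)[of n x s j "fst v" 0 "snd v"] eq assms v Hor by simp
    then show False using assms by simp
  next
    case (Ver x j)
    then have "x < 2 * n" "1 \<le> j" using assms(1) by simp_all
    then have "real j + s = real (snd v) + 0"
      using wrap_column_eqD(3)[of n x 0 "real j + s" "fst v" 0 "snd v"] eq assms v Ver by simp
    then show False using of_nat_add_frac_eqD(2)[of j s "snd v" 0] assms by simp
  qed
qed

text \<open>The flow of an edge, directed from white to black, through the seam between the columns
  2 n - 1 and 0.\<close>

fun seam_flow :: "nat \<Rightarrow> edge \<Rightarrow> int" where
  "seam_flow n (Hor x j) = (if x = 2 * n - 1 then (if even j then 1 else -1) else 0)"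
| "seam_flow n (Ver x j) = 0"

section \<open>Traversing the loops\<close>

context two_covers
begin

abbreviation V where "V \<equiv> cyl_vertices n m"

text \<open>The edge by which the traversal leaves \<open>v\<close>. Choosing the cover by colour
  orients every loop: edges of \<open>M\<close> run from white to black, those of \<open>N\<close>
  from black to white.\<close>

definition edge_at :: "vertex \<Rightarrow> edge" where
  "edge_at v = (THE e. e \<in> (if white v then M else N) \<and> v \<in> ends n e)"

text \<open>The identity outside \<open>V\<close> makes \<open>step\<close> injective on the whole
  type, as \<open>funpow_inj_finite\<close> requires.\<close>

definition step :: "vertex \<Rightarrow> vertex" where
  "step v = (if v \<in> V then the_elem (ends n (edge_at v) - {v}) else v)"

lemma edge_at:
  assumes "v \<in> V"
  shows "edge_at v \<in> (if white v then M else N)" "v \<in> ends n (edge_at v)"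
proof -
  have "\<exists>!e. e \<in> (if white v then M else N) \<and> v \<in> ends n e"
    using M N assms unfolding dimer_covers_def by auto
  from theI'[OF this] show "edge_at v \<in> (if white v then M else N)" "v \<in> ends n (edge_at v)"
    unfolding edge_at_def by blast+
qed

lemma edge_at_eqI:
  assumes "e \<in> (if white v then M else N)" "v \<in> ends n e"
  shows "edge_at v = e"
proof -
  have "e \<in> cyl_edges n m" using assms(1) dimer_covers_subset[OF M] dimer_covers_subset[OF N]
    by (auto split: if_splits)
  then have "v \<in> V" using ends_subset_vertices assms(2) by blast
  then show ?thesis
    using cover_edge_unique[OF M, of "edge_at v" e v] cover_edge_unique[OF N, of "edge_at v" e v]
      edge_at[of v] assms by (auto split: if_splits)
qed

lemma edge_at_in_C: "v \<in> V \<Longrightarrow> edge_at v \<in> C"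
  using edge_at(1)[of v] by (auto split: if_splits)

lemma edge_at_in_edges: "v \<in> V \<Longrightarrow> edge_at v \<in> cyl_edges n m"
  using edge_at_in_C dimer_covers_subset[OF M] dimer_covers_subset[OF N] by blast

lemma step:
  assumes "v \<in> V"
  shows "ends n (edge_at v) = {v, step v}" "white (step v) \<longleftrightarrow> \<not> white v" "step v \<in> V"
proof -
  obtain a b where ab: "ends n (edge_at v) = {a, b}" "white a" "\<not> white b"
    by (rule ends_white_black)
  have "v = a \<or> v = b" using edge_at(2)[OF assms] ab by simp
  moreover have "a \<noteq> b" using ab by blast
  ultimately have "v = a \<and> step v = b \<or> v = b \<and> step v = a"
    using assms unfolding step_def ab by (auto simp: insert_Diff_if)
  then show 1: "ends n (edge_at v) = {v, step v}" "white (step v) \<longleftrightarrow> \<not> white v"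
    using ab by auto
  show "step v \<in> V"
    using ends_subset_vertices[OF edge_at_in_edges[OF assms]] 1 by blast
qed

text \<open>The colour of the common image fixes the colour of \<open>u\<close> and \<open>v\<close>
  and thus the cover they are left by. Both edges are the edge of that cover at the image, and an
  edge has only one end of each colour.\<close>

lemma inj_step: "inj step"
proof (rule injI)
  fix u v assume eq: "step u = step v"
  show "u = v"
  proof (cases "u \<in> V \<and> v \<in> V")
    case True
    then have uv: "u \<in> V" "v \<in> V" by auto
    have w: "white u \<longleftrightarrow> white v" using step(2)[OF uv(1)] step(2)[OF uv(2)] eq by simp
    have s: "step u \<in> ends n (edge_at u)" "step u \<in> ends n (edge_at v)"
      using step(1)[OF uv(1)] step(1)[OF uv(2)] eq by auto
    have "edge_at u = edge_at v"
      using cover_edge_unique[OF M _ _ s] cover_edge_unique[OF N _ _ s] edge_at(1)[OF uv(1)] edge_at(1)[OF uv(2)] w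
      by (auto split: if_splits)
    then show ?thesis
      using ends_same_colour[of u n "edge_at u" v] edge_at(2)[OF uv(1)] edge_at(2)[OF uv(2)] w by simp
  next
    case False
    then show ?thesis using eq step(3) unfolding step_def by metis
  qed
qed

text \<open>Whether the traversal runs through its edge in the direction of the parametrisation
  \<open>edge_point\<close>, that is, to the right or upwards.\<close>

definition forward :: "vertex \<Rightarrow> bool" where
  "forward v = (case edge_at v of Hor x j \<Rightarrow> v = (x, j) | Ver x j \<Rightarrow> v = (x, j))"

definition dx :: "vertex \<Rightarrow> int" where
  "dx v = (case edge_at v of Hor x j \<Rightarrow> if v = (x, j) then 1 else -1 | Ver x j \<Rightarrow> 0)"

definition dy :: "vertex \<Rightarrow> int" where
  "dy v = (case edge_at v of Hor x j \<Rightarrow> 0 | Ver x j \<Rightarrow> if v = (x, j) then 1 else -1)"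

text \<open>Since \<open>seam_flow\<close> is directed from white to black, the sign is reversed
  when the edge is left from its black end; this gives the flow in the direction of travel.\<close>

definition flow :: "vertex \<Rightarrow> int" where
  "flow v = (if white v then seam_flow n (edge_at v) else - seam_flow n (edge_at v))"

lemma edge_at_cases:
  assumes "v \<in> V"
  obtains (right) x j where "edge_at v = Hor x j" "v = (x, j)" "step v = ((x + 1) mod (2 * n), j)" "x < 2 * n" "forward v" "dx v = 1" "dy v = 0"
  | (left) x j where "edge_at v = Hor x j" "v = ((x + 1) mod (2 * n), j)" "step v = (x, j)" "x < 2 * n" "\<not> forward v" "dx v = -1" "dy v = 0"
  | (up) x j where "edge_at v = Ver x j" "v = (x, j)" "step v = (x, j + 1)" "forward v" "dx v = 0" "dy v = 1"
  | (down) x j where "edge_at v = Ver x j" "v = (x, j + 1)" "step v = (x, j)" "\<not> forward v" "dx v = 0" "dy v = -1"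
proof (cases "edge_at v")
  case (Hor x j)
  have x: "x < 2 * n" using edge_at_in_edges[OF assms] Hor by simp
  have ne: "(x + 1) mod (2 * n) \<noteq> x" by (rule ends_Hor_Ver_neq[OF x n2])
  have "{v, step v} = {(x, j), ((x + 1) mod (2 * n), j)}"
    using step(1)[OF assms] Hor by simp
  then consider "v = (x, j)" "step v = ((x + 1) mod (2 * n), j)" | "v = ((x + 1) mod (2 * n), j)" "step v = (x, j)"
    unfolding doubleton_eq_iff by blast
  then show ?thesis
  proof cases
    case 1
    then show ?thesis using right[of x j] x Hor by (simp add: forward_def dx_def dy_def)
  next
    case 2
    then show ?thesis using left[of x j] x Hor ne by (simp add: forward_def dx_def dy_def)
  qed
next
  case (Ver x j)
  have "{v, step v} = {(x, j), (x, j + 1)}" using step(1)[OF assms] Ver by simp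
  then consider "v = (x, j)" "step v = (x, j + 1)" | "v = (x, j + 1)" "step v = (x, j)"
    unfolding doubleton_eq_iff by blast
  then show ?thesis
  proof cases
    case 1
    then show ?thesis using up[of x j] Ver by (simp add: forward_def dx_def dy_def)
  next
    case 2
    then show ?thesis using down[of x j] Ver by (simp add: forward_def dx_def dy_def)
  qed
qed

lemma mod_succ: "x < 2 * n \<Longrightarrow> (x + 1) mod (2 * n) = (if x = 2 * n - 1 then 0 else x + 1)"
  using n2 by auto

text \<open>Column 2 n - 1 is odd, so its vertex in row \<open>j\<close> is white exactly for even
  \<open>j\<close>. Hence the sign by the parity of \<open>j\<close> in \<open>seam_flow\<close> and
  the sign by colour in \<open>flow\<close> cancel.\<close>

lemma flow_right:
  assumes "edge_at v = Hor x j" "v = (x, j)" "x < 2 * n"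
  shows "flow v = (if x = 2 * n - 1 then 1 else 0)"
proof (cases "x = 2 * n - 1")
  case True
  have "2 * n - 1 = Suc (2 * (n - 1))" using n2 by simp
  then have "odd x" using True by simp
  then show ?thesis using assms(1,2) True by (simp add: flow_def white_def)
qed (simp add: flow_def assms(1))

lemma flow_left:
  assumes "edge_at v = Hor x j" "v = ((x + 1) mod (2 * n), j)" "x < 2 * n"
  shows "flow v = (if x = 2 * n - 1 then -1 else 0)"
proof (cases "x = 2 * n - 1")
  case True
  have "v = (0, j)" unfolding assms(2) mod_succ[OF assms(3)] by (simp add: True)
  then show ?thesis using assms(1) True by (simp add: flow_def white_def)
qed (simp add: flow_def assms(1))

text \<open>The term with \<open>flow\<close> accounts for the jump of the column number at the
  seam; adding up \<open>dx\<close> alone therefore gives the column in the universal cover.\<close>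

lemma step_coordinates:
  assumes "v \<in> V"
  shows "int (fst (step v)) = int (fst v) + dx v - 2 * int n * flow v"
    "int (snd (step v)) = int (snd v) + dy v"
proof -
  have "int (fst (step v)) = int (fst v) + dx v - 2 * int n * flow v \<and> int (snd (step v)) = int (snd v) + dy v"
    using assms
  proof (cases rule: edge_at_cases)
    case (right x j)
    note f = flow_right[OF right(1,2,4)]
    have "x = 2 * n - 1 \<Longrightarrow> int x = 2 * int n - 1" using n2 by simp
    moreover have fs: "fst v = x" "snd v = j" by (simp_all add: right(2))
    ultimately show ?thesis unfolding f right(3) mod_succ[OF right(4)] fs right(6,7) by simp
  next
    case (left x j)
    note f = flow_left[OF left(1,2,4)]
    have fs: "fst v = (if x = 2 * n - 1 then 0 else x + 1)" "snd v = j"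
      unfolding left(2) mod_succ[OF left(4)] by simp_all
    have "x = 2 * n - 1 \<Longrightarrow> int x = 2 * int n - 1" using n2 by simp
    then show ?thesis unfolding f left(3) fs left(6,7) by simp
  next
    case (up x j)
    have "flow v = 0" by (simp add: flow_def up(1))
    then show ?thesis unfolding up(3,5,6) by (simp add: up(2))
  next
    case (down x j)
    have "flow v = 0" by (simp add: flow_def down(1))
    then show ?thesis unfolding down(3,5,6) by (simp add: down(2))
  qed
  then show "int (fst (step v)) = int (fst v) + dx v - 2 * int n * flow v"
    "int (snd (step v)) = int (snd v) + dy v" by blast+
qed

lemma segment_eq_edge_point:
  assumes "v \<in> V"
  shows "wrap n (real (fst v) + r * of_int (dx v)) (real (snd v) + r * of_int (dy v))
    = edge_point n (edge_at v) (if forward v then r else 1 - r)"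
  using assms
proof (cases rule: edge_at_cases)
  case (left x j)
  have fs: "fst v = (if x = 2 * n - 1 then 0 else x + 1)" "snd v = j"
    unfolding left(2) mod_succ[OF left(4)] by simp_all
  show ?thesis
  proof (cases "x = 2 * n - 1")
    case True
    \<comment> \<open>A step to the left from column 0 has coordinate - r, while its edge is
      parametrised in front of 2 n: the two differ by one period.\<close>
    then have eq: "real x + (1 - r) = - r + 2 * real n * of_int 1" using n2 by (simp add: of_nat_diff)
    have "wrap n (real x + (1 - r)) j = wrap n (- r) j"
      unfolding eq by (rule wrap_periodic) (use n2 in simp)
    then show ?thesis using left(5) fs True by (simp add: left(1,6,7))
  next
    case False
    then show ?thesis using left(5) fs by (simp add: left(1,6,7) algebra_simps)
  qed
qed (simp_all add: algebra_simps)

text \<open>The hypothesis on \<open>edge_at\<close> rules out a doubled edge, which would be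
  travelled once in each direction.\<close>

lemma segment_inj:
  assumes "u \<in> V" "v \<in> V" "edge_at u = edge_at v \<Longrightarrow> u = v"
    and "0 \<le> r" "r < 1" "0 \<le> s" "s < 1"
    and eq: "wrap n (real (fst u) + r * of_int (dx u)) (real (snd u) + r * of_int (dy u))
      = wrap n (real (fst v) + s * of_int (dx v)) (real (snd v) + s * of_int (dy v))"
  shows "u = v \<and> r = s"
proof -
  note su = segment_eq_edge_point[OF assms(1), of r]
  note sv = segment_eq_edge_point[OF assms(2), of s]
  note ed = edge_at_in_edges[OF assms(1)] edge_at_in_edges[OF assms(2)]
  consider "r = 0" "s = 0" | "r = 0" "0 < s" | "0 < r" "s = 0" | "0 < r" "0 < s"
    using assms(4,6) by linarith
  then show ?thesis
  proof cases
    case 1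
    have "fst u < 2 * n" "fst v < 2 * n" "1 \<le> snd u" "1 \<le> snd v"
      using assms(1,2) by (auto simp: cyl_vertices_def)
    then have "fst u = fst v" "snd u = snd v"
      using wrap_column_eqD[of n "fst u" 0 "snd u" "fst v" 0 "snd v"] eq 1 by simp_all
    then show ?thesis using 1 by (simp add: prod_eq_iff)
  next
    case 2
    then show ?thesis using edge_point_neq_vertex[OF ed(2) assms(1), of "if forward v then s else 1 - s"] eq sv assms
      by (auto split: if_splits)
  next
    case 3
    then show ?thesis using edge_point_neq_vertex[OF ed(1) assms(2), of "if forward u then r else 1 - r"] eq su assms
      by (auto split: if_splits)
  next
    case 4
    have "edge_at u = edge_at v \<and> (if forward u then r else 1 - r) = (if forward v then s else 1 - s)"
      using eq 4 assms(4-7) unfolding su sv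
      by (intro edge_point_eqD[OF _ ed]) simp_all
    then show ?thesis using assms(3) by (auto split: if_splits)
  qed
qed

text \<open>An injective map with orbits in the finite set \<open>V\<close> returns to its starting
  point. Minimality of the period \<open>l\<close> prevents repetitions, and the connectedness of
  \<open>L\<close> makes the orbit pass through every edge of it.\<close>

lemma loop_orbit:
  assumes "L \<in> loops n C"
  obtains v l where "0 < l" "(step ^^ l) v = v" "\<And>k. (step ^^ k) v \<in> V"
    "bij_betw (\<lambda>k. edge_at ((step ^^ k) v)) {..<l} L"
proof -
  have "L \<noteq> {}" using assms by (auto simp: loops_def)
  then obtain e where e: "e \<in> L" by blast
  then have "e \<in> C" using loop_subset[OF assms] by blast
  then have "e \<in> cyl_edges n m" using dimer_covers_subset[OF M] dimer_covers_subset[OF N] by blast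
  note eV = ends_subset_vertices[OF this]
  obtain a b where ab: "ends n e = {a, b}" "white a" "\<not> white b" by (rule ends_white_black)
  \<comment> \<open>The end of \<open>e\<close> from which the traversal leaves along
    \<open>e\<close>.\<close>
  define v where "v = (if e \<in> M then a else b)"
  have vV: "v \<in> V" using eV ab by (auto simp: v_def)
  have "edge_at v = e" using ab \<open>e \<in> C\<close> by (intro edge_at_eqI) (auto simp: v_def)
  define p where "p k = (step ^^ k) v" for k
  have pV: "p k \<in> V" for k
    by (induction k) (use vV step(3) in \<open>auto simp: p_def\<close>)
  have pS: "p (Suc k) = step (p k)" for k by (simp add: p_def)
  have "finite V" by (simp add: cyl_vertices_def)
  then have "finite {y. \<exists>k. y = (step ^^ k) v}"
    by (rule rev_finite_subset) (use pV in \<open>auto simp: p_def\<close>)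
  then obtain l0 where l0: "0 < l0" "(step ^^ l0) v = v"
    using funpow_inj_finite[OF inj_step] by metis
  define Q where "Q l \<longleftrightarrow> 0 < l \<and> (step ^^ l) v = v" for l
  define l where "l = (LEAST l. Q l)"
  have "Q l0" unfolding Q_def using l0 by blast
  then have "Q l" unfolding l_def by (rule LeastI)
  then have l: "0 < l" "(step ^^ l) v = v" unfolding Q_def by blast+
  have lmin: "l \<le> k" if "0 < k" "(step ^^ k) v = v" for k
  proof -
    have "Q k" unfolding Q_def using that by blast
    then show ?thesis unfolding l_def by (rule Least_le)
  qed
  have inL: "edge_at (p k) \<in> L" for k
  proof (induction k)
    case 0 then show ?case using \<open>edge_at v = e\<close> e by (simp add: p_def)
  next
    case (Suc k)
    have "p (Suc k) \<in> ends n (edge_at (p k))" using step(1)[OF pV[of k]] pS[of k] by simp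
    moreover have "p (Suc k) \<in> ends n (edge_at (p (Suc k)))" using edge_at(2)[OF pV] .
    ultimately show ?case using loop_closed[OF assms Suc edge_at_in_C[OF pV]] by blast
  qed
  have inj_edge: "p j = p k" if "edge_at (p j) = edge_at (p k)" for j k
  proof -
    have "white (p j) \<longleftrightarrow> white (p k)"
      using edge_at(1)[OF pV[of j]] edge_at(1)[OF pV[of k]] that loop_edge_alternates[OF assms inL[of k]]
      by (auto split: if_splits)
    then show ?thesis
      using ends_same_colour[of "p j" n "edge_at (p j)" "p k"] edge_at(2)[OF pV[of j]] edge_at(2)[OF pV[of k]] that
      by simp
  qed
  have no_repeat: "j = k" if "j \<le> k" "k < l" "p j = p k" for j k
  proof (rule ccontr)
    assume "j \<noteq> k"
    have "(step ^^ j) ((step ^^ (k - j)) v) = (step ^^ j) v"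
      using that unfolding p_def by (simp flip: funpow_add comp_apply[of "step ^^ j" "step ^^ (k - j)"])
    then have "(step ^^ (k - j)) v = v" using inj_fn[OF inj_step, of j] by (simp add: inj_eq)
    then show False using lmin[of "k - j"] that \<open>j \<noteq> k\<close> by simp
  qed
  have inj: "inj_on (\<lambda>k. edge_at (p k)) {..<l}"
  proof (rule inj_onI)
    fix j k assume "j \<in> {..<l}" "k \<in> {..<l}" "edge_at (p j) = edge_at (p k)"
    then show "j = k" using inj_edge[of j k] no_repeat[of j k] no_repeat[of k j] by (cases "j \<le> k") auto
  qed
  have period: "p (k + l) = p k" for k
    using l(2) by (simp add: p_def funpow_add)
  have "p k \<in> p ` {..<l}" for k
  proof (induction k rule: less_induct)
    case (less k)
    show ?case
    proof (cases "k < l")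
      case False
      then show ?thesis using less[of "k - l"] period[of "k - l"] l by simp
    qed simp
  qed
  then have range_p: "range p = p ` {..<l}" by blast
  have "f \<in> edge_at ` range p" if f: "f \<in> L" for f
    using assms inL[of 0]
  proof (induction rule: loop_induct[where P = "\<lambda>f. f \<in> edge_at ` range p"])
    case (touch f g)
    then obtain k where k: "f = edge_at (p k)" by blast
    \<comment> \<open>A positive index is wanted, so that the vertex has a predecessor on the orbit;
      by periodicity \<open>k\<close> may be replaced by \<open>k + l\<close>.\<close>
    obtain k' where k': "p k' \<in> ends n g" "0 < k'"
    proof -
      have "ends n f = {p k, p (Suc k)}" using step(1)[OF pV[of k]] k pS[of k] by simp
      then have "p k \<in> ends n g \<or> p (Suc k) \<in> ends n g" using touch(3) by auto
      then have "p (k + l) \<in> ends n g \<or> p (Suc k) \<in> ends n g" unfolding period .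
      then show thesis using that[of "k + l"] that[of "Suc k"] l by auto
    qed
    obtain i where i: "k' = Suc i" using k'(2) gr0_implies_Suc by blast
    have gC: "g \<in> C" using touch(2) loop_subset[OF assms] by blast
    have g2: "p k' \<in> ends n (edge_at (p i))" using step(1)[OF pV[of i]] i pS[of i] by simp
    \<comment> \<open>Depending on the cover it belongs to, \<open>g\<close> is the edge by which
      the orbit leaves \<open>p k'\<close> or the one by which it arrives there.\<close>
    show ?case
    proof (cases "g \<in> (if white (p k') then M else N)")
      case True
      then have "edge_at (p k') = g" using k'(1) by (rule edge_at_eqI)
      then show ?thesis by blast
    next
      case False
      have wi: "white (p i) \<longleftrightarrow> \<not> white (p k')" using step(2)[OF pV[of i]] pS[of i] i by simp
      have "edge_at (p i) = g"
        using cover_edge_unique[OF M _ _ g2 k'(1)] cover_edge_unique[OF N _ _ g2 k'(1)]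
          edge_at(1)[OF pV[of i]] False gC wi by (auto split: if_splits)
      then show ?thesis by blast
    qed
  qed (use f in auto)
  then have "(\<lambda>k. edge_at (p k)) ` {..<l} = L"
    using inL range_p by (auto simp: image_image[symmetric])
  then have "bij_betw (\<lambda>k. edge_at (p k)) {..<l} L" using inj by (simp add: bij_betw_def)
  then show thesis using that[of l v] l pV by (simp add: p_def)
qed

text \<open>Edges of \<open>M\<close> are travelled from white to black and those of
  \<open>N\<close> the other way, so \<open>w\<close> is the total flow through the seam in the
  direction of travel. It becomes the winding number in \<open>wrapped_polygon\<close>, whose inside
  condition is contractibility by \<open>inside_subset_annulus_iff\<close>.\<close>

lemma loop_winding:
  assumes L: "L \<in> loops n C"
  defines "w \<equiv> (\<Sum>e\<in>M \<inter> L. seam_flow n e) - (\<Sum>e\<in>N \<inter> L. seam_flow n e)"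
  shows "w = 0 \<and> \<not> noncontractible n m L \<or> \<bar>w\<bar> = 1 \<and> noncontractible n m L"
proof -
  obtain v l where l: "0 < l" "(step ^^ l) v = v" and inV: "\<And>k. (step ^^ k) v \<in> V"
    and bij: "bij_betw (\<lambda>k. edge_at ((step ^^ k) v)) {..<l} L"
    by (rule loop_orbit[OF L]) (rule that)
  define p where "p k = (step ^^ k) v" for k
  have pV: "p k \<in> V" for k using inV by (simp add: p_def)
  have pS: "p (Suc k) = step (p k)" for k by (simp add: p_def)
  have pl: "p l = p 0" by (simp only: p_def funpow.simps id_apply l(2))
  have bij': "bij_betw (\<lambda>k. edge_at (p k)) {..<l} L" using bij unfolding p_def .
  have inL: "edge_at (p k) \<in> L" if "k < l" for k
    by (rule bij_betw_apply[OF bij']) (use that in simp)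
  have finL: "finite L" by (rule finite_subset[OF loop_subset[OF L] finite_C])
  have w: "w = (\<Sum>k<l. flow (p k))"
  proof -
    let ?s = "\<lambda>e. if e \<in> M then seam_flow n e else - seam_flow n e"
    have "(\<Sum>k<l. flow (p k)) = (\<Sum>k<l. ?s (edge_at (p k)))"
    proof (rule sum.cong[OF refl])
      fix k assume "k \<in> {..<l}"
      then have "edge_at (p k) \<in> L" using inL by simp
      from loop_edge_alternates[OF L this] edge_at(1)[OF pV[of k]]
      have "edge_at (p k) \<in> M \<longleftrightarrow> white (p k)" by (auto split: if_splits)
      then show "flow (p k) = ?s (edge_at (p k))" by (simp add: flow_def)
    qed
    also have "\<dots> = (\<Sum>e\<in>L. ?s e)" by (rule sum.reindex_bij_betw[OF bij'])
    also have "\<dots> = (\<Sum>e\<in>L \<inter> {e. e \<in> M}. seam_flow n e) + (\<Sum>e\<in>L \<inter> - {e. e \<in> M}. - seam_flow n e)"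
      by (rule sum.If_cases[OF finL])
    also have "L \<inter> {e. e \<in> M} = M \<inter> L" by blast
    also have "L \<inter> - {e. e \<in> M} = N \<inter> L" using loop_edge_alternates[OF L] by blast
    finally show ?thesis by (simp add: w_def sum_negf)
  qed
  \<comment> \<open>The column in the universal cover, not reduced modulo 2 n.\<close>
  define a where "a k = real (fst (p 0)) + (\<Sum>i<k. of_int (dx (p i)))" for k
  define b where "b k = real (snd (p k))" for k
  have aS: "a (Suc k) - a k = of_int (dx (p k))" for k by (simp add: a_def)
  have bS: "b (Suc k) - b k = of_int (dy (p k))" for k
  proof -
    have "int (snd (p (Suc k))) = int (snd (p k)) + dy (p k)"
      using step_coordinates(2)[OF pV[of k]] by (simp add: pS)
    then have "real_of_int (int (snd (p (Suc k)))) = real_of_int (int (snd (p k)) + dy (p k))" by (rule arg_cong)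
    then show ?thesis by (simp add: b_def)
  qed
  have a: "a k = real (fst (p k)) + 2 * real n * of_int (\<Sum>i<k. flow (p i))" for k
  proof (induction k)
    case (Suc k)
    have "int (fst (p (Suc k))) = int (fst (p k)) + dx (p k) - 2 * int n * flow (p k)"
      using step_coordinates(1)[OF pV[of k]] by (simp add: pS)
    then have "real_of_int (int (fst (p (Suc k)))) = real_of_int (int (fst (p k)) + dx (p k) - 2 * int n * flow (p k))"
      by (rule arg_cong)
    then have "real (fst (p (Suc k))) = real (fst (p k)) + of_int (dx (p k)) - 2 * real n * of_int (flow (p k))"
      by simp
    then show ?case using Suc aS[of k] by (simp add: algebra_simps)
  qed (simp add: a_def)
  have n0: "0 < n" using n2 by simp
  \<comment> \<open>The lifted column exceeds the true one by 2 n for each unit of flow so far, and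
    \<open>wrap\<close> does not notice whole periods.\<close>
  have seg: "wrap n (a k + r * (a (Suc k) - a k)) (b k + r * (b (Suc k) - b k))
     = wrap n (real (fst (p k)) + r * of_int (dx (p k))) (real (snd (p k)) + r * of_int (dy (p k)))" for k r
    unfolding aS bS unfolding a b_def
    using wrap_periodic[OF n0, of "real (fst (p k)) + r * of_int (dx (p k))" "\<Sum>i<k. flow (p i)"]
    by (simp add: algebra_simps)
  define S where "S = (\<Union>k<l. (\<lambda>r. wrap n (a k + r * (a (Suc k) - a k)) (b k + r * (b (Suc k) - b k))) ` {0..1})"
  have b1: "1 \<le> b k" if "k \<le> l" for k
    using pV[of k] by (auto simp: b_def cyl_vertices_def)
  have bl: "b l = b 0" by (simp add: b_def pl)
  have al: "a l = a 0 + 2 * real n * of_int w" using a[of l] pl by (simp add: a_def w)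
  have inj: "j = k \<and> r = s" if jk: "j < l" "k < l" "0 \<le> r" "r < 1" "0 \<le> s" "s < 1"
    and eq: "wrap n (a j + r * (a (Suc j) - a j)) (b j + r * (b (Suc j) - b j))
      = wrap n (a k + s * (a (Suc k) - a k)) (b k + s * (b (Suc k) - b k))" for j k r s
  proof -
    have e: "j = k" if "edge_at (p j) = edge_at (p k)"
      using bij' jk(1,2) that unfolding bij_betw_def inj_on_def by blast
    have "p j = p k \<and> r = s"
    proof (rule segment_inj[OF pV pV _ jk(3-6) eq[unfolded seg]])
      assume "edge_at (p j) = edge_at (p k)"
      then show "p j = p k" using e by simp
    qed
    then show ?thesis using e by simp
  qed
  have "compact S" "w = 0 \<and> 0 \<notin> inside S \<or> \<bar>w\<bar> = 1 \<and> 0 \<in> inside S"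
    unfolding S_def by (rule wrapped_polygon[where b = b, OF n0 l(1) b1 bl al inj]; assumption)+
  moreover have S: "S = loop_curve n L"
  proof -
    have "(\<lambda>r. wrap n (a k + r * (a (Suc k) - a k)) (b k + r * (b (Suc k) - b k))) ` {0..1} = edge_arc n (edge_at (p k))" for k
    proof (cases "forward (p k)")
      case True
      then show ?thesis unfolding seg segment_eq_edge_point[OF pV] edge_arc_eq by simp
    next
      case False
      have "(\<lambda>r::real. 1 - r) ` {0..1} = {0..1}" by simp
      then have "edge_point n (edge_at (p k)) ` {0..1} = (\<lambda>r. edge_point n (edge_at (p k)) (1 - r)) ` {0..1}"
        by (metis image_image)
      then show ?thesis unfolding seg segment_eq_edge_point[OF pV] edge_arc_eq using False by simp
    qed
    then have "S = (\<Union>k<l. edge_arc n (edge_at (p k)))" by (simp add: S_def)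
    also have "\<dots> = (\<Union>e\<in>(\<lambda>k. edge_at (p k)) ` {..<l}. edge_arc n e)" by simp
    also have "(\<lambda>k. edge_at (p k)) ` {..<l} = L" using bij' by (simp add: bij_betw_def)
    finally show ?thesis by (simp add: loop_curve_def)
  qed
  moreover have "S \<subseteq> annulus m"
  proof -
    have "edge_arc n e \<subseteq> annulus m" if "e \<in> cyl_edges n m" for e
    proof (cases e)
      case (Hor x j)
      then have "1 \<le> j" "j \<le> m" using that by simp_all
      then show ?thesis by (auto simp: Hor annulus_def)
    next
      case (Ver x j)
      then have j: "1 \<le> j" "j + 1 \<le> m" using that by simp_all
      then have "real j + 1 \<le> real m" by linarith
      then show ?thesis using j by (auto simp: Ver annulus_def)
    qed
    moreover have "L \<subseteq> cyl_edges n m"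
      using loop_subset[OF L] dimer_covers_subset[OF M] dimer_covers_subset[OF N] by blast
    ultimately show ?thesis unfolding S loop_curve_def by blast
  qed
  moreover have "1 \<le> m" using pV[of 0] by (auto simp: cyl_vertices_def)
  ultimately show ?thesis
    unfolding noncontractible_def using inside_subset_annulus_iff[of m S] by auto
qed

end

section \<open>The loop partition function\<close>

definition seam_weight :: "nat \<Rightarrow> complex \<Rightarrow> edge \<Rightarrow> complex" where
  "seam_weight n z e = z powi seam_flow n e"

definition dimer_partition :: "nat \<Rightarrow> nat \<Rightarrow> complex \<Rightarrow> complex" where
  "dimer_partition n m z = (\<Sum>M\<in>dimer_covers n m. \<Prod>e\<in>M. seam_weight n z e)"

definition loop_partition :: "nat \<Rightarrow> nat \<Rightarrow> complex \<Rightarrow> complex" where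
  "loop_partition n m X = (\<Sum>C\<in>double_dimer_configs n m. 2 ^ num_contractible n m C * X ^ num_noncontractible n m C)"

text \<open>The coefficient of X^k in \<open>loop_partition n m X\<close>.\<close>

definition config_weight :: "nat \<Rightarrow> nat \<Rightarrow> nat \<Rightarrow> real" where
  "config_weight n m k = (\<Sum>C | C \<in> double_dimer_configs n m \<and> num_noncontractible n m C = k. 2 ^ num_contractible n m C)"

lemma prod_powi:
  fixes z :: complex
  assumes "z \<noteq> 0" "finite A"
  shows "(\<Prod>a\<in>A. z powi f a) = z powi (\<Sum>a\<in>A. f a)"
  using assms(2) by induction (use assms(1) in \<open>simp_all add: power_int_add\<close>)

context two_covers
begin

text \<open>The two ways of distributing the halves of \<open>L\<close> weigh z^w and z^(-w), where
  \<open>w\<close> is the flow from \<open>loop_winding\<close> and hence 0, 1 or -1.\<close>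

lemma loop_weight:
  assumes L: "L \<in> loops n C" and z: "z \<noteq> 0"
  shows "prod (seam_weight n z) (N \<inter> L) * prod (seam_weight n (inverse z)) (M \<inter> L)
       + prod (seam_weight n z) (M \<inter> L) * prod (seam_weight n (inverse z)) (N \<inter> L)
     = (if noncontractible n m L then z + inverse z else 2)"
proof -
  define w where "w = (\<Sum>e\<in>M \<inter> L. seam_flow n e) - (\<Sum>e\<in>N \<inter> L. seam_flow n e)"
  have fin: "finite (M \<inter> L)" "finite (N \<inter> L)" using finite_C by auto
  have iz: "inverse z \<noteq> 0" using z by simp
  have inv: "inverse z powi k = z powi (- k)" for k
    by (simp add: power_int_inverse power_int_minus)
  have e: "prod (seam_weight n z) A = z powi (\<Sum>e\<in>A. seam_flow n e)"
    "prod (seam_weight n (inverse z)) A = z powi (- (\<Sum>e\<in>A. seam_flow n e))" if "finite A" for A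
    unfolding seam_weight_def prod_powi[OF z that] prod_powi[OF iz that] inv by (simp_all add: sum_negf)
  have "prod (seam_weight n z) (N \<inter> L) * prod (seam_weight n (inverse z)) (M \<inter> L) = z powi (- w)"
    "prod (seam_weight n z) (M \<inter> L) * prod (seam_weight n (inverse z)) (N \<inter> L) = z powi w"
    unfolding e[OF fin(1)] e[OF fin(2)] w_def using z by (simp_all flip: power_int_add)
  moreover have "w = 0 \<and> \<not> noncontractible n m L \<or> (w = 1 \<or> w = -1) \<and> noncontractible n m L"
    using loop_winding[OF L] unfolding w_def[symmetric] by linarith
  ultimately show ?thesis by (auto simp: power_int_minus)
qed

lemma weighted_pairs_with_union:
  assumes z: "z \<noteq> 0"
  shows "(\<Sum>(M', N') | M' \<in> dimer_covers n m \<and> N' \<in> dimer_covers n m \<and> M' \<union> N' = C.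
        prod (seam_weight n z) M' * prod (seam_weight n (inverse z)) N')
     = 2 ^ num_contractible n m C * (z + inverse z) ^ num_noncontractible n m C"
proof -
  have "seam_weight n z e * seam_weight n (inverse z) e = 1" for e
    using z by (simp add: seam_weight_def power_int_inverse)
  then have "(\<Sum>(M', N') | M' \<in> dimer_covers n m \<and> N' \<in> dimer_covers n m \<and> M' \<union> N' = C.
        prod (seam_weight n z) M' * prod (seam_weight n (inverse z)) N')
      = (\<Prod>L\<in>loops n C. if noncontractible n m L then z + inverse z else 2)"
    by (subst sum_pairs_with_union) (auto intro!: prod.cong simp: loop_weight[OF _ z])
  also have "\<dots> = (\<Prod>L\<in>loops n C \<inter> {L. noncontractible n m L}. z + inverse z)
      * (\<Prod>L\<in>loops n C \<inter> - {L. noncontractible n m L}. 2)"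
    by (rule prod.If_cases[OF finite_loops[OF finite_C]])
  also have "loops n C \<inter> {L. noncontractible n m L} = {L \<in> loops n C. noncontractible n m L}" by blast
  also have "loops n C \<inter> - {L. noncontractible n m L} = {L \<in> loops n C. \<not> noncontractible n m L}" by blast
  finally show ?thesis by (simp add: num_contractible_def num_noncontractible_def)
qed

end

lemma sum_pairs_by_union:
  fixes f :: "edge set \<Rightarrow> edge set \<Rightarrow> 'a::comm_monoid_add"
  shows "(\<Sum>(M, N)\<in>dimer_covers n m \<times> dimer_covers n m. f M N)
    = (\<Sum>C\<in>double_dimer_configs n m.
        \<Sum>(M, N) | M \<in> dimer_covers n m \<and> N \<in> dimer_covers n m \<and> M \<union> N = C. f M N)"
proof -
  let ?D = "dimer_covers n m"
  have "(\<Sum>C\<in>double_dimer_configs n m. \<Sum>x\<in>{x \<in> ?D \<times> ?D. (\<lambda>(M, N). M \<union> N) x = C}. case_prod f x)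
      = (\<Sum>x\<in>?D \<times> ?D. case_prod f x)"
    by (rule sum.group) (simp_all, auto simp: double_dimer_configs_def)
  moreover have "{x \<in> ?D \<times> ?D. (\<lambda>(M, N). M \<union> N) x = C} = {(M, N). M \<in> ?D \<and> N \<in> ?D \<and> M \<union> N = C}" for C
    by auto
  ultimately show ?thesis by simp
qed

theorem dimer_partition_mult:
  assumes "2 \<le> n" "z \<noteq> 0"
  shows "dimer_partition n m z * dimer_partition n m (inverse z) = loop_partition n m (z + inverse z)"
proof -
  let ?D = "dimer_covers n m"
  have "dimer_partition n m z * dimer_partition n m (inverse z)
     = (\<Sum>(M, N)\<in>?D \<times> ?D. prod (seam_weight n z) M * prod (seam_weight n (inverse z)) N)"
    by (simp add: dimer_partition_def sum_product sum.cartesian_product)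
  also have "\<dots> = loop_partition n m (z + inverse z)"
    unfolding sum_pairs_by_union loop_partition_def
  proof (rule sum.cong[OF refl])
    fix C assume "C \<in> double_dimer_configs n m"
    then obtain M N where "C = M \<union> N" "M \<in> ?D" "N \<in> ?D" by (auto simp: double_dimer_configs_def)
    then interpret two_covers n m M N using assms(1) by unfold_locales auto
    show "(\<Sum>(M, N) | M \<in> ?D \<and> N \<in> ?D \<and> M \<union> N = C.
        prod (seam_weight n z) M * prod (seam_weight n (inverse z)) N)
      = 2 ^ num_contractible n m C * (z + inverse z) ^ num_noncontractible n m C"
      unfolding \<open>C = M \<union> N\<close> by (rule weighted_pairs_with_union[OF assms(2)])
  qed
  finally show ?thesis .
qed

text \<open>At z = 1 all weights are 1, so \<open>weighted_pairs_with_union\<close> counts pairs and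
  every loop yields the factor 2.\<close>

lemma card_pairs_with_union:
  assumes "2 \<le> n" "C \<in> double_dimer_configs n m"
  shows "card {(M, N). M \<in> dimer_covers n m \<and> N \<in> dimer_covers n m \<and> M \<union> N = C}
     = 2 ^ num_contractible n m C * 2 ^ num_noncontractible n m C"
proof -
  let ?D = "dimer_covers n m"
  obtain M N where C: "C = M \<union> N" "M \<in> ?D" "N \<in> ?D" using assms(2) by (auto simp: double_dimer_configs_def)
  then interpret two_covers n m M N using assms(1) by unfold_locales auto
  have "of_nat (card {(M, N). M \<in> ?D \<and> N \<in> ?D \<and> M \<union> N = C}) = (\<Sum>(M, N) | M \<in> ?D \<and> N \<in> ?D \<and> M \<union> N = C.
        prod (seam_weight n 1) M * prod (seam_weight n (inverse 1)) N)"
    by (simp add: seam_weight_def case_prod_unfold)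
  also have "\<dots> = 2 ^ num_contractible n m C * (1 + inverse 1) ^ num_noncontractible n m C"
    unfolding C(1) by (rule weighted_pairs_with_union) simp
  also have "\<dots> = of_nat (2 ^ num_contractible n m C * 2 ^ num_noncontractible n m C)" by simp
  finally show ?thesis by (simp only: of_nat_eq_iff)
qed

section \<open>Generating functions of the finite laws\<close>

lemma config_weight_sums: "(\<lambda>k. of_real (config_weight n m k) * X ^ k) sums loop_partition n m X"
proof -
  let ?K = "num_noncontractible n m ` double_dimer_configs n m"
  have "(\<lambda>k. of_real (config_weight n m k) * X ^ k) sums (\<Sum>k\<in>?K. of_real (config_weight n m k) * X ^ k)"
  proof (rule sums_finite)
    fix k assume "k \<notin> ?K"
    then have e: "{C. C \<in> double_dimer_configs n m \<and> num_noncontractible n m C = k} = {}" by auto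
    show "of_real (config_weight n m k) * X ^ k = 0" unfolding config_weight_def e by simp
  qed simp
  also have "(\<Sum>k\<in>?K. of_real (config_weight n m k) * X ^ k)
      = (\<Sum>k\<in>?K. \<Sum>C\<in>{C \<in> double_dimer_configs n m. num_noncontractible n m C = k}.
          2 ^ num_contractible n m C * X ^ num_noncontractible n m C)"
    by (intro sum.cong refl) (simp add: config_weight_def sum_distrib_right)
  also have "\<dots> = loop_partition n m X"
    unfolding loop_partition_def by (rule sum.group) auto
  finally show ?thesis .
qed

lemma trace_prob_sums:
  "(\<lambda>k. of_real (trace_prob n m k) * X ^ k) sums (loop_partition n m X / loop_partition n m 1)"
proof -
  have "of_real (\<Sum>C\<in>double_dimer_configs n m. 2 ^ num_contractible n m C) = loop_partition n m 1"
    by (simp add: loop_partition_def)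
  moreover have "trace_prob n m k = config_weight n m k / (\<Sum>C\<in>double_dimer_configs n m. 2 ^ num_contractible n m C)" for k
    by (simp add: trace_prob_def config_weight_def)
  ultimately have "of_real (trace_prob n m k) * X ^ k = of_real (config_weight n m k) * X ^ k / loop_partition n m 1" for k
    by simp
  then show ?thesis using sums_divide[OF config_weight_sums] by simp
qed

lemma trace_prob_nonneg: "0 \<le> trace_prob n m k"
  unfolding trace_prob_def by (intro divide_nonneg_nonneg sum_nonneg) auto

text \<open>Pairs of covers are equally likely, and grouping them by their union counts each
  configuration once for every choice of halves of its loops. The noncontractible loops are the
  source of 2^k.\<close>

lemma double_dimer_prob_eq:
  assumes "2 \<le> n" "dimer_covers n m \<noteq> {}"
  shows "double_dimer_prob n m k = 2 ^ k * config_weight n m k / (real (card (dimer_covers n m)))\<^sup>2"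
proof -
  let ?D = "dimer_covers n m"
  let ?S = "{(M, N). num_noncontractible n m (M \<union> N) = k}"
  have pm: "pair_pmf (pmf_of_set ?D) (pmf_of_set ?D) = pmf_of_set (?D \<times> ?D)"
  proof (rule pmf_eqI)
    fix x :: "edge set \<times> edge set"
    obtain a b where x: "x = (a, b)" by (cases x)
    have "pmf (pmf_of_set ?D) c = indicator ?D c / real (card ?D)" for c
      using assms by (intro pmf_of_set) auto
    moreover have "pmf (pmf_of_set (?D \<times> ?D)) (a, b) = indicator (?D \<times> ?D) (a, b) / real (card (?D \<times> ?D))"
      using assms by (intro pmf_of_set) auto
    ultimately show "pmf (pair_pmf (pmf_of_set ?D) (pmf_of_set ?D)) x = pmf (pmf_of_set (?D \<times> ?D)) x"
      unfolding x pmf_pair by (simp add: indicator_def card_cartesian_product)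
  qed
  have "real (card (?D \<times> ?D \<inter> ?S)) = (\<Sum>x\<in>?D \<times> ?D \<inter> ?S. 1)" by simp
  also have "\<dots> = (\<Sum>x\<in>?D \<times> ?D. if x \<in> ?S then 1 else 0)"
    by (rule sum.inter_restrict) simp
  also have "\<dots> = (\<Sum>(M, N)\<in>?D \<times> ?D. if num_noncontractible n m (M \<union> N) = k then 1 else 0)"
    by (rule sum.cong) auto
  also have "\<dots> = (\<Sum>C\<in>double_dimer_configs n m.
        \<Sum>(M, N) | M \<in> ?D \<and> N \<in> ?D \<and> M \<union> N = C. if num_noncontractible n m (M \<union> N) = k then 1 else 0)"
    by (rule sum_pairs_by_union)
  also have "\<dots> = (\<Sum>C\<in>double_dimer_configs n m. if num_noncontractible n m C = k then 2 ^ k * 2 ^ num_contractible n m C else 0)"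
  proof (rule sum.cong[OF refl])
    fix C assume C: "C \<in> double_dimer_configs n m"
    have "(\<Sum>(M, N) | M \<in> ?D \<and> N \<in> ?D \<and> M \<union> N = C. if num_noncontractible n m (M \<union> N) = k then 1 else (0::real))
      = (\<Sum>x\<in>{(M, N). M \<in> ?D \<and> N \<in> ?D \<and> M \<union> N = C}. if num_noncontractible n m C = k then 1 else 0)"
      by (rule sum.cong) auto
    also have "\<dots> = (if num_noncontractible n m C = k then real (card {(M, N). M \<in> ?D \<and> N \<in> ?D \<and> M \<union> N = C}) else 0)"
      by simp
    finally show "(\<Sum>(M, N) | M \<in> ?D \<and> N \<in> ?D \<and> M \<union> N = C. if num_noncontractible n m (M \<union> N) = k then 1 else (0::real))
      = (if num_noncontractible n m C = k then 2 ^ k * 2 ^ num_contractible n m C else 0)"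
      unfolding card_pairs_with_union[OF assms(1) C] by simp
  qed
  also have "\<dots> = 2 ^ k * config_weight n m k"
    unfolding config_weight_def sum_distrib_left
    by (rule sum.inter_filter[symmetric]) simp
  finally have "real (card (?D \<times> ?D \<inter> ?S)) = 2 ^ k * config_weight n m k" .
  then show ?thesis
    unfolding double_dimer_prob_def pm using assms
    by (subst measure_pmf_of_set) (auto simp: card_cartesian_product power2_eq_square)
qed

text \<open>The factor 2^k is absorbed into X. The number of pairs of covers is
  \<open>loop_partition n m 2\<close>, by \<open>dimer_partition_mult\<close> at z = 1.\<close>

lemma double_dimer_prob_sums:
  assumes "2 \<le> n" "dimer_covers n m \<noteq> {}"
  shows "(\<lambda>k. of_real (double_dimer_prob n m k) * X ^ k) sums (loop_partition n m (2 * X) / loop_partition n m 2)"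
proof -
  have "dimer_partition n m 1 = of_nat (card (dimer_covers n m))"
    by (simp add: dimer_partition_def seam_weight_def)
  then have l2: "loop_partition n m 2 = (of_nat (card (dimer_covers n m)))\<^sup>2"
    using dimer_partition_mult[OF assms(1), of 1 m] by (simp add: power2_eq_square)
  have "of_real (double_dimer_prob n m k) * X ^ k = of_real (config_weight n m k) * (2 * X) ^ k / loop_partition n m 2" for k
    unfolding double_dimer_prob_eq[OF assms] l2 by (simp add: power_mult_distrib)
  then show ?thesis using sums_divide[OF config_weight_sums, of n m "2 * X" "loop_partition n m 2"] by (simp only:)
qed

section \<open>Crossing signs\<close>

lemma subsets_eqI: "A \<subseteq> M \<Longrightarrow> B \<subseteq> M \<Longrightarrow> (\<And>x. x \<in> M \<Longrightarrow> x \<in> A \<longleftrightarrow> x \<in> B) \<Longrightarrow> A = B"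
  by blast

definition pos :: "nat \<Rightarrow> vertex \<Rightarrow> nat" where
  "pos n v = snd v * (2 * n) + fst v"

definition first_pos :: "nat \<Rightarrow> edge \<Rightarrow> nat" where
  "first_pos n e = Min (pos n ` ends n e)"

definition last_pos :: "nat \<Rightarrow> edge \<Rightarrow> nat" where
  "last_pos n e = Max (pos n ` ends n e)"

text \<open>The parity of the number of arcs that cross the arc of an edge and start after it;
  \<open>crossing_sign\<close> shows that it does not depend on the cover.\<close>

fun vertical_sign :: "edge \<Rightarrow> int" where
  "vertical_sign (Hor x j) = 1"
| "vertical_sign (Ver x j) = (-1) ^ (x + 1)"

lemma row_major_less:
  fixes L :: nat
  assumes "x < L" "y < L"
  shows "j * L + x < k * L + y \<longleftrightarrow> j < k \<or> j = k \<and> x < y"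
proof -
  have lt: "a * L + c < b * L + d" if "a < b" "c < L" for a b c d
  proof -
    have "a * L + c < Suc a * L" using that by simp
    also have "\<dots> \<le> b * L" using that by (intro mult_le_mono1) simp
    finally show ?thesis by simp
  qed
  show ?thesis
    using lt[of j k x y] lt[of k j y x] assms by (cases j k rule: linorder_cases) auto
qed

lemma edge_span_Ver: "first_pos n (Ver x j) = j * (2 * n) + x" "last_pos n (Ver x j) = Suc j * (2 * n) + x"
  by (simp_all add: first_pos_def last_pos_def pos_def)

lemma edge_span_Hor:
  assumes "x + 1 < 2 * n"
  shows "first_pos n (Hor x j) = j * (2 * n) + x" "last_pos n (Hor x j) = j * (2 * n) + (x + 1)"
  using assms by (simp_all add: first_pos_def last_pos_def pos_def)

lemma edge_span_seam:
  assumes "0 < n"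
  shows "first_pos n (Hor (2 * n - 1) j) = j * (2 * n) + 0" "last_pos n (Hor (2 * n - 1) j) = j * (2 * n) + (2 * n - 1)"
proof -
  have "(2 * n - 1 + 1) mod (2 * n) = 0" using assms by simp
  then have "pos n ` ends n (Hor (2 * n - 1) j) = {j * (2 * n) + (2 * n - 1), j * (2 * n) + 0}"
    by (simp add: pos_def)
  then show "first_pos n (Hor (2 * n - 1) j) = j * (2 * n) + 0" "last_pos n (Hor (2 * n - 1) j) = j * (2 * n) + (2 * n - 1)"
    unfolding first_pos_def last_pos_def by simp_all
qed

section \<open>Crossings of arcs in row-major order\<close>

locale cover =
  fixes n m :: nat and M :: "edge set"
  assumes n2: "2 \<le> n" and M: "M \<in> dimer_covers n m"
begin

abbreviation L where "L \<equiv> 2 * n"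

text \<open>\<open>S r\<close>, \<open>H r\<close> and \<open>T r\<close> are the columns in which
  row \<open>r\<close> is covered by an edge going up, by the left end and by the right end of a
  horizontal edge, the seam edge counting as one from column 2 n - 1 to column 0. With
  \<open>S (r - 1)\<close>, the edges from below, they partition the row.\<close>

definition S :: "nat \<Rightarrow> nat set" where "S r = {x. Ver x r \<in> M}"
definition H :: "nat \<Rightarrow> nat set" where "H r = {x. Hor x r \<in> M}"
definition T :: "nat \<Rightarrow> nat set" where "T r = (\<lambda>x. (x + 1) mod L) ` H r"

lemma L4: "4 \<le> L" using n2 by simp

lemma S_bounds: "x \<in> S r \<Longrightarrow> x < L \<and> 1 \<le> r \<and> r < m"
  using dimer_covers_subset[OF M] by (auto simp: S_def)

lemma H_bounds: "x \<in> H r \<Longrightarrow> x < L \<and> 1 \<le> r \<and> r \<le> m"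
  using dimer_covers_subset[OF M] by (auto simp: H_def)

lemma T_iff: "x \<in> T r \<longleftrightarrow> x = 0 \<and> L - 1 \<in> H r \<or> (\<exists>y. x = Suc y \<and> x < L \<and> y \<in> H r)"
proof
  assume "x \<in> T r"
  then obtain y where y: "y \<in> H r" "x = (y + 1) mod L" by (auto simp: T_def)
  then have "y < L" using H_bounds by blast
  show "x = 0 \<and> L - 1 \<in> H r \<or> (\<exists>y. x = Suc y \<and> x < L \<and> y \<in> H r)"
  proof (cases "y + 1 < L")
    case True
    then show ?thesis using y by simp
  next
    case False
    then have "y = L - 1" using \<open>y < L\<close> by simp
    then show ?thesis using y L4 by simp
  qed
next
  assume "x = 0 \<and> L - 1 \<in> H r \<or> (\<exists>y. x = Suc y \<and> x < L \<and> y \<in> H r)"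
  then show "x \<in> T r"
  proof (elim disjE conjE exE)
    assume "x = 0" "L - 1 \<in> H r"
    then show "x \<in> T r" unfolding T_def using L4 by (intro image_eqI[of _ _ "L - 1"]) auto
  next
    fix y assume "x = Suc y" "x < L" "y \<in> H r"
    then show "x \<in> T r" unfolding T_def by (intro image_eqI[of _ _ y]) auto
  qed
qed

lemma finite_rows [simp]: "finite (S r)" "finite (H r)" "finite (T r)"
proof -
  show "finite (S r)" by (rule finite_subset[of _ "{..<L}"]) (use S_bounds in auto)
  show h: "finite (H r)" by (rule finite_subset[of _ "{..<L}"]) (use H_bounds in auto)
  show "finite (T r)" unfolding T_def using h by (rule finite_imageI)
qed

lemma incident_Ver: "(x, r) \<in> ends n (Ver y k) \<longleftrightarrow> x = y \<and> (r = k \<or> r = Suc k)"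
  by auto

lemma incident_Hor: "(x, r) \<in> ends n (Hor y k) \<longleftrightarrow> r = k \<and> (x = y \<or> x = (y + 1) mod L)"
  by auto

lemma row_partition:
  assumes "1 \<le> r" "r \<le> m"
  shows "S (r - 1) \<union> S r \<union> H r \<union> T r = {..<L}"
    "S (r - 1) \<inter> S r = {}" "(S (r - 1) \<union> S r) \<inter> H r = {}" "(S (r - 1) \<union> S r \<union> H r) \<inter> T r = {}"
proof -
  have r: "r = Suc (r - 1)" using assms by simp
  have i1: "(x, r) \<in> ends n (Ver x (r - 1)) \<and> Ver x (r - 1) \<in> M" if "x \<in> S (r - 1)" for x
    using that r by (simp add: S_def)
  have i2: "(x, r) \<in> ends n (Ver x r) \<and> Ver x r \<in> M" if "x \<in> S r" for x
    using that by (simp add: S_def)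
  have i3: "(x, r) \<in> ends n (Hor x r) \<and> Hor x r \<in> M" if "x \<in> H r" for x
    using that by (simp add: H_def)
  have i4: "((x + 1) mod L, r) \<in> ends n (Hor x r) \<and> Hor x r \<in> M" if "x \<in> H r" for x
    using that by (simp add: H_def)
  have uniq: "e = f" if "v \<in> ends n e \<and> e \<in> M" "v \<in> ends n f \<and> f \<in> M" for v e f
    using cover_edge_unique[OF M] that by blast
  show "S (r - 1) \<inter> S r = {}"
  proof (rule equals0I)
    fix x assume x: "x \<in> S (r - 1) \<inter> S r"
    have "Ver x (r - 1) = Ver x r" by (rule uniq[OF i1 i2]) (use x in blast)+
    then show False using r by simp
  qed
  show "(S (r - 1) \<union> S r) \<inter> H r = {}"
  proof (rule equals0I)
    fix x assume x: "x \<in> (S (r - 1) \<union> S r) \<inter> H r"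
    then have h: "x \<in> H r" by blast
    have "Hor x r = Ver x (r - 1) \<or> Hor x r = Ver x r"
      using x uniq[OF i3[OF h] i1] uniq[OF i3[OF h] i2] by blast
    then show False by simp
  qed
  show "(S (r - 1) \<union> S r \<union> H r) \<inter> T r = {}"
  proof (rule equals0I)
    fix x assume x: "x \<in> (S (r - 1) \<union> S r \<union> H r) \<inter> T r"
    then obtain y where y: "y \<in> H r" "x = (y + 1) mod L" by (auto simp: T_def)
    have yL: "y < L" using H_bounds y by blast
    note i = i4[OF y(1), folded y(2)]
    have "Hor y r = Ver x (r - 1) \<or> Hor y r = Ver x r \<or> Hor y r = Hor x r"
      using x uniq[OF i i1] uniq[OF i i2] uniq[OF i i3] by blast
    then have "y = x" by simp
    then show False using ends_Hor_Ver_neq[OF yL n2] y by simp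
  qed
  show "S (r - 1) \<union> S r \<union> H r \<union> T r = {..<L}"
  proof
    show "S (r - 1) \<union> S r \<union> H r \<union> T r \<subseteq> {..<L}"
      using S_bounds H_bounds L4 by (auto simp: T_iff)
    show "{..<L} \<subseteq> S (r - 1) \<union> S r \<union> H r \<union> T r"
    proof
      fix x assume "x \<in> {..<L}"
      then have "(x, r) \<in> cyl_vertices n m" using assms by (simp add: cyl_vertices_def)
      then obtain e where e: "e \<in> M" "(x, r) \<in> ends n e" using cover_edge_exists[OF M] by blast
      show "x \<in> S (r - 1) \<union> S r \<union> H r \<union> T r"
      proof (cases e)
        case (Hor y k)
        then show ?thesis using e unfolding Hor incident_Hor T_def H_def by blast
      next
        case (Ver y k)
        then have "x = y" "k = r \<or> k = r - 1" using e unfolding Ver incident_Ver by auto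
        then show ?thesis using e Ver by (auto simp: S_def)
      qed
    qed
  qed
qed

lemma card_T: "card (T r) = card (H r)"
  unfolding T_def
proof (rule card_image, rule inj_onI)
  fix x y assume xy: "x \<in> H r" "y \<in> H r" "(x + 1) mod L = (y + 1) mod L"
  then have "x < L" "y < L" using H_bounds by blast+
  then have "(x + 1) mod L = (if x + 1 = L then 0 else x + 1)" "(y + 1) mod L = (if y + 1 = L then 0 else y + 1)"
    by auto
  then show "x = y" using xy(3) by (auto split: if_splits)
qed

text \<open>A row has 2 n vertices and its horizontal edges cover an even number of them, so as many
  edges leave upwards as come from below, modulo 2. No edge comes from below row 1.\<close>

lemma even_card_S: "even (card (S r))"
proof (induction r)
  case 0
  have "S 0 = {}" using S_bounds[of _ 0] by auto
  then show ?case by simp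
next
  case (Suc r)
  show ?case
  proof (cases "Suc r \<le> m")
    case True
    note p = row_partition[of "Suc r", simplified diff_Suc_1, OF _ True]
    have "L = card (S r \<union> S (Suc r) \<union> H (Suc r) \<union> T (Suc r))"
      unfolding p(1)[simplified] by simp
    also have "\<dots> = card (S r) + card (S (Suc r)) + 2 * card (H (Suc r))"
      using p(2-4) by (simp add: card_Un_disjoint card_T)
    finally have "even (card (S r) + card (S (Suc r)) + 2 * card (H (Suc r)))"
      by (metis dvd_triv_left)
    then show ?thesis using Suc.IH by simp
  next
    case False
    then have "S (Suc r) = {}" using S_bounds[of _ "Suc r"] by auto
    then show ?thesis by simp
  qed
qed

text \<open>Each crossing is attributed to the arc that starts first, in accordance with the
  exponent in \<open>sign_crossing_invariant\<close>.\<close>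

definition crossed :: "edge \<Rightarrow> edge set" where
  "crossed e = {f \<in> M. first_pos n e < first_pos n f \<and> first_pos n f < last_pos n e \<and> last_pos n e < last_pos n f}"

lemma seam_edge_cases:
  assumes "x < L"
  obtains "x + 1 < L" | "x = L - 1"
  using assms by linarith

text \<open>The arc reaches from column \<open>x\<close> of row \<open>j\<close> to column
  \<open>x\<close> of the next row. Arcs starting in between and ending later are the vertical ones
  from the right part of row \<open>j\<close>, the vertical ones from the left part of the next row,
  and the seam edge of the next row, which spans that row.\<close>

lemma crossed_Ver:
  assumes e: "Ver x j \<in> M"
  shows "crossed (Ver x j) = (\<lambda>y. Ver y j) ` (S j \<inter> {x<..}) \<union> (\<lambda>y. Ver y (Suc j)) ` (S (Suc j) \<inter> {..<x})
     \<union> (\<lambda>y. Hor y (Suc j)) ` (H (Suc j) \<inter> {L - 1})"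
proof -
  have xS: "x \<in> S j" using e by (simp add: S_def)
  then have xL: "x < L" and j: "1 \<le> j" "Suc j \<le> m" using S_bounds[of x j] by auto
  note p = row_partition[of "Suc j", simplified diff_Suc_1, OF _ j(2)]
  \<comment> \<open>The vertex above is covered vertically, so it is not an end of the seam
    edge.\<close>
  have seam: "0 < x \<and> x < L - 1" if "L - 1 \<in> H (Suc j)"
  proof -
    have "x \<notin> H (Suc j)" "x \<notin> T (Suc j)" using p(3,4) xS by auto
    then have "x \<noteq> L - 1" "x \<noteq> 0" using that by (auto simp: T_iff)
    then show ?thesis using xL by simp
  qed
  have iff: "f \<in> crossed (Ver x j) \<longleftrightarrow> f \<in> (\<lambda>y. Ver y j) ` (S j \<inter> {x<..}) \<union> (\<lambda>y. Ver y (Suc j)) ` (S (Suc j) \<inter> {..<x})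
     \<union> (\<lambda>y. Hor y (Suc j)) ` (H (Suc j) \<inter> {L - 1})" if f: "f \<in> M" for f
  proof (cases f)
    case (Ver y k)
    have yL: "y < L" using f Ver S_bounds[of y k] by (simp add: S_def)
    have "f \<in> crossed (Ver x j) \<longleftrightarrow> j = k \<and> x < y \<or> k = Suc j \<and> y < x"
      using f unfolding Ver crossed_def mem_Collect_eq edge_span_Ver row_major_less[OF xL yL] row_major_less[OF yL xL]
      by auto
    then show ?thesis using f Ver by (auto simp: S_def)
  next
    case (Hor y k)
    have yL: "y < L" using f Hor H_bounds[of y k] by (simp add: H_def)
    have "f \<in> crossed (Ver x j) \<longleftrightarrow> k = Suc j \<and> y = L - 1"
      using yL
    proof (cases rule: seam_edge_cases)
      case 1
      show ?thesis
        using f 1 unfolding Hor crossed_def mem_Collect_eq edge_span_Ver edge_span_Hor[OF 1]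
          row_major_less[OF xL yL] row_major_less[OF yL xL] row_major_less[OF xL 1] by auto
    next
      case 2
      have L0: "0 < L" "L - 1 < L" and n0: "0 < n" using L4 by simp_all
      have "f \<in> crossed (Ver x j) \<longleftrightarrow> k = Suc j \<and> 0 < x \<and> x < L - 1"
        using f unfolding Hor 2 crossed_def mem_Collect_eq edge_span_Ver edge_span_seam[OF n0]
          row_major_less[OF xL L0(1)] row_major_less[OF L0(1) xL] row_major_less[OF xL L0(2)]
        by auto
      moreover have "0 < x \<and> x < L - 1" if k: "k = Suc j"
      proof (rule seam)
        show "L - 1 \<in> H (Suc j)" using f unfolding Hor 2 k H_def by simp
      qed
      ultimately have "f \<in> crossed (Ver x j) \<longleftrightarrow> k = Suc j" by argo
      then show ?thesis using 2 by argo
    qed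
    then show ?thesis using f Hor by (auto simp: H_def)
  qed
  have "crossed (Ver x j) \<subseteq> M" by (auto simp: crossed_def)
  moreover have "(\<lambda>y. Ver y j) ` (S j \<inter> {x<..}) \<union> (\<lambda>y. Ver y (Suc j)) ` (S (Suc j) \<inter> {..<x})
     \<union> (\<lambda>y. Hor y (Suc j)) ` (H (Suc j) \<inter> {L - 1}) \<subseteq> M"
    by (auto simp: S_def H_def)
  ultimately show ?thesis using iff by (rule subsets_eqI)
qed

text \<open>Counting the columns left of \<open>x\<close> in the upper row gives x = c + b + 2 h +
  w, and an even number c + 1 + a of edges rises from row \<open>j\<close>. Hence a + b + w, the
  number of crossings, has the parity of x + 1.\<close>

lemma parity_crossed_Ver:
  assumes e: "Ver x j \<in> M"
  shows "even (card (crossed (Ver x j))) \<longleftrightarrow> odd x"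
proof -
  have xS: "x \<in> S j" using e by (simp add: S_def)
  then have xL: "x < L" and j: "1 \<le> j" "Suc j \<le> m" using S_bounds[of x j] by auto
  note p = row_partition[of "Suc j", simplified diff_Suc_1, OF _ j(2)]
  define a b c h w where "a = card (S j \<inter> {x<..})" and "b = card (S (Suc j) \<inter> {..<x})"
    and "c = card (S j \<inter> {..<x})" and "h = card (H (Suc j) \<inter> {..<x})" and "w = card (H (Suc j) \<inter> {L - 1})"
  have "card (crossed (Ver x j)) = card ((\<lambda>y. Ver y j) ` (S j \<inter> {x<..})) + card ((\<lambda>y. Ver y (Suc j)) ` (S (Suc j) \<inter> {..<x}))
     + card ((\<lambda>y. Hor y (Suc j)) ` (H (Suc j) \<inter> {L - 1}))"
    unfolding crossed_Ver[OF e] by (subst card_Un_disjoint; (subst card_Un_disjoint)?) auto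
  then have cr: "card (crossed (Ver x j)) = a + b + w"
    by (simp add: card_image inj_on_def a_def b_def w_def)
  have "S j = (S j \<inter> {..<x}) \<union> {x} \<union> (S j \<inter> {x<..})" using xS by auto
  then have "card (S j) = card ((S j \<inter> {..<x}) \<union> {x} \<union> (S j \<inter> {x<..}))" by simp
  also have "\<dots> = c + 1 + a"
    unfolding a_def c_def by (subst card_Un_disjoint; (subst card_Un_disjoint)?) auto
  finally have S: "even (c + 1 + a)" using even_card_S[of j] by simp
  have xT: "x \<notin> T (Suc j)" using p(4) xS by auto
  \<comment> \<open>Column \<open>x\<close> is covered vertically, so no horizontal edge leads into
    it: those starting left of \<open>x\<close> also end left of it, and only the seam edge adds
    another right end, in column 0.\<close>
  have "T (Suc j) \<inter> {..<x} = Suc ` (H (Suc j) \<inter> {..<x}) \<union> (\<lambda>_. 0) ` (H (Suc j) \<inter> {L - 1})"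
  proof (rule Set.set_eqI)
    fix z
    have "Suc y < x" if "y \<in> H (Suc j)" "y < x" for y
    proof -
      have "Suc y \<noteq> x" using xT that xL by (auto simp: T_iff)
      then show ?thesis using that by simp
    qed
    moreover have "0 < x" if "L - 1 \<in> H (Suc j)" using xT that by (auto simp: T_iff intro: gr0I)
    ultimately show "z \<in> T (Suc j) \<inter> {..<x} \<longleftrightarrow> z \<in> Suc ` (H (Suc j) \<inter> {..<x}) \<union> (\<lambda>_. 0) ` (H (Suc j) \<inter> {L - 1})"
      using xL by (cases z) (auto simp: image_iff T_iff)
  qed
  moreover have "card (Suc ` (H (Suc j) \<inter> {..<x}) \<union> (\<lambda>_. 0) ` (H (Suc j) \<inter> {L - 1})) = h + w"
  proof (subst card_Un_disjoint)
    have "card ((\<lambda>_. 0::nat) ` (H (Suc j) \<inter> {L - 1})) = w"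
      unfolding w_def by (intro card_image inj_onI) auto
    then show "card (Suc ` (H (Suc j) \<inter> {..<x})) + card ((\<lambda>_. 0::nat) ` (H (Suc j) \<inter> {L - 1})) = h + w"
      by (simp add: card_image h_def)
  qed auto
  ultimately have T: "card (T (Suc j) \<inter> {..<x}) = h + w" by simp
  have j1: "1 \<le> Suc j" by simp
  have "{..<x} = {..<L} \<inter> {..<x}" using xL by auto
  then have below: "{..<x} = (S j \<inter> {..<x}) \<union> (S (Suc j) \<inter> {..<x}) \<union> (H (Suc j) \<inter> {..<x}) \<union> (T (Suc j) \<inter> {..<x})"
    unfolding p(1)[OF j1, symmetric] Int_Un_distrib2 .
  have "x = card ((S j \<inter> {..<x}) \<union> (S (Suc j) \<inter> {..<x}) \<union> (H (Suc j) \<inter> {..<x}) \<union> (T (Suc j) \<inter> {..<x}))"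
    unfolding below[symmetric] by simp
  also have "\<dots> = c + b + h + (h + w)"
  proof -
    have d: "(S j \<inter> {..<x}) \<inter> (S (Suc j) \<inter> {..<x}) = {}"
      "((S j \<inter> {..<x}) \<union> (S (Suc j) \<inter> {..<x})) \<inter> (H (Suc j) \<inter> {..<x}) = {}"
      "((S j \<inter> {..<x}) \<union> (S (Suc j) \<inter> {..<x}) \<union> (H (Suc j) \<inter> {..<x})) \<inter> (T (Suc j) \<inter> {..<x}) = {}"
      using p(2-4) by auto
    show ?thesis
      by (simp add: card_Un_disjoint[OF _ _ d(3)] card_Un_disjoint[OF _ _ d(2)] card_Un_disjoint[OF _ _ d(1)] T
          flip: b_def c_def h_def)
  qed
  finally have "x = c + b + h + (h + w)" .
  then show ?thesis using S unfolding cr by presburger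
qed

text \<open>The arc spans the whole row, and the first and last vertex are its own ends. It is thus
  crossed by just the edges rising from that row, whose number is even by
  \<open>even_card_S\<close>.\<close>

lemma crossed_seam:
  assumes e: "Hor (L - 1) j \<in> M"
  shows "crossed (Hor (L - 1) j) = (\<lambda>y. Ver y j) ` S j"
proof -
  have eH: "L - 1 \<in> H j" using e by (simp add: H_def)
  have j: "1 \<le> j" "j \<le> m" using H_bounds[OF eH] by auto
  note p = row_partition[OF j]
  have L0: "0 < L" "L - 1 < L" and n0: "0 < n" using L4 by simp_all
  have T0: "0 \<in> T j" using eH by (simp add: T_iff)
  have iff: "f \<in> crossed (Hor (L - 1) j) \<longleftrightarrow> f \<in> (\<lambda>y. Ver y j) ` S j" if f: "f \<in> M" for f
  proof (cases f)
    case (Ver y k)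
    have yL: "y < L" using f Ver S_bounds[of y k] by (simp add: S_def)
    have "f \<in> crossed (Hor (L - 1) j) \<longleftrightarrow> j = k \<and> 0 < y \<and> y < L - 1"
      using f yL unfolding Ver crossed_def mem_Collect_eq edge_span_Ver edge_span_seam[OF n0]
        row_major_less[OF L0(1) yL] row_major_less[OF yL L0(2)] row_major_less[OF L0(2) yL] by auto
    moreover have "0 < y \<and> y < L - 1" if "j = k"
    proof -
      have "y \<in> S j" using f Ver that by (simp add: S_def)
      then have "y \<noteq> L - 1" "y \<noteq> 0" using p(3,4) eH T0 by auto
      then show ?thesis using yL by simp
    qed
    ultimately show ?thesis using f Ver by (auto simp: S_def)
  next
    case (Hor y k)
    have yL: "y < L" using f Hor H_bounds[of y k] by (simp add: H_def)
    have "f \<notin> crossed (Hor (L - 1) j)"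
      using yL
    proof (cases rule: seam_edge_cases)
      case 1
      show ?thesis
        using f 1 unfolding Hor crossed_def mem_Collect_eq edge_span_seam[OF n0] edge_span_Hor[OF 1]
          row_major_less[OF L0(1) yL] row_major_less[OF yL L0(2)] row_major_less[OF L0(2) 1] by auto
    next
      case 2
      show ?thesis
        using f unfolding Hor 2 crossed_def mem_Collect_eq edge_span_seam[OF n0]
          row_major_less[OF L0(1) L0(1)] row_major_less[OF L0(1) L0(2)] row_major_less[OF L0(2) L0(2)] by auto
    qed
    then show ?thesis using Hor by auto
  qed
  have "crossed (Hor (L - 1) j) \<subseteq> M" "(\<lambda>y. Ver y j) ` S j \<subseteq> M" by (auto simp: crossed_def S_def)
  then show ?thesis using iff by (rule subsets_eqI)
qed

lemma crossed_Hor: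
  assumes "x + 1 < L"
  shows "crossed (Hor x j) = {}"
  unfolding crossed_def edge_span_Hor[OF assms] by auto

lemma crossing_sign:
  assumes e: "e \<in> M"
  shows "(-1) ^ card (crossed e) = vertical_sign e"
proof (cases e)
  case (Ver x j)
  have "even (card (crossed (Ver x j))) \<longleftrightarrow> odd x" using parity_crossed_Ver e Ver by blast
  then show ?thesis unfolding Ver by (cases "odd x") simp_all
next
  case (Hor x j)
  have "x < L" using e Hor H_bounds[of x j] by (simp add: H_def)
  then show ?thesis
  proof (cases rule: seam_edge_cases)
    case 1
    then show ?thesis by (simp add: Hor crossed_Hor)
  next
    case 2
    have "card (crossed (Hor (L - 1) j)) = card (S j)"
      unfolding crossed_seam[OF e[unfolded Hor 2]] by (intro card_image inj_onI) simp
    then show ?thesis unfolding Hor 2 using even_card_S[of j] by simp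
  qed
qed

end

section \<open>The Kasteleyn determinant\<close>

text \<open>The vertices of each colour in row-major order, \<open>n\<close> per row. Rows are
  numbered from 1, so \<open>i div n\<close> is the row minus 1 and its parity is that of the white
  columns.\<close>

definition white_vertex :: "nat \<Rightarrow> nat \<Rightarrow> vertex" where
  "white_vertex n i = (2 * (i mod n) + i div n mod 2, i div n + 1)"

definition black_vertex :: "nat \<Rightarrow> nat \<Rightarrow> vertex" where
  "black_vertex n i = (2 * (i mod n) + (1 - i div n mod 2), i div n + 1)"

text \<open>Columns 2 p and 2 p + 1 hold one vertex of each colour, so the i-th vertex of either
  colour has position 2 i + 2 n or the next one. Both enumerations are therefore increasing, as
  \<open>sign_crossing_invariant\<close> demands.\<close>

lemma pos_row_index: "pos n (2 * (i mod n) + r, i div n + 1) = 2 * i + 2 * n + r"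
proof -
  have "(j + 1) * (2 * n) + (2 * p + r) = 2 * (j * n + p) + 2 * n + r" for j p
    by (simp add: algebra_simps)
  from this[of "i div n" "i mod n"] show ?thesis
    unfolding pos_def fst_conv snd_conv div_mult_mod_eq .
qed

lemma pos_white_vertex: "pos n (white_vertex n i) = 2 * i + 2 * n + i div n mod 2"
  unfolding white_vertex_def by (rule pos_row_index)

lemma pos_black_vertex: "pos n (black_vertex n i) = 2 * i + 2 * n + (1 - i div n mod 2)"
  unfolding black_vertex_def by (rule pos_row_index)

lemma pos_white_vertex_mono: "i < k \<Longrightarrow> pos n (white_vertex n i) < pos n (white_vertex n k)"
proof -
  have "i div n mod 2 < 2" by simp
  then show "i < k \<Longrightarrow> pos n (white_vertex n i) < pos n (white_vertex n k)" unfolding pos_white_vertex by linarith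
qed

lemma pos_black_vertex_mono: "i < k \<Longrightarrow> pos n (black_vertex n i) < pos n (black_vertex n k)"
  unfolding pos_black_vertex by linarith

lemma pos_white_vertex_neq_black_vertex: "pos n (white_vertex n i) \<noteq> pos n (black_vertex n k)"
proof
  assume eq: "pos n (white_vertex n i) = pos n (black_vertex n k)"
  have r: "i div n mod 2 \<le> 1" by linarith
  then have "i = k" using eq unfolding pos_white_vertex pos_black_vertex by linarith
  with eq have "i div n mod 2 = 1 - i div n mod 2" unfolding pos_white_vertex pos_black_vertex by simp
  moreover have "a \<noteq> 1 - a" for a :: nat by presburger
  ultimately show False by blast
qed

lemma white_vertex_inject: "white_vertex n i = white_vertex n k \<Longrightarrow> i = k"
  using pos_white_vertex_mono by (metis less_irrefl linorder_neqE_nat)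

lemma black_vertex_inject: "black_vertex n i = black_vertex n k \<Longrightarrow> i = k"
  using pos_black_vertex_mono by (metis less_irrefl linorder_neqE_nat)

lemma white_white_vertex: "white (white_vertex n i)"
  by (simp add: white_def white_vertex_def)

lemma black_black_vertex: "\<not> white (black_vertex n i)"
proof -
  have "even (1 - i div n mod 2) \<longleftrightarrow> odd (i div n)" by (cases "even (i div n)") auto
  then show ?thesis by (simp add: white_def black_vertex_def)
qed

lemma row_index_less: "0 < n \<Longrightarrow> i < n * m \<Longrightarrow> i div n < m" for n :: nat
  by (simp add: less_mult_imp_div_less mult.commute)

lemma white_vertex_in_vertices:
  assumes "0 < n" "i < n * m"
  shows "white_vertex n i \<in> cyl_vertices n m"
proof -
  have "i mod n < n" "i div n mod 2 < 2" using assms by simp_all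
  then have "2 * (i mod n) + i div n mod 2 < 2 * n" by linarith
  then show ?thesis using row_index_less[OF assms] by (simp add: white_vertex_def cyl_vertices_def)
qed

lemma black_vertex_in_vertices:
  assumes "0 < n" "i < n * m"
  shows "black_vertex n i \<in> cyl_vertices n m"
proof -
  have "i mod n < n" using assms by simp
  then have "2 * (i mod n) + (1 - i div n mod 2) < 2 * n" by linarith
  then show ?thesis using row_index_less[OF assms] by (simp add: black_vertex_def cyl_vertices_def)
qed

lemma vertex_index:
  assumes "v \<in> cyl_vertices n m"
  obtains i where "i < n * m" "v = (if white v then white_vertex n i else black_vertex n i)"
proof -
  obtain x j where v: "v = (x, Suc j)" "x < 2 * n" "j < m"
    using assms by (cases v; cases "snd v") (auto simp: cyl_vertices_def)
  define i where "i = j * n + x div 2"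
  have xn: "x div 2 < n" using v by (simp add: less_mult_imp_div_less)
  then have i: "i div n = j" "i mod n = x div 2" by (simp_all add: i_def)
  have "i < Suc j * n" using xn by (simp add: i_def)
  also have "\<dots> \<le> m * n" using v by (intro mult_le_mono1) simp
  finally have "i < n * m" by (simp add: mult.commute)
  moreover have "v = (if white v then white_vertex n i else black_vertex n i)"
  proof -
    have x: "x = 2 * (x div 2) + x mod 2" by simp
    have w: "white v \<longleftrightarrow> x mod 2 = j mod 2" by (auto simp: white_def v(1) mod2_eq_if)
    show ?thesis
    proof (cases "x mod 2 = j mod 2")
      case True
      have "v = white_vertex n i" unfolding white_vertex_def i v(1) using x unfolding True prod.inject Suc_eq_plus1 by blast
      then show ?thesis using w True by simp
    next
      case False
      then have f: "x mod 2 = 1 - j mod 2" by presburger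
      have "v = black_vertex n i" unfolding black_vertex_def i v(1) using x unfolding f prod.inject Suc_eq_plus1 by blast
      then show ?thesis using w False by simp
    qed
  qed
  ultimately show thesis using that by blast
qed

definition kas_edges :: "nat \<Rightarrow> nat \<Rightarrow> nat \<Rightarrow> nat \<Rightarrow> edge set" where
  "kas_edges n m i k = {e \<in> cyl_edges n m. ends n e = {white_vertex n i, black_vertex n k}}"

text \<open>The two signs are the factors that accompany the sign of the permutation in
  \<open>sign_crossing_invariant\<close>: the direction of the arc and the parity of its crossings.
  All covers then enter the determinant with the same sign.\<close>

definition kas_entry :: "nat \<Rightarrow> nat \<Rightarrow> complex \<Rightarrow> nat \<Rightarrow> nat \<Rightarrow> complex" where
  "kas_entry n m z i k = (\<Sum>e\<in>kas_edges n m i k.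
     of_int (sgn (int (pos n (white_vertex n i)) - int (pos n (black_vertex n k))) * vertical_sign e) * seam_weight n z e)"

definition matching_perms :: "nat \<Rightarrow> nat \<Rightarrow> (nat \<Rightarrow> nat) set" where
  "matching_perms n m = {p. p permutes {..<n * m} \<and> (\<forall>i<n * m. kas_edges n m i (p i) \<noteq> {})}"

definition perm_edge :: "nat \<Rightarrow> nat \<Rightarrow> (nat \<Rightarrow> nat) \<Rightarrow> nat \<Rightarrow> edge" where
  "perm_edge n m p i = the_elem (kas_edges n m i (p i))"

definition perm_cover :: "nat \<Rightarrow> nat \<Rightarrow> (nat \<Rightarrow> nat) \<Rightarrow> edge set" where
  "perm_cover n m p = perm_edge n m p ` {..<n * m}"

section \<open>Dimer covers as permutations\<close>

lemma kas_edges_unique: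
  assumes "2 \<le> n" "e \<in> kas_edges n m i k"
  shows "kas_edges n m i k = {e}"
proof -
  have "f = e" if "f \<in> kas_edges n m i k" for f
    using that assms ends_inject[OF assms(1), of f m e] by (simp add: kas_edges_def)
  then show ?thesis using assms(2) by blast
qed

lemma kas_edges_perm:
  assumes "2 \<le> n" "p \<in> matching_perms n m" "i < n * m"
  shows "kas_edges n m i (p i) = {perm_edge n m p i}"
proof -
  have "kas_edges n m i (p i) \<noteq> {}" using assms by (simp add: matching_perms_def)
  then obtain e where e: "e \<in> kas_edges n m i (p i)" by blast
  show ?thesis unfolding perm_edge_def kas_edges_unique[OF assms(1) e] by simp
qed

lemma perm_edge:
  assumes "2 \<le> n" "p \<in> matching_perms n m" "i < n * m"
  shows "perm_edge n m p i \<in> cyl_edges n m" "ends n (perm_edge n m p i) = {white_vertex n i, black_vertex n (p i)}"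
proof -
  have "perm_edge n m p i \<in> kas_edges n m i (p i)" using kas_edges_perm[OF assms] by simp
  then show "perm_edge n m p i \<in> cyl_edges n m" "ends n (perm_edge n m p i) = {white_vertex n i, black_vertex n (p i)}"
    by (simp_all add: kas_edges_def)
qed

lemma white_vertex_neq_black_vertex: "white_vertex n i \<noteq> black_vertex n k"
  using white_white_vertex black_black_vertex by metis

lemma perm_edge_inject:
  assumes "2 \<le> n" "p \<in> matching_perms n m" "q \<in> matching_perms n m" "i < n * m" "k < n * m"
    "perm_edge n m p i = perm_edge n m q k"
  shows "i = k \<and> p i = q k"
proof -
  have "{white_vertex n i, black_vertex n (p i)} = {white_vertex n k, black_vertex n (q k)}"
    using perm_edge(2)[OF assms(1,2,4)] perm_edge(2)[OF assms(1,3,5)] assms(6) by simp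
  then have "white_vertex n i = white_vertex n k" "black_vertex n (p i) = black_vertex n (q k)"
    unfolding doubleton_eq_iff using white_vertex_neq_black_vertex by metis+
  then show ?thesis using white_vertex_inject black_vertex_inject by blast
qed

lemma matching_permsD:
  assumes "p \<in> matching_perms n m"
  shows "p permutes {..<n * m}" "i < n * m \<Longrightarrow> p i < n * m"
proof -
  show p: "p permutes {..<n * m}" using assms by (simp add: matching_perms_def)
  show "i < n * m \<Longrightarrow> p i < n * m" using permutes_in_image[OF p, of i] by simp
qed

lemma perm_cover_in_covers:
  assumes n: "2 \<le> n" and p: "p \<in> matching_perms n m"
  shows "perm_cover n m p \<in> dimer_covers n m"
  unfolding dimer_covers_def mem_Collect_eq
proof (intro conjI ballI)
  show "perm_cover n m p \<subseteq> cyl_edges n m"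
    using perm_edge(1)[OF n p] by (auto simp: perm_cover_def)
  fix v assume v: "v \<in> cyl_vertices n m"
  obtain i where i: "i < n * m" "v = (if white v then white_vertex n i else black_vertex n i)" using vertex_index[OF v] .
  obtain k where k: "k < n * m" "v = (if white v then white_vertex n k else black_vertex n (p k))"
  proof (cases "white v")
    case True then show ?thesis using i that[of i] by simp
  next
    case False
    have "i \<in> p ` {..<n * m}" using permutes_image[OF matching_permsD(1)[OF p]] i(1) by simp
    then obtain k where "k < n * m" "p k = i" by auto
    then show ?thesis using False i that[of k] by simp
  qed
  show "\<exists>!e. e \<in> perm_cover n m p \<and> v \<in> ends n e"
  proof (rule ex1I[of _ "perm_edge n m p k"])
    show "perm_edge n m p k \<in> perm_cover n m p \<and> v \<in> ends n (perm_edge n m p k)"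
      using k perm_edge(2)[OF n p k(1)] by (auto simp: perm_cover_def split: if_splits)
    fix e assume "e \<in> perm_cover n m p \<and> v \<in> ends n e"
    then obtain l where l: "l < n * m" "e = perm_edge n m p l" "v \<in> ends n e" by (auto simp: perm_cover_def)
    then have "v = white_vertex n l \<or> v = black_vertex n (p l)" using perm_edge(2)[OF n p l(1)] by simp
    then have "white_vertex n l = white_vertex n k \<or> black_vertex n (p l) = black_vertex n (p k)"
      using k(2) white_white_vertex black_black_vertex by (metis (full_types))
    then have "l = k"
    proof
      assume "black_vertex n (p l) = black_vertex n (p k)"
      then have "p l = p k" by (rule black_vertex_inject)
      then show ?thesis using permutes_inj[OF matching_permsD(1)[OF p]] by (simp add: inj_eq)
    qed (rule white_vertex_inject)
    then show "e = perm_edge n m p k" using l by simp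
  qed
qed

text \<open>A cover sends the index of each white vertex to that of its black partner. This is
  injective since a black vertex has only one edge in the cover, and the edge is recovered from its
  ends by \<open>kas_edges_unique\<close>.\<close>

lemma perm_cover_bij:
  assumes n: "2 \<le> n"
  shows "bij_betw (perm_cover n m) (matching_perms n m) (dimer_covers n m)"
proof (rule bij_betwI')
  fix p q assume pq: "p \<in> matching_perms n m" "q \<in> matching_perms n m"
  show "(perm_cover n m p = perm_cover n m q) = (p = q)"
  proof
    assume eq: "perm_cover n m p = perm_cover n m q"
    show "p = q"
    proof (rule ext)
      fix i
      show "p i = q i"
      proof (cases "i < n * m")
        case True
        then have "perm_edge n m p i \<in> perm_cover n m q" unfolding eq[symmetric] by (simp add: perm_cover_def)
        then obtain k where "k < n * m" "perm_edge n m p i = perm_edge n m q k" by (auto simp: perm_cover_def)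
        then show ?thesis using perm_edge_inject[OF n pq True] by blast
      next
        case False
        then have "i \<notin> {..<n * m}" by simp
        then show ?thesis using matching_permsD(1)[OF pq(1)] matching_permsD(1)[OF pq(2)]
          by (simp add: permutes_not_in)
      qed
    qed
  qed simp
next
  fix p assume "p \<in> matching_perms n m"
  then show "perm_cover n m p \<in> dimer_covers n m" by (rule perm_cover_in_covers[OF n])
next
  fix M assume M: "M \<in> dimer_covers n m"
  have n0: "0 < n" using n by simp
  have "\<exists>k<n * m. \<exists>e\<in>M. ends n e = {white_vertex n i, black_vertex n k}" if i: "i < n * m" for i
  proof -
    obtain e where e: "e \<in> M" "white_vertex n i \<in> ends n e" using cover_edge_exists[OF M white_vertex_in_vertices[OF n0 i]] .
    obtain a b where ab: "ends n e = {a, b}" "white a" "\<not> white b" by (rule ends_white_black)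
    have a: "a = white_vertex n i" using e(2) ab white_white_vertex[of n i] by auto
    have "b \<in> cyl_vertices n m" using ends_subset_vertices[of e n m] dimer_covers_subset[OF M] e(1) ab by blast
    then obtain k where "k < n * m" "b = black_vertex n k" using vertex_index[of b n m] ab(3) by auto
    then show ?thesis using e(1) ab(1) a by blast
  qed
  then obtain f where f: "\<And>i. i < n * m \<Longrightarrow> f i < n * m \<and> (\<exists>e\<in>M. ends n e = {white_vertex n i, black_vertex n (f i)})"
    by metis
  define p where "p i = (if i < n * m then f i else i)" for i
  have inj: "inj_on p {..<n * m}"
  proof (rule inj_onI)
    fix i k assume ik: "i \<in> {..<n * m}" "k \<in> {..<n * m}" "p i = p k"
    obtain e where e: "e \<in> M" "ends n e = {white_vertex n i, black_vertex n (f i)}" using f ik by blast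
    obtain e' where e': "e' \<in> M" "ends n e' = {white_vertex n k, black_vertex n (f k)}" using f ik by blast
    have "f i = f k" using ik by (simp add: p_def)
    then have "e = e'" using cover_edge_unique[OF M e(1) e'(1), of "black_vertex n (f i)"] e e' by simp
    then have "white_vertex n i \<in> {white_vertex n k, black_vertex n (f k)}" using e e' by auto
    then show "i = k" using white_vertex_neq_black_vertex white_vertex_inject by blast
  qed
  moreover have "p ` {..<n * m} \<subseteq> {..<n * m}" using f by (auto simp: p_def)
  ultimately have "bij_betw p {..<n * m} {..<n * m}"
    by (simp add: bij_betw_def endo_inj_surj)
  then have perm: "p permutes {..<n * m}" by (rule bij_imp_permutes) (simp add: p_def)
  have edge: "\<exists>e\<in>M. e \<in> kas_edges n m i (p i)" if "i < n * m" for i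
    using f[OF that] that dimer_covers_subset[OF M] by (auto simp: kas_edges_def p_def)
  then have pM: "p \<in> matching_perms n m" using perm by (auto simp: matching_perms_def)
  have in_M: "perm_edge n m p i \<in> M" if "i < n * m" for i
    using edge[OF that] kas_edges_perm[OF n pM that] by auto
  have "perm_cover n m p = M"
  proof
    show "perm_cover n m p \<subseteq> M" using in_M by (auto simp: perm_cover_def)
    show "M \<subseteq> perm_cover n m p"
    proof
      fix e assume e: "e \<in> M"
      obtain a b where ab: "ends n e = {a, b}" "white a" "\<not> white b" by (rule ends_white_black)
      have "a \<in> cyl_vertices n m" using ends_subset_vertices[of e n m] dimer_covers_subset[OF M] e ab by blast
      then obtain i where i: "i < n * m" "a = white_vertex n i" using vertex_index[of a n m] ab(2) by auto
      have "e = perm_edge n m p i"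
        using cover_edge_unique[OF M e in_M[OF i(1)], of a] ab(1) perm_edge(2)[OF n pM i(1)] i(2) by simp
      then show "e \<in> perm_cover n m p" using i(1) by (simp add: perm_cover_def)
    qed
  qed
  then show "\<exists>p\<in>matching_perms n m. M = perm_cover n m p" using pM by blast
qed

text \<open>The constant of \<open>sign_crossing_invariant\<close> for the positions of the white
  and black vertices. The product of the determinants at \<open>z\<close> and
  \<open>inverse z\<close> contains only its square.\<close>

definition kas_sign :: "nat \<Rightarrow> nat \<Rightarrow> int" where
  "kas_sign n m = (\<Prod>k<n * m. \<Prod>i<k. -1) * (\<Prod>i<n * m. \<Prod>k<n * m. sgn (int (pos n (white_vertex n i)) - int (pos n (black_vertex n k))))"

lemma kas_sign_square: "kas_sign n m * kas_sign n m = 1"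
proof -
  have "sgn (int (pos n (white_vertex n i)) - int (pos n (black_vertex n k))) * sgn (int (pos n (white_vertex n i)) - int (pos n (black_vertex n k))) = 1" for i k
    using pos_white_vertex_neq_black_vertex[of n i k] by (simp add: sgn_if)
  then have "(\<Prod>i<n * m. \<Prod>k<n * m. sgn (int (pos n (white_vertex n i)) - int (pos n (black_vertex n k))))
     * (\<Prod>i<n * m. \<Prod>k<n * m. sgn (int (pos n (white_vertex n i)) - int (pos n (black_vertex n k)))) = 1"
    by (simp only: prod.distrib[symmetric]) simp
  moreover have "(\<Prod>k<n * m. \<Prod>i<k. -1) * (\<Prod>k<n * m. \<Prod>i<k. -1) = (1::int)"
    by (simp only: prod.distrib[symmetric]) simp
  moreover have "(a * b) * (a * b) = 1" if "b * b = 1" "a * a = 1" for a b :: int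
  proof -
    have "(a * b) * (a * b) = (a * a) * (b * b)" by (simp only: mult_ac)
    then show ?thesis unfolding that by simp
  qed
  ultimately show ?thesis unfolding kas_sign_def by blast
qed

lemma kasteleyn_term:
  assumes n: "2 \<le> n" and p: "p \<in> matching_perms n m"
  shows "of_int (sign p) * (\<Prod>i<n * m. kas_entry n m z i (p i))
    = of_int (kas_sign n m) * (\<Prod>e\<in>perm_cover n m p. seam_weight n z e)"
proof -
  let ?N = "n * m" let ?e = "perm_edge n m p"
  let ?w = "\<lambda>i. pos n (white_vertex n i)" and ?b = "\<lambda>i. pos n (black_vertex n i)"
  interpret cover n m "perm_cover n m p"
    using n perm_cover_in_covers[OF n p] by unfold_locales
  have inj: "inj_on ?e {..<?N}"
    using perm_edge_inject[OF n p p] by (auto intro: inj_onI)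
  have fp: "first_pos n (?e i) = min (?w i) (?b (p i))" "last_pos n (?e i) = max (?w i) (?b (p i))" if "i < ?N" for i
    unfolding first_pos_def last_pos_def perm_edge(2)[OF n p that] by simp_all
  \<comment> \<open>Translates the crossings of edges into crossings of indices: \<open>?e\<close>
    is injective, and the position of its ends are those of white vertex \<open>i\<close> and black
    vertex \<open>p i\<close>.\<close>
  have vs: "vertical_sign (?e i) = (-1) ^ card {k. k < ?N \<and> min (?w i) (?b (p i)) < min (?w k) (?b (p k))
      \<and> min (?w k) (?b (p k)) < max (?w i) (?b (p i)) \<and> max (?w i) (?b (p i)) < max (?w k) (?b (p k))}" (is "_ = _ ^ card ?A")
    if i: "i < ?N" for i
  proof -
    have cr: "crossed (?e i) = ?e ` ?A"
    proof -
      have "f \<in> crossed (?e i) \<longleftrightarrow> f \<in> ?e ` ?A" if f: "f \<in> perm_cover n m p" for f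
      proof -
        obtain k where k: "k < ?N" "f = ?e k" using f unfolding perm_cover_def by auto
        have "f \<in> crossed (?e i) \<longleftrightarrow> k \<in> ?A"
          unfolding crossed_def mem_Collect_eq k(2) fp[OF i] fp[OF k(1)] using f k by simp
        also have "\<dots> \<longleftrightarrow> f \<in> ?e ` ?A"
        proof
          assume "k \<in> ?A"
          then show "f \<in> ?e ` ?A" unfolding k(2) by (rule imageI)
        next
          assume "f \<in> ?e ` ?A"
          then obtain l where l: "f = ?e l" "l \<in> ?A" by (rule imageE)
          have lN: "l < ?N" using l(2) by simp
          have kl: "?e k = ?e l" using k(2) l(1) by simp
          have "k = l" by (rule conjunct1[OF perm_edge_inject[OF n p p k(1) lN kl]])
          show "k \<in> ?A" unfolding \<open>k = l\<close> by (rule l(2))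
        qed
        finally show ?thesis .
      qed
      moreover have "crossed (?e i) \<subseteq> perm_cover n m p" unfolding crossed_def by blast
      moreover have "?e ` ?A \<subseteq> perm_cover n m p" unfolding perm_cover_def by blast
      ultimately show ?thesis by (rule subsets_eqI[rotated 2])
    qed
    have sub: "?A \<subseteq> {..<?N}" unfolding lessThan_def by blast
    have c: "card (crossed (?e i)) = card ?A"
      unfolding cr by (rule card_image[OF inj_on_subset[OF inj sub]])
    have "?e i \<in> perm_cover n m p" unfolding perm_cover_def using i by (intro imageI) (simp only: lessThan_iff)
    from crossing_sign[OF this] show ?thesis unfolding c by (rule sym)
  qed
  have "(\<Prod>i<?N. kas_entry n m z i (p i))
     = (\<Prod>i<?N. of_int (sgn (int (?w i) - int (?b (p i)))) * of_int (vertical_sign (?e i)) * seam_weight n z (?e i))"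
  proof (rule prod.cong[OF refl])
    fix i assume "i \<in> {..<?N}"
    then have "i < ?N" by simp
    show "kas_entry n m z i (p i) = of_int (sgn (int (?w i) - int (?b (p i)))) * of_int (vertical_sign (?e i)) * seam_weight n z (?e i)"
      unfolding kas_entry_def kas_edges_perm[OF n p \<open>i < ?N\<close>] by simp
  qed
  also have "\<dots> = of_int ((\<Prod>i<?N. sgn (int (?w i) - int (?b (p i)))) * (\<Prod>i<?N. vertical_sign (?e i))) * (\<Prod>i<?N. seam_weight n z (?e i))"
    by (simp add: prod.distrib)
  also have "(\<Prod>i<?N. seam_weight n z (?e i)) = (\<Prod>e\<in>perm_cover n m p. seam_weight n z e)"
    unfolding perm_cover_def by (simp add: prod.reindex[OF inj])
  finally have eq: "(\<Prod>i<?N. kas_entry n m z i (p i)) = of_int ((\<Prod>i<?N. sgn (int (?w i) - int (?b (p i)))) * (\<Prod>i<?N. vertical_sign (?e i)))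
     * (\<Prod>e\<in>perm_cover n m p. seam_weight n z e)" .
  have "sign p * (\<Prod>i<?N. sgn (int (?w i) - int (?b (p i)))) * (\<Prod>i<?N. vertical_sign (?e i)) = kas_sign n m"
  proof -
    have "(\<Prod>i<?N. vertical_sign (?e i)) = (\<Prod>i<?N. (-1) ^ card {k. k < ?N \<and> min (?w i) (?b (p i)) < min (?w k) (?b (p k))
      \<and> min (?w k) (?b (p k)) < max (?w i) (?b (p i)) \<and> max (?w i) (?b (p i)) < max (?w k) (?b (p k))})"
      by (rule prod.cong[OF refl]) (use vs in blast)
    then show ?thesis
      unfolding kas_sign_def
      using sign_crossing_invariant[where w = ?w and b = ?b and p = p and N = ?N
          and lo = "\<lambda>i. min (?w i) (?b (p i))" and hi = "\<lambda>i. max (?w i) (?b (p i))",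
          OF pos_white_vertex_mono pos_black_vertex_mono pos_white_vertex_neq_black_vertex matching_permsD(1)[OF p] refl refl]
      by simp
  qed
  then show ?thesis unfolding eq by (simp only: mult.assoc[symmetric] of_int_mult[symmetric])
qed

text \<open>In the Leibniz expansion a permutation that pairs non-adjacent vertices has a zero
  factor. The others are the covers, all with the sign \<open>kas_sign n m\<close>.\<close>

theorem kasteleyn_determinant:
  assumes n: "2 \<le> n"
  shows "Determinant.det (mat (n * m) (n * m) (\<lambda>(i, k). kas_entry n m z i k)) = of_int (kas_sign n m) * dimer_partition n m z"
proof -
  let ?N = "n * m"
  let ?P = "{p. p permutes {..<?N}}"
  have "Determinant.det (mat ?N ?N (\<lambda>(i, k). kas_entry n m z i k))
      = (\<Sum>p\<in>?P. of_int (sign p) * (\<Prod>i<?N. kas_entry n m z i (p i)))"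
    unfolding det_def'[OF mat_carrier] lessThan_atLeast0
  proof (rule sum.cong[OF refl])
    fix p assume "p \<in> {p. p permutes {0..<?N}}"
    then have p: "p permutes {0..<?N}" by simp
    have "mat ?N ?N (\<lambda>(i, k). kas_entry n m z i k) $$ (i, p i) = kas_entry n m z i (p i)" if "i \<in> {0..<?N}" for i
      using that permutes_in_image[OF p, of i] by simp
    then show "signof p * (\<Prod>i = 0..<?N. mat ?N ?N (\<lambda>(i, k). kas_entry n m z i k) $$ (i, p i))
       = of_int (sign p) * (\<Prod>i = 0..<?N. kas_entry n m z i (p i))"
      by (simp add: sign_def)
  qed
  also have "\<dots> = (\<Sum>p\<in>matching_perms n m. of_int (sign p) * (\<Prod>i<?N. kas_entry n m z i (p i)))"
  proof (rule sum.mono_neutral_right)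
    show "finite ?P" by (rule finite_permutations) simp
    show "matching_perms n m \<subseteq> ?P" by (auto simp: matching_perms_def)
    show "\<forall>p\<in>?P - matching_perms n m. of_int (sign p) * (\<Prod>i<?N. kas_entry n m z i (p i)) = 0"
    proof
      fix p assume "p \<in> ?P - matching_perms n m"
      then obtain i where i: "i < ?N" "kas_edges n m i (p i) = {}" by (auto simp: matching_perms_def)
      have "kas_entry n m z i (p i) = 0" unfolding kas_entry_def i(2) by simp
      then have "(\<Prod>i<?N. kas_entry n m z i (p i)) = 0" using i(1) by (intro prod_zero) auto
      then show "of_int (sign p) * (\<Prod>i<?N. kas_entry n m z i (p i)) = 0" by (simp only: mult_zero_right)
    qed
  qed
  also have "\<dots> = (\<Sum>p\<in>matching_perms n m. of_int (kas_sign n m) * (\<Prod>e\<in>perm_cover n m p. seam_weight n z e))"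
    by (rule sum.cong[OF refl]) (rule kasteleyn_term[OF n])
  also have "\<dots> = (\<Sum>M\<in>dimer_covers n m. of_int (kas_sign n m) * (\<Prod>e\<in>M. seam_weight n z e))"
    by (rule sum.reindex_bij_betw[OF perm_cover_bij[OF n]])
  finally show ?thesis by (simp add: dimer_partition_def sum_distrib_left)
qed

section \<open>Diagonalisation\<close>

definition opposite :: "nat \<Rightarrow> vertex \<Rightarrow> edge \<Rightarrow> vertex" where
  "opposite n v e = the_elem (ends n e - {v})"

lemma opposite_eqI:
  assumes "ends n e = {v, u}" "u \<noteq> v"
  shows "opposite n v e = u"
proof -
  have "ends n e - {v} = {u}" using assms by blast
  then show ?thesis by (simp add: opposite_def)
qed

lemma incident_edges:
  assumes "2 \<le> n" "(x, r) \<in> cyl_vertices n m"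
  shows "{e \<in> cyl_edges n m. (x, r) \<in> ends n e}
    = {Hor x r, Hor (if x = 0 then 2 * n - 1 else x - 1) r} \<union> (if r < m then {Ver x r} else {})
      \<union> (if 1 < r then {Ver x (r - 1)} else {})" (is "?A = ?B")
proof -
  have x: "x < 2 * n" and r: "1 \<le> r" "r \<le> m" using assms(2) by (auto simp: cyl_vertices_def)
  have succ: "(y + 1) mod (2 * n) = (if y = 2 * n - 1 then 0 else y + 1)" if "y < 2 * n" for y
    using that assms(1) by auto
  have "e \<in> ?A \<longleftrightarrow> e \<in> ?B" for e
  proof (cases e)
    case (Hor y k)
    show ?thesis
    proof (cases "y < 2 * n")
      case y: True
      have "e \<in> ?A \<longleftrightarrow> k = r \<and> (x = y \<or> x = (if y = 2 * n - 1 then 0 else y + 1))"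
        using y r unfolding Hor mem_Collect_eq Hor_in_cyl_edges ends.simps succ[OF y] by auto
      also have "\<dots> \<longleftrightarrow> k = r \<and> (y = x \<or> y = (if x = 0 then 2 * n - 1 else x - 1))"
        using x y assms(1) by auto
      also have "\<dots> \<longleftrightarrow> e \<in> ?B" unfolding Hor by auto
      finally show ?thesis .
    next
      case False
      then have "e \<notin> ?A" unfolding Hor by simp
      moreover have "e \<notin> ?B" using False x unfolding Hor by auto
      ultimately show ?thesis by blast
    qed
  next
    case (Ver y k)
    have "e \<in> ?A \<longleftrightarrow> y = x \<and> (k = r \<and> r < m \<or> Suc k = r \<and> 1 \<le> k)"
      using x r unfolding Ver mem_Collect_eq Ver_in_cyl_edges ends.simps by auto
    also have "\<dots> \<longleftrightarrow> y = x \<and> (k = r \<and> r < m \<or> k = r - 1 \<and> 1 < r)"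
      using r by auto
    also have "\<dots> \<longleftrightarrow> e \<in> ?B" unfolding Ver by auto
    finally show ?thesis .
  qed
  then show ?thesis by blast
qed

lemma incident_sum:
  fixes F :: "edge \<Rightarrow> complex"
  assumes "2 \<le> n" "(x, r) \<in> cyl_vertices n m"
  shows "(\<Sum>e | e \<in> cyl_edges n m \<and> (x, r) \<in> ends n e. F e)
    = F (Hor x r) + F (Hor (if x = 0 then 2 * n - 1 else x - 1) r)
      + (if r < m then F (Ver x r) else 0) + (if 1 < r then F (Ver x (r - 1)) else 0)"
proof -
  define y where "y = (if x = 0 then 2 * n - 1 else x - 1)"
  have "y \<noteq> x" using assms(1) by (cases x) (auto simp: y_def)
  then show ?thesis
    unfolding incident_edges[OF assms] y_def[symmetric]
    by (subst sum.union_disjoint, simp, simp, force, subst sum.union_disjoint, simp, simp, force) simp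
qed

text \<open>Replaces the index of the black vertex by the edge leading to it, so that applying the
  matrix becomes a sum over the at most four edges at one vertex.\<close>

lemma kas_row_sum:
  fixes F :: "vertex \<Rightarrow> edge \<Rightarrow> complex"
  assumes n: "2 \<le> n" and i: "i < n * m"
  shows "(\<Sum>k<n * m. \<Sum>e\<in>kas_edges n m i k. F (black_vertex n k) e)
    = (\<Sum>e | e \<in> cyl_edges n m \<and> white_vertex n i \<in> ends n e. F (opposite n (white_vertex n i) e) e)"
proof -
  let ?S = "{e. e \<in> cyl_edges n m \<and> white_vertex n i \<in> ends n e}"
  have "\<exists>k<n * m. ends n e = {white_vertex n i, black_vertex n k}" if e: "e \<in> ?S" for e
  proof -
    obtain a b where ab: "ends n e = {a, b}" "white a" "\<not> white b" by (rule ends_white_black)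
    have a: "a = white_vertex n i" using e ab white_white_vertex[of n i] by auto
    have "b \<in> cyl_vertices n m" using ends_subset_vertices[of e n m] e ab by blast
    then obtain k where "k < n * m" "b = black_vertex n k" using vertex_index[of b n m] ab(3) by auto
    then show ?thesis using ab(1) a by blast
  qed
  then obtain \<kappa> where \<kappa>: "\<And>e. e \<in> ?S \<Longrightarrow> \<kappa> e < n * m \<and> ends n e = {white_vertex n i, black_vertex n (\<kappa> e)}" by metis
  have opp: "opposite n (white_vertex n i) e = black_vertex n (\<kappa> e)" if "e \<in> ?S" for e
    using \<kappa>[OF that] white_vertex_neq_black_vertex by (intro opposite_eqI) metis+
  have ke: "kas_edges n m i k = {e \<in> ?S. \<kappa> e = k}" for k
  proof (rule Set.set_eqI)
    fix e
    show "e \<in> kas_edges n m i k \<longleftrightarrow> e \<in> {e \<in> ?S. \<kappa> e = k}"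
    proof
      assume e: "e \<in> kas_edges n m i k"
      then have eS: "e \<in> ?S" and "ends n e = {white_vertex n i, black_vertex n k}" by (auto simp: kas_edges_def)
      then have "{white_vertex n i, black_vertex n (\<kappa> e)} = {white_vertex n i, black_vertex n k}" using \<kappa>[OF eS] by simp
      then have "black_vertex n (\<kappa> e) = black_vertex n k" by (auto simp: doubleton_eq_iff)
      then show "e \<in> {e \<in> ?S. \<kappa> e = k}" using eS black_vertex_inject by blast
    next
      assume "e \<in> {e \<in> ?S. \<kappa> e = k}"
      then show "e \<in> kas_edges n m i k" using \<kappa>[of e] by (auto simp: kas_edges_def)
    qed
  qed
  have "(\<Sum>k<n * m. \<Sum>e\<in>kas_edges n m i k. F (black_vertex n k) e)
     = (\<Sum>k<n * m. \<Sum>e\<in>{e \<in> ?S. \<kappa> e = k}. F (opposite n (white_vertex n i) e) e)"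
    unfolding ke by (intro sum.cong refl) (use opp in auto)
  also have "\<dots> = (\<Sum>e\<in>?S. F (opposite n (white_vertex n i) e) e)"
    by (rule sum.group) (use \<kappa> in auto)
  finally show ?thesis .
qed

lemma kas_col_sum:
  fixes F :: "vertex \<Rightarrow> edge \<Rightarrow> complex"
  assumes n: "2 \<le> n" and k: "k < n * m"
  shows "(\<Sum>i<n * m. \<Sum>e\<in>kas_edges n m i k. F (white_vertex n i) e)
    = (\<Sum>e | e \<in> cyl_edges n m \<and> black_vertex n k \<in> ends n e. F (opposite n (black_vertex n k) e) e)"
proof -
  let ?S = "{e. e \<in> cyl_edges n m \<and> black_vertex n k \<in> ends n e}"
  have "\<exists>i<n * m. ends n e = {white_vertex n i, black_vertex n k}" if e: "e \<in> ?S" for e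
  proof -
    obtain a b where ab: "ends n e = {a, b}" "white a" "\<not> white b" by (rule ends_white_black)
    have b: "b = black_vertex n k" using e ab black_black_vertex[of n k] by auto
    have "a \<in> cyl_vertices n m" using ends_subset_vertices[of e n m] e ab by blast
    then obtain i where "i < n * m" "a = white_vertex n i" using vertex_index[of a n m] ab(2) by auto
    then show ?thesis using ab(1) b by blast
  qed
  then obtain \<iota> where \<iota>: "\<And>e. e \<in> ?S \<Longrightarrow> \<iota> e < n * m \<and> ends n e = {white_vertex n (\<iota> e), black_vertex n k}" by metis
  have opp: "opposite n (black_vertex n k) e = white_vertex n (\<iota> e)" if "e \<in> ?S" for e
    using \<iota>[OF that] white_vertex_neq_black_vertex by (intro opposite_eqI) (auto simp: insert_commute)
  have ke: "kas_edges n m i k = {e \<in> ?S. \<iota> e = i}" for i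
  proof (rule Set.set_eqI)
    fix e
    show "e \<in> kas_edges n m i k \<longleftrightarrow> e \<in> {e \<in> ?S. \<iota> e = i}"
    proof
      assume e: "e \<in> kas_edges n m i k"
      then have eS: "e \<in> ?S" and "ends n e = {white_vertex n i, black_vertex n k}" by (auto simp: kas_edges_def)
      then have "{white_vertex n (\<iota> e), black_vertex n k} = {white_vertex n i, black_vertex n k}" using \<iota>[OF eS] by simp
      then have "white_vertex n (\<iota> e) = white_vertex n i" by (auto simp: doubleton_eq_iff)
      then show "e \<in> {e \<in> ?S. \<iota> e = i}" using eS white_vertex_inject by blast
    next
      assume "e \<in> {e \<in> ?S. \<iota> e = i}"
      then show "e \<in> kas_edges n m i k" using \<iota>[of e] by (auto simp: kas_edges_def)
    qed
  qed
  have "(\<Sum>i<n * m. \<Sum>e\<in>kas_edges n m i k. F (white_vertex n i) e)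
     = (\<Sum>i<n * m. \<Sum>e\<in>{e \<in> ?S. \<iota> e = i}. F (opposite n (black_vertex n k) e) e)"
    unfolding ke by (intro sum.cong refl) (use opp in auto)
  also have "\<dots> = (\<Sum>e\<in>?S. F (opposite n (black_vertex n k) e) e)"
    by (rule sum.group) (use \<iota> in auto)
  finally show ?thesis .
qed

text \<open>Since the seam factor is compensated by t^(2 n) = -z, a plane wave sees no seam.\<close>

lemma plane_wave_sum:
  fixes t z :: complex and g :: "nat \<Rightarrow> complex"
  assumes n: "2 \<le> n" and v: "(x, r) \<in> cyl_vertices n m" and t: "t ^ (2 * n) = - z" and z: "z \<noteq> 0"
    and g: "g 0 = 0" "g (m + 1) = 0"
  shows "(\<Sum>e | e \<in> cyl_edges n m \<and> (x, r) \<in> ends n e.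
        of_int (sgn (int (pos n (x, r)) - int (pos n (opposite n (x, r) e))) * vertical_sign e)
        * (z powi (if white (x, r) then seam_flow n e else - seam_flow n e))
        * (t ^ fst (opposite n (x, r) e) * g (snd (opposite n (x, r) e))))
    = t ^ x * ((1 / t - t) * g r + (-1) ^ x * (g (r + 1) - g (r - 1)))"
proof -
  have x: "x < 2 * n" and r: "1 \<le> r" "r \<le> m" using v by (auto simp: cyl_vertices_def)
  have t0: "t \<noteq> 0" using t z n by (auto simp: power_0_left)
  define F where "F e = of_int (sgn (int (pos n (x, r)) - int (pos n (opposite n (x, r) e))) * vertical_sign e)
        * (z powi (if white (x, r) then seam_flow n e else - seam_flow n e))
        * (t ^ fst (opposite n (x, r) e) * g (snd (opposite n (x, r) e)))" for e
  have right: "F (Hor x r) = - (t ^ x * t * g r)"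
  proof (cases "x = 2 * n - 1")
    case True
    have sx: "Suc x = 2 * n" using True n by simp
    have opp: "opposite n (x, r) (Hor x r) = (0, r)" using n by (intro opposite_eqI) (auto simp: sx True)
    have "odd x" using sx by (metis even_Suc dvd_triv_left)
    then have fl: "(if white (x, r) then seam_flow n (Hor x r) else - seam_flow n (Hor x r)) = 1"
      using True by (simp add: white_def)
    have sg: "sgn (int (pos n (x, r)) - int (pos n (0, r))) = 1" using sx n by (simp add: pos_def)
    have "t ^ x * t = - z" using t sx by (metis power_Suc2)
    then show ?thesis unfolding F_def opp fl sg by simp
  next
    case False
    then have sx: "Suc x < 2 * n" using x by simp
    have opp: "opposite n (x, r) (Hor x r) = (Suc x, r)" using sx by (intro opposite_eqI) auto
    have fl: "(if white (x, r) then seam_flow n (Hor x r) else - seam_flow n (Hor x r)) = 0" using False by simp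
    have sg: "sgn (int (pos n (x, r)) - int (pos n (Suc x, r))) = -1" by (simp add: pos_def)
    show ?thesis unfolding F_def opp fl sg by simp
  qed
  have left: "F (Hor (if x = 0 then 2 * n - 1 else x - 1) r) = t ^ x * (1 / t) * g r"
  proof (cases "x = 0")
    case True
    have opp: "opposite n (x, r) (Hor (2 * n - 1) r) = (2 * n - 1, r)"
      using n by (intro opposite_eqI) (auto simp: True)
    have fl: "(if white (x, r) then seam_flow n (Hor (2 * n - 1) r) else - seam_flow n (Hor (2 * n - 1) r)) = - 1"
      by (simp add: white_def True)
    have sg: "sgn (int (pos n (x, r)) - int (pos n (2 * n - 1, r))) = -1" using n by (simp add: pos_def True)
    have "t * t ^ (2 * n - 1) = - z" using t n by (simp flip: power_Suc)
    then have tn: "t ^ (2 * n - 1) = - z / t" using t0 by (simp add: field_simps)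
    have e: "(if x = 0 then 2 * n - 1 else x - 1) = 2 * n - 1" by (simp add: True)
    show ?thesis unfolding e F_def opp fl sg fst_conv snd_conv tn using z by (simp add: True power_int_minus)
  next
    case False
    then obtain y where y: "x = Suc y" by (cases x) auto
    have opp: "opposite n (x, r) (Hor y r) = (y, r)" using x y by (intro opposite_eqI) auto
    have fl: "(if white (x, r) then seam_flow n (Hor y r) else - seam_flow n (Hor y r)) = 0" using x y by simp
    have sg: "sgn (int (pos n (x, r)) - int (pos n (y, r))) = 1" by (simp add: pos_def y)
    have e: "(if x = 0 then 2 * n - 1 else x - 1) = y" by (simp add: y)
    show ?thesis unfolding e F_def opp fl sg fst_conv snd_conv using t0 by (simp add: y)
  qed
  \<comment> \<open>In the top row the zero of \<open>g\<close> at m + 1 stands in for the missing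
    edge; in the bottom row the zero at 0 does so.\<close>
  have up: "(if r < m then F (Ver x r) else 0) = t ^ x * (-1) ^ x * g (r + 1)"
  proof (cases "r < m")
    case True
    have opp: "opposite n (x, r) (Ver x r) = (x, r + 1)" by (intro opposite_eqI) auto
    have sg: "sgn (int (pos n (x, r)) - int (pos n (x, r + 1))) = -1" using n by (simp add: pos_def)
    show ?thesis using True unfolding F_def opp sg by simp
  next
    case False
    then have "r = m" using r by simp
    then show ?thesis using g by simp
  qed
  have down: "(if 1 < r then F (Ver x (r - 1)) else 0) = - (t ^ x * (-1) ^ x * g (r - 1))"
  proof (cases "1 < r")
    case True
    have rs: "Suc (r - 1) = r" using True by simp
    have opp: "opposite n (x, r) (Ver x (r - 1)) = (x, r - 1)" using rs by (intro opposite_eqI) auto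
    have "pos n (x, r - 1) < pos n (x, r)" using True n by (simp add: pos_def)
    then have sg: "sgn (int (pos n (x, r)) - int (pos n (x, r - 1))) = 1" by simp
    show ?thesis using True unfolding F_def opp sg by simp
  next
    case False
    then have "r = 1" using r by simp
    then show ?thesis using g by simp
  qed
  show ?thesis
    unfolding F_def[symmetric] incident_sum[OF n v] right left up down by (simp add: algebra_simps)
qed

lemma kas_apply:
  fixes g :: "nat \<Rightarrow> complex"
  assumes n: "2 \<le> n" and i: "i < n * m" and t: "t ^ (2 * n) = - z" and z: "z \<noteq> 0"
    and g: "g 0 = 0" "g (m + 1) = 0" and xr: "white_vertex n i = (x, r)"
  shows "(\<Sum>k<n * m. kas_entry n m z i k * (t ^ fst (black_vertex n k) * g (snd (black_vertex n k))))
    = t ^ x * ((1 / t - t) * g r + (-1) ^ x * (g (r + 1) - g (r - 1)))"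
proof -
  have n0: "0 < n" using n by simp
  have v: "(x, r) \<in> cyl_vertices n m" using white_vertex_in_vertices[OF n0 i] xr by simp
  have w: "white (x, r)" using white_white_vertex[of n i] xr by simp
  define F where "F u e = of_int (sgn (int (pos n (white_vertex n i)) - int (pos n u)) * vertical_sign e) * seam_weight n z e * (t ^ fst u * g (snd u))" for u e
  have "(\<Sum>k<n * m. kas_entry n m z i k * (t ^ fst (black_vertex n k) * g (snd (black_vertex n k))))
     = (\<Sum>k<n * m. \<Sum>e\<in>kas_edges n m i k. F (black_vertex n k) e)"
    by (simp only: kas_entry_def sum_distrib_right F_def)
  also have "\<dots> = (\<Sum>e | e \<in> cyl_edges n m \<and> white_vertex n i \<in> ends n e. F (opposite n (white_vertex n i) e) e)"
    by (rule kas_row_sum[OF n i])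
  also have "\<dots> = t ^ x * ((1 / t - t) * g r + (-1) ^ x * (g (r + 1) - g (r - 1)))"
    using plane_wave_sum[where g = g, OF n v t z g] unfolding F_def xr seam_weight_def by (simp only: w if_True)
  finally show ?thesis .
qed

text \<open>Seen from the black end, the difference of positions changes sign, which gives the
  overall minus. The flow is reversed as well, and this is compensated by \<open>inverse z\<close>,
  so the same wave sum appears.\<close>

lemma kas_transpose_apply:
  fixes g :: "nat \<Rightarrow> complex"
  assumes n: "2 \<le> n" and k: "k < n * m" and t: "t ^ (2 * n) = - z" and z: "z \<noteq> 0"
    and g: "g 0 = 0" "g (m + 1) = 0" and xr: "black_vertex n k = (x, r)"
  shows "(\<Sum>i<n * m. kas_entry n m (inverse z) i k * (t ^ fst (white_vertex n i) * g (snd (white_vertex n i))))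
    = - (t ^ x * ((1 / t - t) * g r + (-1) ^ x * (g (r + 1) - g (r - 1))))"
proof -
  have n0: "0 < n" using n by simp
  have v: "(x, r) \<in> cyl_vertices n m" using black_vertex_in_vertices[OF n0 k] xr by simp
  have w: "\<not> white (x, r)" using black_black_vertex[of n k] xr by simp
  have sg: "sgn (a - b) = - sgn (b - a)" for a b :: int by (simp add: sgn_if)
  have iz: "seam_weight n (inverse z) e = z powi (- seam_flow n e)" for e
    by (simp add: seam_weight_def power_int_inverse power_int_minus)
  define F where "F u e = of_int (sgn (int (pos n u) - int (pos n (black_vertex n k))) * vertical_sign e) * seam_weight n (inverse z) e * (t ^ fst u * g (snd u))" for u e
  have "(\<Sum>i<n * m. kas_entry n m (inverse z) i k * (t ^ fst (white_vertex n i) * g (snd (white_vertex n i))))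
     = (\<Sum>i<n * m. \<Sum>e\<in>kas_edges n m i k. F (white_vertex n i) e)"
    by (simp only: kas_entry_def sum_distrib_right F_def)
  also have "\<dots> = (\<Sum>e | e \<in> cyl_edges n m \<and> black_vertex n k \<in> ends n e. F (opposite n (black_vertex n k) e) e)"
    by (rule kas_col_sum[OF n k])
  also have "\<dots> = - (\<Sum>e | e \<in> cyl_edges n m \<and> (x, r) \<in> ends n e.
        of_int (sgn (int (pos n (x, r)) - int (pos n (opposite n (x, r) e))) * vertical_sign e)
        * (z powi (if white (x, r) then seam_flow n e else - seam_flow n e))
        * (t ^ fst (opposite n (x, r) e) * g (snd (opposite n (x, r) e))))"
    unfolding F_def xr iz sum_negf[symmetric]
  proof (rule sum.cong[OF refl])
    fix e
    show "of_int (sgn (int (pos n (opposite n (x, r) e)) - int (pos n (x, r))) * vertical_sign e) * z powi - seam_flow n e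
        * (t ^ fst (opposite n (x, r) e) * g (snd (opposite n (x, r) e)))
      = - (of_int (sgn (int (pos n (x, r)) - int (pos n (opposite n (x, r) e))) * vertical_sign e)
        * (z powi (if white (x, r) then seam_flow n e else - seam_flow n e))
        * (t ^ fst (opposite n (x, r) e) * g (snd (opposite n (x, r) e))))"
      unfolding sg[of "int (pos n (opposite n (x, r) e))"] using w by simp
  qed
  also have "\<dots> = - (t ^ x * ((1 / t - t) * g r + (-1) ^ x * (g (r + 1) - g (r - 1))))"
    unfolding plane_wave_sum[where g = g, OF n v t z g] ..
  finally show ?thesis .
qed

section \<open>Roots and sines: orthogonality and products\<close>

lemma sum_blocks: "(\<Sum>i<n * m. f i) = (\<Sum>j<m. \<Sum>p<n. f (j * n + p))"
  for f :: "nat \<Rightarrow> complex"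
proof -
  have 1: "(\<Sum>i<n * m. f i) = (\<Sum>j<m. sum f {j * n..<j * n + n})"
    by (simp add: sum.nat_group mult.commute)
  have 2: "sum f {j * n..<j * n + n} = (\<Sum>p<n. f (j * n + p))" for j
    using sum.shift_bounds_nat_ivl[of f 0 "j * n" n] by (simp add: lessThan_atLeast0 add.commute)
  show ?thesis unfolding 1 2 ..
qed

lemma prod_blocks: "(\<Prod>i<n * m. f i) = (\<Prod>j<m. \<Prod>p<n. f (j * n + p))"
  for f :: "nat \<Rightarrow> complex"
proof -
  have 1: "(\<Prod>i<n * m. f i) = (\<Prod>j<m. prod f {j * n..<j * n + n})"
    by (simp add: prod.nat_group mult.commute)
  have 2: "prod f {j * n..<j * n + n} = (\<Prod>p<n. f (j * n + p))" for j
    using prod.shift_bounds_nat_ivl[of f 0 "j * n" n] by (simp add: lessThan_atLeast0 add.commute)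
  show ?thesis unfolding 1 2 ..
qed

text \<open>For a < n these are half of the 2 n-th roots of -z, one from each pair t, -t. The white
  vertices of a row have columns of one parity, so t and -t differ there by a sign only, and
  \<open>n\<close> roots suffice for \<open>n\<close> white vertices.\<close>

definition wave_root :: "nat \<Rightarrow> complex \<Rightarrow> nat \<Rightarrow> complex" where
  "wave_root n z a = exp (Ln (- z) / (2 * of_nat n)) * cis (pi * real a / real n)"

lemma wave_root_power:
  assumes "0 < n" "z \<noteq> 0"
  shows "wave_root n z a ^ (2 * n) = - z"
proof -
  have "exp (Ln (- z) / (2 * of_nat n)) ^ (2 * n) = exp (of_nat (2 * n) * (Ln (- z) / (2 * of_nat n)))"
    by (rule exp_of_nat_mult[symmetric])
  also have "of_nat (2 * n) * (Ln (- z) / (2 * of_nat n)) = Ln (- z)" using assms by (simp add: field_simps)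
  also have "exp (Ln (- z)) = - z" using assms by simp
  finally have 1: "exp (Ln (- z) / (2 * of_nat n)) ^ (2 * n) = - z" .
  have "cis (pi * real a / real n) ^ (2 * n) = cis (real (2 * n) * (pi * real a / real n))" by (rule Complex.DeMoivre)
  also have "real (2 * n) * (pi * real a / real n) = 2 * pi * real a" using assms by simp
  also have "cis (2 * pi * real a) = 1" by (rule cis_multiple_2pi) simp
  finally show ?thesis unfolding wave_root_def power_mult_distrib 1 by simp
qed

lemma wave_root_nonzero: "wave_root n z a \<noteq> 0"
  by (simp add: wave_root_def)

lemma cis_ratio_eq_1:
  assumes "a < n" "b < n" "cis (2 * pi * (real a - real b) / real n) = 1"
  shows "a = b"
proof -
  have n: "0 < n" using assms by simp
  have "cos (2 * pi * (real a - real b) / real n) = 1"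
    using arg_cong[OF assms(3), of Re] by simp
  then obtain k :: int where "2 * pi * (real a - real b) / real n = of_int k * 2 * pi"
    using cos_one_2pi_int by blast
  then have "2 * pi * (real a - real b) = 2 * pi * (real n * of_int k)" using n by (simp add: field_simps)
  then have "real a - real b = real n * of_int k"
    using mult_left_cancel[of "2 * pi" "real a - real b" "real n * of_int k"] pi_gt_zero by fastforce
  then have "of_int (int a - int b) = (of_int (int n * k) :: real)" by simp
  then have k: "int a - int b = int n * k" by (simp only: of_int_eq_iff)
  then have "int n * k < int n * 1" "int n * (-1) < int n * k" using assms(1,2) by linarith+
  then have "k < 1" "-1 < k" using n by (simp_all only: mult_less_cancel_left_pos of_nat_0_less_iff)
  then have "k = 0" by linarith
  then show ?thesis using k by simp
qed

lemma wave_root_ratio: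
  "wave_root n z a / wave_root n z b = cis (pi * (real a - real b) / real n)"
proof -
  have "wave_root n z a / wave_root n z b = cis (pi * real a / real n) / cis (pi * real b / real n)"
    by (simp add: wave_root_def)
  then show ?thesis by (simp add: cis_divide right_diff_distrib diff_divide_distrib)
qed

lemma wave_root_ratio_square: "(wave_root n z a / wave_root n z b)\<^sup>2 = cis (2 * pi * (real a - real b) / real n)"
  unfolding wave_root_ratio power2_eq_square cis_mult by (simp add: field_simps)

lemma sum_root_ratio:
  assumes "a < n" "b < n"
  shows "(\<Sum>p<n. ((wave_root n z a / wave_root n z b)\<^sup>2) ^ p) = (if a = b then of_nat n else 0)"
proof (cases "a = b")
  case True
  then show ?thesis by (simp add: wave_root_nonzero)
next
  case False
  let ?r = "(wave_root n z a / wave_root n z b)\<^sup>2"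
  have n: "0 < n" using assms by simp
  have "?r \<noteq> 1" using cis_ratio_eq_1[OF assms] False by (auto simp: wave_root_ratio_square)
  moreover have "?r ^ n = 1"
  proof -
    have "?r ^ n = cis (real n * (2 * pi * (real a - real b) / real n))" unfolding wave_root_ratio_square by (rule Complex.DeMoivre)
    also have "real n * (2 * pi * (real a - real b) / real n) = 2 * pi * of_int (int a - int b)" using n by simp
    also have "cis (2 * pi * of_int (int a - int b)) = 1" by (rule cis_multiple_2pi) simp
    finally show ?thesis .
  qed
  ultimately show ?thesis using False by (simp add: sum_gp_strict)
qed

text \<open>The squares of the roots are the \<open>n\<close> distinct zeros of w^n + z, and a monic
  polynomial of degree \<open>n\<close> is determined by them.\<close>

lemma prod_minus_roots:
  assumes n: "0 < n" and z: "z \<noteq> 0"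
  shows "(\<Prod>a<n. w - (wave_root n z a)\<^sup>2) = w ^ n + z"
proof -
  let ?p = "\<Prod>a<n. [:- (wave_root n z a)\<^sup>2, 1:]" and ?q = "monom 1 n + [:z:]"
  have inj: "inj_on (\<lambda>a. (wave_root n z a)\<^sup>2) {..<n}"
  proof (rule inj_onI)
    fix a b assume ab: "a \<in> {..<n}" "b \<in> {..<n}" "(wave_root n z a)\<^sup>2 = (wave_root n z b)\<^sup>2"
    have "(wave_root n z a / wave_root n z b)\<^sup>2 = 1" using ab(3) wave_root_nonzero[of n z b] by (simp add: power_divide)
    then show "a = b" using cis_ratio_eq_1[of a n b] ab(1,2) by (simp add: wave_root_ratio_square)
  qed
  have deg: "degree ?p = n" by (simp add: degree_prod_eq_sum_degree)
  have degq: "degree ?q = n"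
  proof -
    have "degree [:z:] < degree (monom (1::complex) n)" using n by (simp add: degree_monom_eq)
    then have "degree (monom 1 n + [:z:]) = degree (monom (1::complex) n)" by (rule degree_add_eq_left)
    then show ?thesis by (simp add: degree_monom_eq)
  qed
  have "?p = ?q"
  proof (rule poly_eqI_degree_lead_coeff[where A = "(\<lambda>a. (wave_root n z a)\<^sup>2) ` {..<n}" and n = n])
    have "lead_coeff ?p = 1" by (simp add: lead_coeff_prod)
    then show "coeff ?p n = coeff ?q n" using deg n by (simp add: coeff_pCons split: nat.splits)
    show "n \<le> card ((\<lambda>a. (wave_root n z a)\<^sup>2) ` {..<n})" using card_image[OF inj] by simp
    fix s assume "s \<in> (\<lambda>a. (wave_root n z a)\<^sup>2) ` {..<n}"
    then obtain a where a: "a < n" "s = (wave_root n z a)\<^sup>2" by auto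
    have "s ^ n = - z" using wave_root_power[OF n z, of a] by (simp add: a power_mult)
    moreover have "poly ?p s = 0" using a by (auto simp: poly_prod)
    ultimately show "poly ?p s = poly ?q s" by (simp add: poly_monom)
  qed (use deg degq in simp_all)
  then have "poly ?p w = poly ?q w" by simp
  then show ?thesis by (simp add: poly_prod poly_monom)
qed

text \<open>Each factor equals -(y - s) (1/y - s) / s for the square s of a root. For odd
  \<open>n\<close> the minus signs multiply to -1 and the squares to -z, so the two signs cancel and
  (y^n + z) (1/y^n + z) / z remains.\<close>

lemma prod_resolvent:
  fixes y z :: complex
  assumes n: "odd n" and z: "z \<noteq> 0" and y: "y \<noteq> 0"
  shows "(\<Prod>a<n. y + 1 / y - (wave_root n z a)\<^sup>2 - 1 / (wave_root n z a)\<^sup>2) = z + 1 / z + y ^ n + 1 / y ^ n"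
proof -
  have n0: "0 < n" using n odd_pos by blast
  note P = prod_minus_roots[OF n0 z]
  have odd_neg: "(\<Prod>a<n. - f a) = - (\<Prod>a<n. f a)" for f :: "nat \<Rightarrow> complex"
  proof -
    have "(\<Prod>a<n. - f a) = (\<Prod>a<n. (-1) * f a)" by simp
    also have "\<dots> = (\<Prod>a<n. -1) * (\<Prod>a<n. f a)" by (rule prod.distrib)
    finally show ?thesis using n by simp
  qed
  have r0: "(wave_root n z a)\<^sup>2 \<noteq> 0" for a using wave_root_nonzero by simp
  have "y + 1 / y - s - 1 / s = (y - s) * (- (1 / y - s)) / s" if "s \<noteq> 0" for s :: complex
    using that y by (simp add: field_simps)
  then have "(\<Prod>a<n. y + 1 / y - (wave_root n z a)\<^sup>2 - 1 / (wave_root n z a)\<^sup>2)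
     = (\<Prod>a<n. (y - (wave_root n z a)\<^sup>2) * (- (1 / y - (wave_root n z a)\<^sup>2)) / (wave_root n z a)\<^sup>2)"
    using r0 by (intro prod.cong refl) blast
  also have "\<dots> = (\<Prod>a<n. y - (wave_root n z a)\<^sup>2) * (\<Prod>a<n. - (1 / y - (wave_root n z a)\<^sup>2)) / (\<Prod>a<n. (wave_root n z a)\<^sup>2)"
    by (simp add: prod.distrib prod_dividef)
  also have "(\<Prod>a<n. (wave_root n z a)\<^sup>2) = - z"
  proof -
    have "- (\<Prod>a<n. (wave_root n z a)\<^sup>2) = (\<Prod>a<n. 0 - (wave_root n z a)\<^sup>2)"
      unfolding diff_0 by (rule odd_neg[symmetric])
    also have "\<dots> = z" unfolding P using n0 by simp
    finally show ?thesis by (metis minus_minus)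
  qed
  also have "(\<Prod>a<n. y - (wave_root n z a)\<^sup>2) * (\<Prod>a<n. - (1 / y - (wave_root n z a)\<^sup>2)) / (- z)
      = (y ^ n + z) * ((1 / y) ^ n + z) / z"
    unfolding odd_neg P by (simp only: mult_minus_right minus_divide_divide)
  also have "\<dots> = z + 1 / z + y ^ n + 1 / y ^ n"
  proof -
    have "y ^ n \<noteq> 0" using y by simp
    then show ?thesis using z by (simp add: power_divide field_simps)
  qed
  finally show ?thesis .
qed

definition angle :: "nat \<Rightarrow> nat \<Rightarrow> real" where
  "angle m q = pi * real (q + 1) / real (m + 1)"

lemma angle_bounds: "q < m \<Longrightarrow> 0 < angle m q \<and> angle m q < pi"
proof -
  assume "q < m"
  then have "real (q + 1) / real (m + 1) < 1" by simp
  then have "pi * (real (q + 1) / real (m + 1)) < pi * 1" by (intro mult_strict_left_mono) simp_all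
  then show ?thesis by (simp add: angle_def)
qed

lemma sin_angle_end: "sin (real (m + 1) * angle m q) = 0"
proof -
  have "real (m + 1) * angle m q = real (q + 1) * pi" by (simp add: angle_def)
  then show ?thesis by (simp only: sin_npi)
qed

lemma sin_add_sub: "sin (real (r + 2) * t) + sin (real r * t) = 2 * cos t * sin (real (r + 1) * t)"
proof -
  have "sin (real (r + 1) * t + t) + sin (real (r + 1) * t - t) = 2 * cos t * sin (real (r + 1) * t)"
    by (simp add: sin_add sin_diff)
  moreover have "real (r + 1) * t + t = real (r + 2) * t" "real (r + 1) * t - t = real r * t"
    by (simp_all add: algebra_simps)
  ultimately show ?thesis by (simp only:)
qed

text \<open>For distinct modes, both sequences solve the same three-term recurrence with different
  factors 2 cos. The difference of these factors times the sum telescopes to a discrete Wronskian,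
  which vanishes at 0 and at m + 1; the cosines differ because cos is injective on [0, pi].\<close>

lemma sine_orthogonal:
  assumes q: "q < m" "q' < m"
  shows "(\<Sum>j<m. sin (real (j + 1) * angle m q) * sin (real (j + 1) * angle m q')) = 0 \<longleftrightarrow> q \<noteq> q'"
proof (cases "q = q'")
  case True
  have "0 < sin (angle m q)" using angle_bounds[OF q(1)] by (intro sin_gt_zero) auto
  then have "0 < sin (real (0 + 1) * angle m q) * sin (real (0 + 1) * angle m q)" by simp
  also have "\<dots> \<le> (\<Sum>j<m. sin (real (j + 1) * angle m q) * sin (real (j + 1) * angle m q))"
    using q by (intro member_le_sum) auto
  finally show ?thesis using True by simp
next
  case False
  define S where "S r = sin (real r * angle m q)" for r
  define S' where "S' r = sin (real r * angle m q')" for r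
  have rec: "S (j + 2) + S j = 2 * cos (angle m q) * S (j + 1)" "S' (j + 2) + S' j = 2 * cos (angle m q') * S' (j + 1)" for j
    unfolding S_def S'_def by (rule sin_add_sub)+
  have "(2 * cos (angle m q) - 2 * cos (angle m q')) * (S (j + 1) * S' (j + 1))
      = (S (Suc j + 1) * S' (Suc j) - S (Suc j) * S' (Suc j + 1)) - (S (j + 1) * S' j - S j * S' (j + 1))" for j
  proof -
    have "(2 * cos (angle m q) - 2 * cos (angle m q')) * (S (j + 1) * S' (j + 1))
       = (2 * cos (angle m q) * S (j + 1)) * S' (j + 1) - S (j + 1) * (2 * cos (angle m q') * S' (j + 1))"
      by (simp add: algebra_simps)
    also have "\<dots> = (S (j + 2) + S j) * S' (j + 1) - S (j + 1) * (S' (j + 2) + S' j)" unfolding rec ..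
    finally show ?thesis by (simp add: algebra_simps)
  qed
  then have "(2 * cos (angle m q) - 2 * cos (angle m q')) * (\<Sum>j<m. S (j + 1) * S' (j + 1))
     = (\<Sum>j<m. (S (Suc j + 1) * S' (Suc j) - S (Suc j) * S' (Suc j + 1)) - (S (j + 1) * S' j - S j * S' (j + 1)))"
    by (simp only: sum_distrib_left)
  also have "\<dots> = (S (m + 1) * S' m - S m * S' (m + 1)) - (S (0 + 1) * S' 0 - S 0 * S' (0 + 1))"
    by (rule sum_lessThan_telescope)
  also have "\<dots> = 0"
    using sin_angle_end[of m q] sin_angle_end[of m q'] by (simp add: S_def S'_def)
  finally have "cos (angle m q) = cos (angle m q') \<or> (\<Sum>j<m. S (j + 1) * S' (j + 1)) = 0" by simp
  moreover have "cos (angle m q) \<noteq> cos (angle m q')"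
  proof
    assume "cos (angle m q) = cos (angle m q')"
    then have "angle m q = angle m q'"
      by (rule cos_inj_pi[rotated 4]) (use angle_bounds[OF q(1)] angle_bounds[OF q(2)] in simp_all)
    then show False using False by (simp add: angle_def)
  qed
  ultimately show ?thesis using False by (simp add: S_def S'_def)
qed

text \<open>The signs of the vertical edges produce the difference of the rows r + 1 and r - 1,
  whereas sines behave well under their sum; the power of \<i> converts one into the other.\<close>

definition vertical_wave :: "nat \<Rightarrow> nat \<Rightarrow> nat \<Rightarrow> complex" where
  "vertical_wave m q r = \<i> ^ r * of_real (sin (real r * angle m q))"

lemma vertical_wave_ends: "vertical_wave m q 0 = 0" "vertical_wave m q (m + 1) = 0"
  using sin_angle_end[of m q] by (simp_all add: vertical_wave_def del: of_nat_add)

lemma vertical_wave_eigen: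
  assumes "1 \<le> r"
  shows "vertical_wave m q (r + 1) - vertical_wave m q (r - 1) = 2 * \<i> * of_real (cos (angle m q)) * vertical_wave m q r"
proof -
  obtain j where j: "r = j + 1" using assms by (metis add.commute le_Suc_ex)
  have "vertical_wave m q (j + 2) - vertical_wave m q j
      = - (\<i> ^ j * of_real (sin (real (j + 2) * angle m q) + sin (real j * angle m q)))"
    by (simp add: vertical_wave_def power2_eq_square algebra_simps del: of_nat_add)
  also have "\<dots> = 2 * \<i> * of_real (cos (angle m q)) * vertical_wave m q (j + 1)"
    unfolding sin_add_sub by (simp add: vertical_wave_def algebra_simps del: of_nat_add)
  finally show ?thesis by (simp add: j)
qed


section \<open>Spectral decomposition of the product matrix\<close>

lemma mat_times_mat:
  fixes f g :: "nat \<Rightarrow> nat \<Rightarrow> complex"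
  shows "mat N N (\<lambda>(i, j). f i j) * mat N N (\<lambda>(i, j). g i j) = mat N N (\<lambda>(i, j). \<Sum>k<N. f i k * g k j)"
  by (rule eq_matI) (simp_all add: scalar_prod_def lessThan_atLeast0)

lemma det_diagonal:
  fixes f :: "nat \<Rightarrow> complex"
  shows "Determinant.det (mat N N (\<lambda>(i, j). if i = j then f i else 0)) = (\<Prod>i<N. f i)"
proof -
  have "Determinant.det (mat N N (\<lambda>(i, j). if i = j then f i else 0))
      = prod_list (diag_mat (mat N N (\<lambda>(i, j). if i = j then f i else 0)))"
    by (rule det_upper_triangular[of _ N]) (auto simp: upper_triangular_def)
  also have "\<dots> = (\<Prod>i<N. f i)"
    by (simp add: prod_list_diag_prod lessThan_atLeast0)
  finally show ?thesis .
qed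

definition eigenvector :: "nat \<Rightarrow> nat \<Rightarrow> complex \<Rightarrow> nat \<Rightarrow> nat \<Rightarrow> complex" where
  "eigenvector n m z i l = wave_root n z (l mod n) ^ fst (white_vertex n i) * vertical_wave m (l div n) (snd (white_vertex n i))"

text \<open>This is 4 c^2 - d^2 for the cosine c of the vertical mode and d = 1/t - t, where t is
  the root of the horizontal mode.\<close>

definition eigenvalue :: "nat \<Rightarrow> nat \<Rightarrow> complex \<Rightarrow> nat \<Rightarrow> complex" where
  "eigenvalue n m z l = 2 + 4 * of_real ((cos (angle m (l div n)))\<^sup>2) - (wave_root n z (l mod n))\<^sup>2 - 1 / (wave_root n z (l mod n))\<^sup>2"

text \<open>On vertices of one colour the column sign of the vertical edges becomes a function of
  the row, so that waves in product form stay in product form.\<close>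

lemma white_parity: "white_vertex n i = (x, r) \<Longrightarrow> (-1) ^ x = - ((-1) ^ r :: complex)"
  using white_white_vertex[of n i] by (cases "even r") (auto simp: white_def)

lemma black_parity: "black_vertex n i = (x, r) \<Longrightarrow> (-1) ^ x = ((-1) ^ r :: complex)"
  using black_black_vertex[of n i] by (cases "even r") (auto simp: white_def)

text \<open>The transpose at 1/z turns the white wave into a black one with the same
  \<open>t\<close>, whose vertical part carries a term alternating with the row. On the way back the
  alternation changes sign between neighbouring rows, so the mixed terms in \<open>c\<close> and
  \<open>d\<close> cancel.\<close>

lemma kas_eigenvector:
  assumes n: "2 \<le> n" and z: "z \<noteq> 0" and i: "i < n * m"
  shows "(\<Sum>k<n * m. kas_entry n m z i k * (\<Sum>j<n * m. kas_entry n m (inverse z) j k * eigenvector n m z j l))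
    = eigenvector n m z i l * eigenvalue n m z l"
proof -
  define t where "t = wave_root n z (l mod n)"
  define h where "h = vertical_wave m (l div n)"
  define c where "c = complex_of_real (cos (angle m (l div n)))"
  define d where "d = 1 / t - t"
  \<comment> \<open>The vertical part of the intermediate black wave. It inherits the boundary zeros
    of \<open>h\<close>, so \<open>kas_apply\<close> can be used on it.\<close>
  define g where "g r = - ((d + (-1) ^ r * (2 * \<i> * c)) * h r)" for r
  have n0: "0 < n" using n by simp
  have t: "t ^ (2 * n) = - z" unfolding t_def by (rule wave_root_power[OF n0 z])
  have t0: "t \<noteq> 0" unfolding t_def by (rule wave_root_nonzero)
  have h: "h 0 = 0" "h (m + 1) = 0" unfolding h_def by (rule vertical_wave_ends)+
  have eig: "h (r + 1) - h (r - 1) = 2 * \<i> * c * h r" if "1 \<le> r" for r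
    unfolding h_def c_def by (rule vertical_wave_eigen[OF that])
  have g0: "g 0 = 0" "g (m + 1) = 0" unfolding g_def h by simp_all
  have inner: "(\<Sum>j<n * m. kas_entry n m (inverse z) j k * eigenvector n m z j l) = t ^ fst (black_vertex n k) * g (snd (black_vertex n k))"
    if k: "k < n * m" for k
  proof -
    obtain x r where xr: "black_vertex n k = (x, r)" by (cases "black_vertex n k")
    have r: "1 \<le> r" using xr by (auto simp: black_vertex_def)
    have "(\<Sum>j<n * m. kas_entry n m (inverse z) j k * eigenvector n m z j l) = - (t ^ x * (d * h r + (-1) ^ x * (h (r + 1) - h (r - 1))))"
      unfolding eigenvector_def t_def[symmetric] h_def[symmetric] d_def
      by (rule kas_transpose_apply[OF n k t z h xr])
    also have "\<dots> = t ^ x * g r"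
      unfolding eig[OF r] black_parity[OF xr] g_def by (simp add: algebra_simps)
    finally show ?thesis by (simp add: xr)
  qed
  obtain x r where xr: "white_vertex n i = (x, r)" by (cases "white_vertex n i")
  have r: "1 \<le> r" using xr by (auto simp: white_vertex_def)
  then obtain s where s: "r = Suc s" by (cases r) auto
  have "(\<Sum>k<n * m. kas_entry n m z i k * (\<Sum>j<n * m. kas_entry n m (inverse z) j k * eigenvector n m z j l))
     = (\<Sum>k<n * m. kas_entry n m z i k * (t ^ fst (black_vertex n k) * g (snd (black_vertex n k))))"
    by (rule sum.cong[OF refl]) (simp only: inner lessThan_iff)
  also have "\<dots> = t ^ x * (d * g r + (-1) ^ x * (g (r + 1) - g (r - 1)))"
    unfolding d_def by (rule kas_apply[OF n i t z g0 xr])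
  \<comment> \<open>The rows r + 1 and r - 1 have the same parity, opposite to that of
    \<open>r\<close>, so one common factor can be taken out.\<close>
  also have "g (r + 1) - g (r - 1) = - ((d - (-1) ^ r * (2 * \<i> * c)) * (h (r + 1) - h (r - 1)))"
    unfolding g_def s by (simp add: algebra_simps)
  also have "\<dots> = - ((d - (-1) ^ r * (2 * \<i> * c)) * (2 * \<i> * c * h r))" unfolding eig[OF r] ..
  also have "t ^ x * (d * g r + (-1) ^ x * - ((d - (-1) ^ r * (2 * \<i> * c)) * (2 * \<i> * c * h r)))
      = t ^ x * h r * (- d\<^sup>2 + 4 * c\<^sup>2)"
  proof -
    define e where "e = ((-1) ^ r :: complex)"
    have e: "e * e = 1" unfolding e_def by (simp flip: power_mult_distrib)
    have "t ^ x * (d * g r + (-1) ^ x * - ((d - (-1) ^ r * (2 * \<i> * c)) * (2 * \<i> * c * h r)))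
      = t ^ x * h r * (- d\<^sup>2 + (e * e) * 4 * c\<^sup>2)"
      unfolding white_parity[OF xr] g_def e_def[symmetric] by (simp add: algebra_simps power2_eq_square)
    then show ?thesis unfolding e by simp
  qed
  also have "- d\<^sup>2 + 4 * c\<^sup>2 = eigenvalue n m z l"
    unfolding eigenvalue_def t_def[symmetric] d_def c_def using t0 by (simp add: power2_eq_square field_simps)
  also have "t ^ x * h r = eigenvector n m z i l"
    by (simp add: eigenvector_def t_def h_def xr)
  finally show ?thesis .
qed

text \<open>Dual to the eigenvectors up to scaling. Reciprocal powers replace complex conjugates, as
  the roots need not have modulus 1 for general \<open>z\<close>.\<close>

definition dual_vector :: "nat \<Rightarrow> nat \<Rightarrow> complex \<Rightarrow> nat \<Rightarrow> nat \<Rightarrow> complex" where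
  "dual_vector n m z l i = inverse (wave_root n z (l mod n) ^ fst (white_vertex n i)) * (inverse (\<i> ^ snd (white_vertex n i))
     * of_real (sin (real (snd (white_vertex n i)) * angle m (l div n))))"

lemma white_vertex_block: "p < n \<Longrightarrow> white_vertex n (j * n + p) = (2 * p + j mod 2, j + 1)"
  by (simp add: white_vertex_def)

text \<open>The sum over a row is geometric in the square of the ratio \<rho> of the roots and
  vanishes for different horizontal modes. For equal ones \<rho> is 1, the row parity drops out, and
  the sines decide.\<close>

lemma dual_vector_orthogonal:
  assumes l: "l < n * m" "l' < n * m"
  shows "(\<Sum>i<n * m. dual_vector n m z l i * eigenvector n m z i l') = 0 \<longleftrightarrow> l \<noteq> l'"
proof -
  define \<rho> where "\<rho> = wave_root n z (l' mod n) / wave_root n z (l mod n)"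
  have n0: "0 < n" using l by (cases n) auto
  have q: "l div n < m" "l' div n < m" using row_index_less[OF n0] l by auto
  define S where "S = (\<Sum>j<m. sin (real (j + 1) * angle m (l div n)) * sin (real (j + 1) * angle m (l' div n)))"
  have "dual_vector n m z l (j * n + p) * eigenvector n m z (j * n + p) l'
     = \<rho> ^ (j mod 2) * of_real (sin (real (j + 1) * angle m (l div n)) * sin (real (j + 1) * angle m (l' div n))) * (\<rho>\<^sup>2) ^ p"
    if "p < n" for j p
  proof -
    have "dual_vector n m z l (j * n + p) * eigenvector n m z (j * n + p) l'
      = (wave_root n z (l' mod n) ^ (2 * p + j mod 2) / wave_root n z (l mod n) ^ (2 * p + j mod 2)) * (inverse (\<i> ^ (j + 1)) * \<i> ^ (j + 1))
         * of_real (sin (real (j + 1) * angle m (l div n)) * sin (real (j + 1) * angle m (l' div n)))"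
      unfolding dual_vector_def eigenvector_def vertical_wave_def white_vertex_block[OF that] fst_conv snd_conv divide_inverse of_real_mult
      by (simp only: mult_ac)
    also have "inverse (\<i> ^ (j + 1)) * \<i> ^ (j + 1) = 1" by (rule left_inverse) simp
    also have "wave_root n z (l' mod n) ^ (2 * p + j mod 2) / wave_root n z (l mod n) ^ (2 * p + j mod 2) = \<rho> ^ (j mod 2) * (\<rho>\<^sup>2) ^ p"
    proof -
      have "wave_root n z (l' mod n) ^ (2 * p + j mod 2) / wave_root n z (l mod n) ^ (2 * p + j mod 2) = \<rho> ^ (2 * p + j mod 2)"
        by (simp only: \<rho>_def power_divide)
      also have "\<dots> = \<rho> ^ (j mod 2) * (\<rho>\<^sup>2) ^ p"
        unfolding power_add power_mult by (rule mult.commute)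
      finally show ?thesis .
    qed
    finally show ?thesis by (simp only: mult_ac mult_1_right mult_1_left)
  qed
  then have "(\<Sum>i<n * m. dual_vector n m z l i * eigenvector n m z i l')
     = (\<Sum>j<m. \<Sum>p<n. \<rho> ^ (j mod 2) * of_real (sin (real (j + 1) * angle m (l div n)) * sin (real (j + 1) * angle m (l' div n))) * (\<rho>\<^sup>2) ^ p)"
    unfolding sum_blocks by (intro sum.cong refl) simp_all
  also have "\<dots> = (\<Sum>j<m. \<rho> ^ (j mod 2) * of_real (sin (real (j + 1) * angle m (l div n)) * sin (real (j + 1) * angle m (l' div n)))) * (\<Sum>p<n. (\<rho>\<^sup>2) ^ p)"
    by (simp only: sum_distrib_left[symmetric] sum_distrib_right)
  also have "(\<Sum>p<n. (\<rho>\<^sup>2) ^ p) = (if l' mod n = l mod n then of_nat n else 0)"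
    unfolding \<rho>_def using n0 by (intro sum_root_ratio) simp_all
  finally have eq: "(\<Sum>i<n * m. dual_vector n m z l i * eigenvector n m z i l')
     = (\<Sum>j<m. \<rho> ^ (j mod 2) * of_real (sin (real (j + 1) * angle m (l div n)) * sin (real (j + 1) * angle m (l' div n)))) * (if l' mod n = l mod n then of_nat n else 0)" .
  show ?thesis
  proof (cases "l' mod n = l mod n")
    case False
    then have "l \<noteq> l'" by auto
    then show ?thesis unfolding eq using False by simp
  next
    case True
    then have "\<rho> = 1" unfolding \<rho>_def by (simp add: wave_root_nonzero)
    then have "(\<Sum>i<n * m. dual_vector n m z l i * eigenvector n m z i l') = of_real S * of_nat n"
      unfolding eq S_def using True by simp
    moreover have "of_real S * of_nat n = (0::complex) \<longleftrightarrow> S = 0" using n0 by simp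
    moreover have "S = 0 \<longleftrightarrow> l div n \<noteq> l' div n" unfolding S_def by (rule sine_orthogonal[OF q])
    moreover have "l div n \<noteq> l' div n \<longleftrightarrow> l \<noteq> l'"
      using True by (metis div_mult_mod_eq)
    ultimately show ?thesis by simp
  qed
qed

text \<open>The eigenvector equations read K K'^T E = E D, so determinants give the claim once det E
  can be cancelled. It is nonzero because G E is diagonal with nonzero entries.\<close>

lemma dimer_partition_mult_eigenvalues:
  assumes n: "2 \<le> n" and z: "z \<noteq> 0"
  shows "dimer_partition n m z * dimer_partition n m (inverse z) = (\<Prod>l<n * m. eigenvalue n m z l)"
proof -
  let ?N = "n * m"
  define K where "K = mat ?N ?N (\<lambda>(i, k). kas_entry n m z i k)"
  define K' where "K' = mat ?N ?N (\<lambda>(i, k). kas_entry n m (inverse z) i k)"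
  define E where "E = mat ?N ?N (\<lambda>(i, l). eigenvector n m z i l)"
  define G where "G = mat ?N ?N (\<lambda>(l, i). dual_vector n m z l i)"
  define D where "D = mat ?N ?N (\<lambda>(i, j). if i = j then eigenvalue n m z i else 0)"
  have carr: "K \<in> carrier_mat ?N ?N" "K' \<in> carrier_mat ?N ?N" "E \<in> carrier_mat ?N ?N" "G \<in> carrier_mat ?N ?N" "D \<in> carrier_mat ?N ?N"
    by (simp_all add: K_def K'_def E_def G_def D_def)
  have tr: "transpose_mat K' = mat ?N ?N (\<lambda>(k, j). kas_entry n m (inverse z) j k)"
    by (rule eq_matI) (simp_all add: K'_def)
  have "K * (transpose_mat K' * E) = E * D"
    unfolding tr K_def E_def D_def mat_times_mat
  proof (rule eq_matI)
    fix i l assume "i < dim_row (mat ?N ?N (\<lambda>(i, j). \<Sum>k<?N. eigenvector n m z i k * (if k = j then eigenvalue n m z k else 0)))"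
      "l < dim_col (mat ?N ?N (\<lambda>(i, j). \<Sum>k<?N. eigenvector n m z i k * (if k = j then eigenvalue n m z k else 0)))"
    then have il: "i < ?N" "l < ?N" by simp_all
    have "(\<Sum>k<?N. eigenvector n m z i k * (if k = l then eigenvalue n m z k else 0)) = eigenvector n m z i l * eigenvalue n m z l"
      using il by (simp add: if_distrib cong: if_cong)
    then show "mat ?N ?N (\<lambda>(i, j). \<Sum>k<?N. kas_entry n m z i k * (\<Sum>ka<?N. kas_entry n m (inverse z) ka k * eigenvector n m z ka j)) $$ (i, l)
       = mat ?N ?N (\<lambda>(i, j). \<Sum>k<?N. eigenvector n m z i k * (if k = j then eigenvalue n m z k else 0)) $$ (i, l)"
      using il kas_eigenvector[OF n z il(1), of l] by simp
  qed simp_all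
  then have "Determinant.det (K * (transpose_mat K' * E)) = Determinant.det (E * D)" by simp
  moreover have "Determinant.det (K * (transpose_mat K' * E)) = Determinant.det K * (Determinant.det K' * Determinant.det E)"
    using carr by (simp add: det_mult[of _ ?N] det_transpose)
  moreover have "Determinant.det (E * D) = Determinant.det E * Determinant.det D"
    using carr by (simp add: det_mult[of _ ?N])
  ultimately have KK: "(Determinant.det K * Determinant.det K') * Determinant.det E = Determinant.det D * Determinant.det E"
    by (simp only: mult_ac)
  define F where "F l = (\<Sum>i<?N. dual_vector n m z l i * eigenvector n m z i l)" for l
  have "G * E = mat ?N ?N (\<lambda>(i, j). if i = j then F i else 0)"
    unfolding G_def E_def mat_times_mat
    by (rule eq_matI) (auto simp: F_def dual_vector_orthogonal)
  then have "Determinant.det (G * E) = (\<Prod>l<?N. F l)" by (simp only: det_diagonal)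
  moreover have "(\<Prod>l<?N. F l) \<noteq> 0" by (auto simp: F_def dual_vector_orthogonal)
  moreover have "Determinant.det (G * E) = Determinant.det G * Determinant.det E"
    using carr by (simp add: det_mult[of _ ?N])
  ultimately have "Determinant.det E \<noteq> 0" by auto
  then have "Determinant.det K * Determinant.det K' = Determinant.det D" using KK by simp
  moreover have "Determinant.det K * Determinant.det K' = (of_int (kas_sign n m * kas_sign n m))
      * (dimer_partition n m z * dimer_partition n m (inverse z))"
    unfolding K_def K'_def kasteleyn_determinant[OF n] of_int_mult by (simp only: mult_ac)
  ultimately show ?thesis unfolding kas_sign_square D_def det_diagonal by simp
qed

theorem loop_partition_product:
  assumes n: "odd n" "2 \<le> n"
  shows "loop_partition n m X = (\<Prod>q<m. X + 2 * of_real (cosh (2 * real n * arsinh (cos (angle m q)))))"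
proof -
  \<comment> \<open>A solution of z + 1/z = X, so that every complex X is reached.\<close>
  define z where "z = (X + csqrt (X\<^sup>2 - 4)) / 2"
  have prod1: "z * ((X - csqrt (X\<^sup>2 - 4)) / 2) = 1"
  proof -
    have "z * ((X - csqrt (X\<^sup>2 - 4)) / 2) = (X\<^sup>2 - (csqrt (X\<^sup>2 - 4))\<^sup>2) / 4"
      by (simp add: z_def power2_eq_square algebra_simps)
    then show ?thesis by simp
  qed
  then have z: "z \<noteq> 0" by auto
  have iz: "inverse z = (X - csqrt (X\<^sup>2 - 4)) / 2" using prod1 by (rule inverse_unique)
  have X: "z + inverse z = X" unfolding iz by (simp add: z_def field_simps)
  have n0: "0 < n" using n by simp
  have "loop_partition n m X = (\<Prod>l<n * m. eigenvalue n m z l)"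
    using dimer_partition_mult[OF n(2) z, of m] dimer_partition_mult_eigenvalues[OF n(2) z, of m] X by simp
  also have "\<dots> = (\<Prod>q<m. \<Prod>a<n. eigenvalue n m z (q * n + a))" by (rule prod_blocks)
  also have "\<dots> = (\<Prod>q<m. X + 2 * of_real (cosh (2 * real n * arsinh (cos (angle m q)))))"
  proof (rule prod.cong[OF refl])
    fix q
    define b where "b = arsinh (cos (angle m q))"
    \<comment> \<open>Chosen so that y + 1/y = 2 cosh (2 b) = 2 + 4 (sinh b)^2 is the part of the
      eigenvalue that does not depend on the root.\<close>
    define y where "y = complex_of_real (exp (2 * b))"
    have y0: "y \<noteq> 0" by (simp add: y_def)
    have "exp (2 * b) + 1 / exp (2 * b) = 2 + 4 * (cos (angle m q))\<^sup>2"
    proof -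
      have "exp (2 * b) + 1 / exp (2 * b) = 2 * cosh (2 * b)" by (simp add: cosh_def exp_minus inverse_eq_divide)
      also have "cosh (2 * b) = 1 + 2 * (sinh b)\<^sup>2" by (simp add: cosh_double cosh_square_eq)
      also have "sinh b = cos (angle m q)" by (simp add: b_def)
      finally show ?thesis by simp
    qed
    then have "complex_of_real (exp (2 * b) + 1 / exp (2 * b)) = of_real (2 + 4 * (cos (angle m q))\<^sup>2)" by simp
    then have yy: "y + 1 / y = 2 + 4 * of_real ((cos (angle m q))\<^sup>2)" by (simp add: y_def)
    have "(\<Prod>a<n. eigenvalue n m z (q * n + a)) = (\<Prod>a<n. y + 1 / y - (wave_root n z a)\<^sup>2 - 1 / (wave_root n z a)\<^sup>2)"
      unfolding yy by (intro prod.cong refl) (simp add: eigenvalue_def)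
    also have "\<dots> = z + 1 / z + y ^ n + 1 / y ^ n" by (rule prod_resolvent[OF n(1) z y0])
    also have "\<dots> = X + (y ^ n + 1 / y ^ n)" unfolding X[symmetric] by (simp add: inverse_eq_divide)
    also have "y ^ n + 1 / y ^ n = 2 * of_real (cosh (2 * real n * b))"
    proof -
      have "exp (2 * b) ^ n = exp (2 * real n * b)" by (simp add: exp_of_nat_mult[symmetric] mult_ac)
      then have "exp (2 * b) ^ n + 1 / exp (2 * b) ^ n = 2 * cosh (2 * real n * b)"
        by (simp add: cosh_def exp_minus field_simps)
      then have "complex_of_real (exp (2 * b) ^ n + 1 / exp (2 * b) ^ n) = of_real (2 * cosh (2 * real n * b))" by simp
      then show ?thesis by (simp add: y_def)
    qed
    finally show "(\<Prod>a<n. eigenvalue n m z (q * n + a)) = X + 2 * of_real (cosh (2 * real n * arsinh (cos (angle m q))))"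
      by (simp add: b_def)
  qed
  finally show ?thesis .
qed

section \<open>Limits of products and of coefficients\<close>

lemma prod_telescope:
  fixes f :: "nat \<Rightarrow> complex"
  shows "(\<Prod>j<J. f j) = 1 + (\<Sum>k<J. (f k - 1) * (\<Prod>j<k. f j))"
  by (induction J) (simp_all add: algebra_simps)

lemma norm_prod_le_exp:
  fixes f :: "nat \<Rightarrow> complex"
  assumes "\<And>j. norm (f j - 1) \<le> M j" "summable M"
  shows "norm (\<Prod>j<k. f j) \<le> exp (suminf M)"
proof -
  have M0: "0 \<le> M j" for j by (rule order_trans[OF norm_ge_zero assms(1)])
  have "norm (\<Prod>j<k. f j) = (\<Prod>j<k. norm (f j))" by (simp add: prod_norm)
  also have "\<dots> \<le> (\<Prod>j<k. exp (M j))"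
  proof (rule prod_mono)
    fix j
    have "norm (f j) \<le> norm (f j - 1) + norm (1 :: complex)" using norm_triangle_ineq[of "f j - 1" 1] by simp
    also have "\<dots> \<le> 1 + M j" using assms(1)[of j] by simp
    also have "\<dots> \<le> exp (M j)" by (rule exp_ge_add_one_self)
    finally show "0 \<le> norm (f j) \<and> norm (f j) \<le> exp (M j)" by simp
  qed
  also have "\<dots> = exp (\<Sum>j<k. M j)" by (simp add: exp_sum)
  also have "\<dots> \<le> exp (suminf M)"
    using sum_le_suminf[OF assms(2), of "{..<k}"] M0 by simp
  finally show ?thesis .
qed

text \<open>Telescoping the products reduces this to dominated convergence of series.\<close>

lemma tendsto_prod_dominated:
  fixes f :: "nat \<Rightarrow> nat \<Rightarrow> complex" and g :: "nat \<Rightarrow> complex" and J :: "nat \<Rightarrow> nat"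
  assumes lim: "\<And>j. (\<lambda>i. f i j) \<longlonglongrightarrow> g j"
    and bound: "eventually (\<lambda>i. \<forall>j. norm (f i j - 1) \<le> M j) sequentially"
    and M: "summable M"
    and one: "\<And>i j. J i \<le> j \<Longrightarrow> f i j = 1"
  shows "(\<lambda>i. \<Prod>j<J i. f i j) \<longlonglongrightarrow> prodinf g"
proof -
  \<comment> \<open>The increments of the partial products. From index \<open>J i\<close> on the
    factors are 1 and the increments 0, so the finite product is a full series.\<close>
  define a where "a k i = (f i k - 1) * (\<Prod>j<k. f i j)" for k i
  define b where "b k = (g k - 1) * (\<Prod>j<k. g j)" for k
  have gM: "norm (g j - 1) \<le> M j" for j
  proof (rule tendsto_upperbound)
    show "(\<lambda>i. norm (f i j - 1)) \<longlonglongrightarrow> norm (g j - 1)" by (intro tendsto_intros lim)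
    show "eventually (\<lambda>i. norm (f i j - 1) \<le> M j) sequentially" using bound by eventually_elim simp
  qed simp
  have ab: "(\<lambda>i. a k i) \<longlonglongrightarrow> b k" for k
    unfolding a_def b_def by (intro tendsto_intros lim)
  have M': "summable (\<lambda>k. M k * exp (suminf M))" by (rule summable_mult2[OF M])
  have "eventually (\<lambda>(k,i). norm (a k i) \<le> M k * exp (suminf M)) (at_top \<times>\<^sub>F sequentially)"
    unfolding eventually_prod_filter
  proof (intro exI conjI allI impI)
    show "eventually (\<lambda>_. True) (at_top :: nat filter)" by simp
    show "eventually (\<lambda>i. \<forall>j. norm (f i j - 1) \<le> M j) sequentially" by (rule bound)
    fix k i assume fi: "\<forall>j. norm (f i j - 1) \<le> M j"
    have "norm (a k i) = norm (f i k - 1) * norm (\<Prod>j<k. f i j)" by (simp add: a_def norm_mult)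
    also have "\<dots> \<le> M k * exp (suminf M)"
    proof (rule mult_mono)
      show "norm (f i k - 1) \<le> M k" using fi by blast
      show "norm (\<Prod>j<k. f i j) \<le> exp (suminf M)" using fi M by (intro norm_prod_le_exp) auto
      show "0 \<le> M k" by (rule order_trans[OF norm_ge_zero spec[OF fi]])
    qed simp
    finally show "case (k, i) of (k, i) \<Rightarrow> norm (a k i) \<le> M k * exp (suminf M)" by simp
  qed
  from tannerys_theorem[OF ab this M']
  have T: "summable (\<lambda>k. norm (b k))" "(\<lambda>i. \<Sum>k. a k i) \<longlonglongrightarrow> suminf b" by auto
  have "(\<Prod>j<J i. f i j) = 1 + (\<Sum>k. a k i)" for i
  proof -
    have "(\<Sum>k. a k i) = (\<Sum>k<J i. a k i)"
    proof (rule suminf_finite)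
      fix k assume "k \<notin> {..<J i}"
      then have "f i k = 1" by (intro one) simp
      then show "a k i = 0" by (simp add: a_def)
    qed simp
    then show ?thesis unfolding a_def by (simp only: prod_telescope[of "f i" "J i"])
  qed
  then have 1: "(\<lambda>i. \<Prod>j<J i. f i j) \<longlonglongrightarrow> 1 + suminf b"
    using tendsto_add[OF tendsto_const[of 1] T(2)] by simp
  have "summable (\<lambda>j. norm (g j - 1))"
    by (rule summable_comparison_test[OF _ M]) (use gM in auto)
  then have "convergent_prod g"
    by (intro abs_convergent_prod_imp_convergent_prod summable_imp_abs_convergent_prod)
  then have "(\<lambda>k. \<Prod>j\<le>k. g j) \<longlonglongrightarrow> prodinf g" by (rule convergent_prod_LIMSEQ)
  then have "(\<lambda>k. \<Prod>j<Suc k. g j) \<longlonglongrightarrow> prodinf g" by (simp only: lessThan_Suc_atMost)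
  then have 2: "(\<lambda>k. \<Prod>j<k. g j) \<longlonglongrightarrow> prodinf g" by (rule LIMSEQ_imp_Suc)
  have "summable b" using T(1) by (rule summable_norm_cancel)
  then have "(\<lambda>k. 1 + (\<Sum>j<k. b j)) \<longlonglongrightarrow> 1 + suminf b"
    by (intro tendsto_intros summable_LIMSEQ)
  then have "(\<lambda>k. \<Prod>j<k. g j) \<longlonglongrightarrow> 1 + suminf b"
    unfolding b_def prod_telescope[symmetric] .
  then have "1 + suminf b = prodinf g" by (rule LIMSEQ_unique[OF _ 2])
  then show ?thesis using 1 by simp
qed

text \<open>For 0 \<le> x \<le> 1 every term of index l \<ge> 1 lies between 0 and x times
  \<open>a l\<close>.\<close>

lemma nonneg_power_series_coeff_le:
  fixes a :: "nat \<Rightarrow> real"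
  assumes "\<And>l. 0 \<le> a l" "summable (\<lambda>l. a l)" "0 \<le> x" "x \<le> 1"
  shows "summable (\<lambda>l. a l * x ^ l)" "a 0 \<le> (\<Sum>l. a l * x ^ l)" "(\<Sum>l. a l * x ^ l) \<le> a 0 + x * (\<Sum>l. a l)"
proof -
  have le: "a l * x ^ l \<le> a l" for l
    using mult_left_mono[OF power_le_one[OF assms(3,4)] assms(1)] by simp
  have "norm (a l * x ^ l) \<le> a l" for l
    using le assms(1,3) by (simp add: abs_mult)
  then show s: "summable (\<lambda>l. a l * x ^ l)"
    by (intro summable_comparison_test[OF _ assms(2)]) auto
  have s1: "summable (\<lambda>l. a (Suc l))" using assms(2) by (simp add: summable_Suc_iff)
  have s2: "summable (\<lambda>l. a (Suc l) * x ^ Suc l)" using s by (simp only: summable_Suc_iff[of "\<lambda>l. a l * x ^ l"])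
  have split: "(\<Sum>l. a l * x ^ l) = a 0 + (\<Sum>l. a (Suc l) * x ^ Suc l)"
    using suminf_split_head[OF s] by simp
  have "0 \<le> (\<Sum>l. a (Suc l) * x ^ Suc l)"
    by (intro suminf_nonneg[OF s2]) (simp add: assms)
  then show "a 0 \<le> (\<Sum>l. a l * x ^ l)" using split by simp
  have "(\<Sum>l. a (Suc l) * x ^ Suc l) \<le> (\<Sum>l. x * a (Suc l))"
  proof (rule suminf_le[OF _ s2 summable_mult[OF s1]])
    fix l
    have "x * (a (Suc l) * x ^ l) \<le> x * a (Suc l)"
      using mult_left_mono[OF power_le_one[OF assms(3,4)] assms(1)] assms(3) by (intro mult_left_mono) simp_all
    then show "a (Suc l) * x ^ Suc l \<le> x * a (Suc l)" by (simp add: mult_ac)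
  qed
  also have "\<dots> = x * (\<Sum>l. a (Suc l))" by (rule suminf_mult[OF s1])
  also have "\<dots> \<le> x * (\<Sum>l. a l)"
    using suminf_split_head[OF assms(2)] assms(1)[of 0] assms(3) by (intro mult_left_mono) simp_all
  finally show "(\<Sum>l. a l * x ^ l) \<le> a 0 + x * (\<Sum>l. a l)" using split by simp
qed

text \<open>The k-th coefficient is squeezed between the limits at small x of the power series with the first
  k terms removed.\<close>

lemma coefficients_convergent:
  fixes a :: "nat \<Rightarrow> nat \<Rightarrow> real" and R :: "nat \<Rightarrow> real \<Rightarrow> real"
  assumes pos: "\<And>i k. 0 \<le> a i k"
    and sums: "\<And>i x. (\<lambda>k. a i k * x ^ k) sums R i x"
    and conv: "\<And>x. convergent (\<lambda>i. R i x)"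
  shows "convergent (\<lambda>i. a i k)"
proof (induction k rule: less_induct)
  case (less k)
  define T where "T i x = (R i x - (\<Sum>l<k. a i l * x ^ l)) / x ^ k" for i x
  have Tconv: "convergent (\<lambda>i. T i x)" if "0 < x" for x
  proof -
    have "convergent (\<lambda>i. a i l * x ^ l)" if "l \<in> {..<k}" for l
      using less[of l] that convergent_mult[OF _ convergent_const] by auto
    then have "convergent (\<lambda>i. \<Sum>l<k. a i l * x ^ l)" by (rule convergent_sum)
    then have "convergent (\<lambda>i. R i x - (\<Sum>l<k. a i l * x ^ l))" by (rule convergent_diff[OF conv])
    then have "convergent (\<lambda>i. (R i x - (\<Sum>l<k. a i l * x ^ l)) * inverse (x ^ k))"
      by (rule convergent_mult[OF _ convergent_const])
    then show ?thesis by (simp add: T_def divide_inverse)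
  qed
  have Tsum: "T i x = (\<Sum>l. a i (l + k) * x ^ l)" "summable (\<lambda>l. a i (l + k) * x ^ l)" if "0 < x" for i x
  proof -
    have s: "(\<lambda>l. a i (l + k) * x ^ (l + k)) sums (R i x - (\<Sum>l<k. a i l * x ^ l))"
      using sums_split_initial_segment[OF sums[of i x], of k] .
    have "(\<lambda>l. a i (l + k) * x ^ (l + k) / x ^ k) sums T i x"
      unfolding T_def by (rule sums_divide[OF s])
    moreover have "a i (l + k) * x ^ (l + k) / x ^ k = a i (l + k) * x ^ l" for l
      using that by (simp add: power_add)
    ultimately have "(\<lambda>l. a i (l + k) * x ^ l) sums T i x" by simp
    then show "T i x = (\<Sum>l. a i (l + k) * x ^ l)" "summable (\<lambda>l. a i (l + k) * x ^ l)"
      by (simp_all add: sums_iff)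
  qed
  have squeeze: "a i k \<le> T i x \<and> T i x \<le> a i k + x * T i 1" if "0 < x" "x \<le> 1" for i x
    using nonneg_power_series_coeff_le[of "\<lambda>l. a i (l + k)" x] Tsum[of x i] Tsum[of 1 i] that pos by simp
  obtain B where B: "\<And>i. \<bar>T i 1\<bar> \<le> B"
    using convergent_imp_Bseq[OF Tconv[of 1]] by (auto simp: Bseq_def)
  have B0: "0 \<le> B" using B[of 0] by linarith
  have "Cauchy (\<lambda>i. a i k)"
  proof (rule metric_CauchyI)
    fix e :: real assume e: "0 < e"
    \<comment> \<open>So small that the gap between \<open>a i k\<close> and \<open>T i x\<close>,
      at most x * B for every i, stays within e / 4.\<close>
    define x where "x = min 1 (e / (4 * (B + 1)))"
    have x: "0 < x" "x \<le> 1" using e B0 by (auto simp: x_def)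
    have "x * B \<le> e / (4 * (B + 1)) * B" using B0 by (intro mult_right_mono) (auto simp: x_def)
    also have "\<dots> \<le> e / 4" using B0 e by (simp add: field_simps)
    finally have xB: "x * B \<le> e / 4" .
    have "Cauchy (\<lambda>i. T i x)" using Tconv[OF x(1)] by (rule convergent_Cauchy)
    then obtain K where K: "\<And>i j. K \<le> i \<Longrightarrow> K \<le> j \<Longrightarrow> dist (T i x) (T j x) < e / 4"
      using metric_CauchyD[of "\<lambda>i. T i x" "e / 4"] e by auto
    have "dist (a i k) (a j k) < e" if ij: "K \<le> i" "K \<le> j" for i j
    proof -
      have "x * T i 1 \<le> x * B" "x * T j 1 \<le> x * B"
        using B[of i] B[of j] x by (auto intro!: mult_left_mono)
      then show ?thesis
        using squeeze[OF x, of i] squeeze[OF x, of j] K[OF ij] xB e unfolding dist_real_def by linarith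
    qed
    then show "\<exists>K. \<forall>i\<ge>K. \<forall>j\<ge>K. dist (a i k) (a j k) < e" by blast
  qed
  then show ?case by (rule Cauchy_convergent)
qed

text \<open>Convergence of the coefficients is \<open>coefficients_convergent\<close> on the real
  axis. That their limits have generating function \<open>G\<close> follows by dominated
  convergence: boundedness of the series at one larger point bounds all terms at X by a geometric
  sequence.\<close>

lemma has_limiting_pgfI_all:
  fixes a :: "nat \<Rightarrow> nat \<Rightarrow> real" and S :: "nat \<Rightarrow> complex \<Rightarrow> complex"
  assumes pos: "\<And>i k. 0 \<le> a i k"
    and sums: "\<And>i X. (\<lambda>k. of_real (a i k) * X ^ k) sums S i X"
    and lim: "\<And>X. (\<lambda>i. S i X) \<longlonglongrightarrow> G X"
  shows "has_limiting_pgf a G"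
proof -
  have Re: "(\<lambda>k. a i k * x ^ k) sums Re (S i (of_real x))" for i x
    using sums_Re[OF sums[of i "of_real x"]] by (simp flip: of_real_power of_real_mult)
  have conv: "convergent (\<lambda>i. a i k)" for k
  proof (rule coefficients_convergent[OF pos Re])
    show "convergent (\<lambda>i. Re (S i (of_real x)))" for x
      using tendsto_Re[OF lim] unfolding convergent_def by blast
  qed
  define p where "p k = lim (\<lambda>i. a i k)" for k
  have p: "(\<lambda>i. a i k) \<longlonglongrightarrow> p k" for k
    using conv[of k] by (simp add: p_def convergent_LIMSEQ_iff)
  have psum: "(\<lambda>k. of_real (p k) * X ^ k) sums G X" for X
  proof -
    \<comment> \<open>The bound is taken at s = 2 r, which gains the factor (1/2)^k over the terms
      at X; the 1 keeps r positive.\<close>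
    define r where "r = cmod X + 1"
    have r: "0 < r" "cmod X \<le> r" using norm_ge_zero[of X] unfolding r_def by linarith+
    define s where "s = 2 * r"
    have s: "0 \<le> s" using r by (simp add: s_def)
    have "Bseq (\<lambda>i. S i (of_real s))" by (rule convergent_imp_Bseq, rule convergentI, rule lim)
    then obtain B where B: "\<And>i. cmod (S i (of_real s)) \<le> B" by (auto simp: Bseq_def)
    have bound: "norm (of_real (a i k) * X ^ k) \<le> B * (1 / 2) ^ k" for i k
    proof -
      have "a i k * s ^ k = (\<Sum>k\<in>{k}. a i k * s ^ k)" by simp
      also have "\<dots> \<le> (\<Sum>k. a i k * s ^ k)"
        using pos s by (intro sum_le_suminf sums_summable[OF Re[of i s]]) simp_all
      also have "\<dots> = Re (S i (of_real s))" by (rule sums_unique[OF Re[of i s], symmetric])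
      also have "\<dots> \<le> B" by (rule order_trans[OF complex_Re_le_cmod B])
      finally have le: "a i k * s ^ k \<le> B" .
      have "norm (of_real (a i k) * X ^ k) = a i k * cmod X ^ k"
        using pos[of i k] by (simp add: norm_mult norm_power)
      also have "\<dots> \<le> a i k * r ^ k"
        by (rule mult_left_mono[OF power_mono[OF r(2) norm_ge_zero] pos])
      also have "a i k * r ^ k = a i k * (s ^ k * (1 / 2) ^ k)" unfolding power_mult_distrib[symmetric] by (simp add: s_def)
      also have "\<dots> \<le> B * (1 / 2) ^ k"
        unfolding mult.assoc[symmetric] using le by (intro mult_right_mono) simp_all
      finally show ?thesis .
    qed
    have "eventually (\<lambda>(k,i). norm (of_real (a i k) * X ^ k) \<le> B * (1 / 2) ^ k) (at_top \<times>\<^sub>F sequentially)"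
      using bound by (intro always_eventually) auto
    moreover have "summable (\<lambda>k. B * (1 / 2 :: real) ^ k)" by (intro summable_mult summable_geometric) simp
    moreover have "(\<lambda>i. of_real (a i k) * X ^ k) \<longlonglongrightarrow> of_real (p k) * X ^ k" for k
      by (intro tendsto_intros p)
    ultimately have T: "summable (\<lambda>k. norm (of_real (p k) * X ^ k))"
      "(\<lambda>i. \<Sum>k. of_real (a i k) * X ^ k) \<longlonglongrightarrow> (\<Sum>k. of_real (p k) * X ^ k)"
      using tannerys_theorem[of "\<lambda>k i. of_real (a i k) * X ^ k" "\<lambda>k. of_real (p k) * X ^ k" sequentially "\<lambda>k. B * (1 / 2) ^ k"]
      by auto
    have "(\<lambda>i. S i X) \<longlonglongrightarrow> (\<Sum>k. of_real (p k) * X ^ k)"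
      using T(2) sums_unique[OF sums] by simp
    then have "(\<Sum>k. of_real (p k) * X ^ k) = G X" by (rule LIMSEQ_unique[OF _ lim])
    then show ?thesis using summable_sums[OF summable_norm_cancel[OF T(1)]] by simp
  qed
  have "(\<lambda>i. \<Sum>k. of_real (a i k) * X ^ k) \<longlonglongrightarrow> G X" for X
    using lim sums_unique[OF sums] by simp
  then show ?thesis unfolding has_limiting_pgf_def using p psum by blast
qed

text \<open>Only a tail of the sequence has to satisfy the hypotheses:
  \<open>double_dimer_prob_sums\<close> is available once 2 \<le> n i.\<close>

lemma has_limiting_pgfI:
  fixes a :: "nat \<Rightarrow> nat \<Rightarrow> real" and S :: "nat \<Rightarrow> complex \<Rightarrow> complex"
  assumes pos: "\<And>i k. i \<ge> i0 \<Longrightarrow> 0 \<le> a i k"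
    and sums: "\<And>i X. i \<ge> i0 \<Longrightarrow> (\<lambda>k. of_real (a i k) * X ^ k) sums S i X"
    and lim: "\<And>X. (\<lambda>i. S i X) \<longlonglongrightarrow> G X"
  shows "has_limiting_pgf a G"
proof -
  have "has_limiting_pgf (\<lambda>i. a (i + i0)) G"
    by (rule has_limiting_pgfI_all[where S = "\<lambda>i. S (i + i0)"])
      (use pos sums LIMSEQ_ignore_initial_segment[OF lim] in auto)
  then obtain p where p: "\<And>k. (\<lambda>i. a (i + i0) k) \<longlonglongrightarrow> p k" "\<And>X. (\<lambda>k. of_real (p k) * X ^ k) sums G X"
    "\<And>X. (\<lambda>i. \<Sum>k. of_real (a (i + i0) k) * X ^ k) \<longlonglongrightarrow> G X"
    unfolding has_limiting_pgf_def by blast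
  have "(\<lambda>i. a i k) \<longlonglongrightarrow> p k" for k by (rule LIMSEQ_offset[OF p(1)])
  moreover have "(\<lambda>i. \<Sum>k. of_real (a i k) * X ^ k) \<longlonglongrightarrow> G X" for X
    by (rule LIMSEQ_offset[OF p(3)])
  ultimately show ?thesis unfolding has_limiting_pgf_def using p(2) by blast
qed

section \<open>The limiting generating functions\<close>

lemma prod_split_add: "(\<Prod>q<a + b. f q) = (\<Prod>q<a. f q) * (\<Prod>q<b. f (a + q))"
  for f :: "nat \<Rightarrow> complex"
  by (induction b) (simp_all add: mult.assoc)

text \<open>The odd numbers for even \<open>m\<close> and the positive even numbers for odd
  \<open>m\<close>: the exponents of q in the limit.\<close>

definition wave_number :: "nat \<Rightarrow> nat \<Rightarrow> nat" where
  "wave_number m j = 2 * j + 1 + m mod 2"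

text \<open>The distance of \<open>angle m q\<close> from pi / 2, where r = |m + 1 - 2 (q +
  1)|.\<close>

definition half_angle :: "nat \<Rightarrow> nat \<Rightarrow> real" where
  "half_angle m r = pi * real r / (2 * real (m + 1))"

lemma angle_plus_half_angle:
  assumes "2 * (q + 1) + r = m + 1"
  shows "angle m q + half_angle m r = pi / 2"
proof -
  have *: "pi * a / D + pi * b / (2 * D) = pi / 2" if "b = D - 2 * a" "0 < D" for a b D :: real
    using that(2) unfolding that(1) by (simp add: field_simps)
  have "real r = real (m + 1) - 2 * real (q + 1)" using assms by linarith
  from *[OF this] show ?thesis unfolding angle_def half_angle_def by simp
qed

lemma angle_minus_half_angle:
  assumes "2 * (q + 1) = m + 1 + r"
  shows "angle m q - half_angle m r = pi / 2"
proof -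
  have *: "pi * a / D - pi * b / (2 * D) = pi / 2" if "b = 2 * a - D" "0 < D" for a b D :: real
    using that(2) unfolding that(1) by (simp add: field_simps)
  have "real r = 2 * real (q + 1) - real (m + 1)" using assms by linarith
  from *[OF this] show ?thesis unfolding angle_def half_angle_def by simp
qed

lemma cos_eq_sin_complement: "cos x = sin y" if "x + y = pi / 2" for x y :: real
proof -
  have "y = pi / 2 - x" using that by simp
  then show ?thesis by (simp add: cos_sin_eq)
qed

lemma cos_eq_minus_sin: "cos x = - sin y" if "x - y = pi / 2" for x y :: real
proof -
  have "cos x = sin (- y)" using that by (intro cos_eq_sin_complement) simp
  then show ?thesis by simp
qed

text \<open>The angles are symmetric about pi / 2, so the cosines come in pairs of opposite sign, on
  which an even function takes equal values. For odd \<open>m\<close> the angle pi / 2 itself is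
  left over, the source of the factor in front of the product.\<close>

lemma fold_cosines:
  fixes \<psi> :: "real \<Rightarrow> complex"
  assumes even: "\<And>u. \<psi> (- u) = \<psi> u"
  shows "(\<Prod>q<m. \<psi> (cos (angle m q)))
    = (if odd m then \<psi> 0 else 1) * (\<Prod>j<m div 2. (\<psi> (sin (half_angle m (wave_number m j))))\<^sup>2)"
proof (cases "odd m")
  case False
  define J where "J = m div 2"
  have m: "m = J + J" using False unfolding J_def by presburger
  have wn: "wave_number m j = 2 * j + 1" for j using False by (simp add: wave_number_def)
  have lower: "cos (angle m (J - Suc j)) = sin (half_angle m (2 * j + 1))" if "j < J" for j
    using that by (intro cos_eq_sin_complement angle_plus_half_angle) (simp add: m)
  have upper: "cos (angle m (J + j)) = - sin (half_angle m (2 * j + 1))" for j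
    by (intro cos_eq_minus_sin angle_minus_half_angle) (simp add: m)
  have "(\<Prod>q<m. \<psi> (cos (angle m q))) = (\<Prod>q<J. \<psi> (cos (angle m q))) * (\<Prod>q<J. \<psi> (cos (angle m (J + q))))"
    unfolding m by (rule prod_split_add)
  also have "(\<Prod>q<J. \<psi> (cos (angle m q))) = (\<Prod>j<J. \<psi> (cos (angle m (J - Suc j))))"
    by (rule prod.nat_diff_reindex[symmetric])
  also have "\<dots> = (\<Prod>j<J. \<psi> (sin (half_angle m (2 * j + 1))))"
    by (intro prod.cong refl) (simp only: lower lessThan_iff)
  also have "(\<Prod>q<J. \<psi> (cos (angle m (J + q)))) = (\<Prod>j<J. \<psi> (sin (half_angle m (2 * j + 1))))"
    unfolding upper even ..
  also have "(\<Prod>j<J. \<psi> (sin (half_angle m (2 * j + 1)))) * (\<Prod>j<J. \<psi> (sin (half_angle m (2 * j + 1))))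
      = (\<Prod>j<J. (\<psi> (sin (half_angle m (2 * j + 1))))\<^sup>2)"
    by (simp add: prod.distrib power2_eq_square)
  finally show ?thesis using False by (simp add: wn J_def)
next
  case True
  define J where "J = m div 2"
  have m: "m = Suc J + J" using True unfolding J_def by presburger
  have wn: "wave_number m j = 2 * j + 2" for j using True by (simp add: wave_number_def mod2_eq_if)
  have lower: "cos (angle m (J - Suc j)) = sin (half_angle m (2 * j + 2))" if "j < J" for j
    using that by (intro cos_eq_sin_complement angle_plus_half_angle) (simp add: m)
  have upper: "cos (angle m (Suc J + j)) = - sin (half_angle m (2 * j + 2))" for j
    by (intro cos_eq_minus_sin angle_minus_half_angle) (simp add: m)
  have "angle m J + half_angle m 0 = pi / 2" by (rule angle_plus_half_angle) (simp add: m)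
  then have "angle m J = pi / 2" by (simp add: half_angle_def)
  then have mid: "cos (angle m J) = 0" by (simp only: cos_pi_half)
  have "(\<Prod>q<m. \<psi> (cos (angle m q))) = (\<Prod>q<Suc J. \<psi> (cos (angle m q))) * (\<Prod>q<J. \<psi> (cos (angle m (Suc J + q))))"
    unfolding m by (rule prod_split_add)
  also have "(\<Prod>q<Suc J. \<psi> (cos (angle m q))) = \<psi> 0 * (\<Prod>q<J. \<psi> (cos (angle m q)))"
    by (simp add: mid)
  also have "(\<Prod>q<J. \<psi> (cos (angle m q))) = (\<Prod>j<J. \<psi> (cos (angle m (J - Suc j))))"
    by (rule prod.nat_diff_reindex[symmetric])
  also have "\<dots> = (\<Prod>j<J. \<psi> (sin (half_angle m (2 * j + 2))))"
    by (intro prod.cong refl) (simp only: lower lessThan_iff)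
  also have "(\<Prod>q<J. \<psi> (cos (angle m (Suc J + q)))) = (\<Prod>j<J. \<psi> (sin (half_angle m (2 * j + 2))))"
    unfolding upper even ..
  also have "\<psi> 0 * (\<Prod>j<J. \<psi> (sin (half_angle m (2 * j + 2)))) * (\<Prod>j<J. \<psi> (sin (half_angle m (2 * j + 2))))
      = \<psi> 0 * (\<Prod>j<J. (\<psi> (sin (half_angle m (2 * j + 2))))\<^sup>2)"
    by (simp add: prod.distrib power2_eq_square)
  finally show ?thesis using True by (simp add: wn J_def)
qed

text \<open>The finite counterpart of q^r: the hyperbolic term of the product formula, 2 cosh (2 n
  arsinh (sin (half_angle m r))), is A + 1/A for this amplitude A.\<close>

definition amplitude :: "nat \<Rightarrow> nat \<Rightarrow> nat \<Rightarrow> real" where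
  "amplitude n m r = exp (- (2 * real n * arsinh (sin (half_angle m r))))"

text \<open>Multiplying a factor X + A + 1/A by its amplitude A gives 1 + A X + A^2, and the
  amplitudes cancel in the ratio. The parameter \<open>c\<close> is the weight of a noncontractible
  loop: 1 for \<open>trace_prob\<close> and 2 for the double-dimer law.\<close>

lemma loop_partition_ratio:
  fixes c :: real
  assumes n: "odd n" "2 \<le> n" and c: "0 < c"
  shows "loop_partition n m (of_real c * X) / loop_partition n m (of_real c)
    = (if odd m then (2 + of_real c * X) / (2 + of_real c) else 1)
      * (\<Prod>j<m div 2. ((1 + of_real (amplitude n m (wave_number m j)) * (of_real c * X) + (of_real (amplitude n m (wave_number m j)))\<^sup>2)
          / (1 + of_real (amplitude n m (wave_number m j)) * of_real c + (of_real (amplitude n m (wave_number m j)))\<^sup>2))\<^sup>2)"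
proof -
  define \<psi> where "\<psi> Y u = Y + 2 * complex_of_real (cosh (2 * real n * arsinh u))" for Y u
  have even: "\<psi> Y (- u) = \<psi> Y u" for Y u by (simp add: \<psi>_def arsinh_minus_real)
  have lp: "loop_partition n m Y = (if odd m then \<psi> Y 0 else 1) * (\<Prod>j<m div 2. (\<psi> Y (sin (half_angle m (wave_number m j))))\<^sup>2)" for Y
  proof -
    have "loop_partition n m Y = (\<Prod>q<m. \<psi> Y (cos (angle m q)))" by (simp only: loop_partition_product[OF n] \<psi>_def)
    then show ?thesis by (simp only: fold_cosines[where \<psi> = "\<psi> Y", OF even])
  qed
  have p0: "\<psi> Y 0 = 2 + Y" for Y by (simp add: \<psi>_def)
  have amp: "\<psi> Y (sin (half_angle m r)) = (1 + of_real (amplitude n m r) * Y + (of_real (amplitude n m r))\<^sup>2) / of_real (amplitude n m r)" for Y r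
  proof -
    define A where "A = complex_of_real (amplitude n m r)"
    have A0: "A \<noteq> 0" by (simp add: A_def amplitude_def)
    have "2 * cosh (2 * real n * arsinh (sin (half_angle m r))) = amplitude n m r + 1 / amplitude n m r"
      by (simp add: cosh_def amplitude_def exp_minus field_simps)
    then have "complex_of_real (2 * cosh (2 * real n * arsinh (sin (half_angle m r)))) = of_real (amplitude n m r + 1 / amplitude n m r)" by simp
    then have "\<psi> Y (sin (half_angle m r)) = Y + (A + 1 / A)" by (simp add: \<psi>_def A_def)
    also have "\<dots> = (1 + A * Y + A\<^sup>2) / A" using A0 by (simp add: field_simps power2_eq_square)
    finally show ?thesis by (simp add: A_def)
  qed
  have amp0: "complex_of_real (amplitude n m r) \<noteq> 0" for r by (simp add: amplitude_def)
  have "\<psi> (of_real c * X) (sin (half_angle m r)) / \<psi> (of_real c) (sin (half_angle m r))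
     = (1 + of_real (amplitude n m r) * (of_real c * X) + (of_real (amplitude n m r))\<^sup>2) / (1 + of_real (amplitude n m r) * of_real c + (of_real (amplitude n m r))\<^sup>2)" for r
    unfolding amp using amp0[of r] by simp
  then have "(\<Prod>j<m div 2. ((1 + of_real (amplitude n m (wave_number m j)) * (of_real c * X) + (of_real (amplitude n m (wave_number m j)))\<^sup>2)
          / (1 + of_real (amplitude n m (wave_number m j)) * of_real c + (of_real (amplitude n m (wave_number m j)))\<^sup>2))\<^sup>2)
      = (\<Prod>j<m div 2. (\<psi> (of_real c * X) (sin (half_angle m (wave_number m j))))\<^sup>2) / (\<Prod>j<m div 2. (\<psi> (of_real c) (sin (half_angle m (wave_number m j))))\<^sup>2)"
    by (simp only: prod_dividef[symmetric] power_divide[symmetric])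
  then show ?thesis unfolding lp p0 by simp
qed

lemma loop_partition_nonzero:
  assumes n: "odd n" "2 \<le> n"
  shows "loop_partition n m 2 \<noteq> 0"
proof -
  have "(2 :: complex) + 2 * of_real (cosh x) \<noteq> 0" for x :: real
  proof
    assume "(2 :: complex) + 2 * of_real (cosh x) = 0"
    then have "complex_of_real (2 + 2 * cosh x) = 0" by simp
    then have "2 + 2 * cosh x = 0" by (simp only: of_real_eq_0_iff)
    then show False using cosh_real_pos[of x] by linarith
  qed
  then show ?thesis unfolding loop_partition_product[OF n] by simp
qed

text \<open>No cover is constructed: without covers \<open>loop_partition\<close> would vanish,
  while its product formula does not at X = 2.\<close>

lemma dimer_covers_nonempty:
  assumes n: "odd n" "2 \<le> n"
  shows "dimer_covers n m \<noteq> {}"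
proof
  assume "dimer_covers n m = {}"
  then have "double_dimer_configs n m = {}" by (simp add: double_dimer_configs_def)
  then show False using loop_partition_nonzero[OF n, of m] by (simp add: loop_partition_def)
qed

text \<open>A crude linear bound is enough to dominate the factors. The double angle formula, with x
  cos x \<le> sin x and cos x \<ge> sqrt 2 / 2 on [0, pi/4], gives sin y \<ge> y / 2; and sinh u
  \<le> 2 u on [0, 1] is applied at u = y / 4.\<close>

lemma arsinh_sin_lower_bound:
  assumes "0 \<le> y" "y \<le> pi / 2"
  shows "y / 4 \<le> arsinh (sin y)"
proof -
  have half: "x * cos x \<le> sin x" if "0 \<le> x" "x \<le> pi / 4" for x :: real
  proof -
    have "sin 0 - 0 * cos 0 \<le> sin x - x * cos x"
    proof (rule DERIV_nonneg_imp_nondecreasing[OF that(1)])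
      fix u assume u: "0 \<le> u" "u \<le> x"
      have "((\<lambda>x. sin x - x * cos x) has_real_derivative u * sin u) (at u)"
        by (auto intro!: derivative_eq_intros)
      moreover have "0 \<le> u * sin u" using u that by (intro mult_nonneg_nonneg sin_ge_zero) auto
      ultimately show "\<exists>d. ((\<lambda>x. sin x - x * cos x) has_real_derivative d) (at u) \<and> 0 \<le> d" by blast
    qed
    then show ?thesis by simp
  qed
  define x where "x = y / 2"
  have x: "0 \<le> x" "x \<le> pi / 4" using assms by (simp_all add: x_def)
  have "cos (pi / 4) \<le> cos x" using x pi_gt_zero by (intro cos_monotone_0_pi_le) auto
  then have c: "sqrt 2 / 2 \<le> cos x" by (simp add: cos_45)
  then have c0: "0 \<le> cos x" by (rule order_trans[rotated]) simp
  have "(sqrt 2 / 2) * (sqrt 2 / 2) \<le> cos x * cos x" using c c0 by (intro mult_mono) auto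
  then have "1 / 2 \<le> cos x * cos x" by simp
  then have "x * (1 / 2) \<le> x * (cos x * cos x)" using x(1) by (intro mult_left_mono) auto
  also have "\<dots> \<le> sin x * cos x" using mult_right_mono[OF half[OF x] c0] by (simp add: mult.assoc)
  also have "2 * (sin x * cos x) = sin y" using sin_double[of x] by (simp add: x_def)
  finally have "x * (1 / 2) \<le> sin y / 2" using \<open>2 * (sin x * cos x) = sin y\<close> by linarith
  then have s: "y / 2 \<le> sin y" by (simp add: x_def)
  define u where "u = y / 4"
  have u: "0 \<le> u" "u \<le> 1" using assms pi_less_4 by (simp_all add: u_def)
  have "sinh u = (exp u - exp (- u)) / 2" by (simp add: sinh_def)
  also have "\<dots> \<le> ((1 + u + u\<^sup>2) - (1 - u)) / 2"
    using exp_bound[OF u] exp_ge_add_one_self[of "- u"] by simp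
  also have "\<dots> \<le> 2 * u"
  proof -
    have "u\<^sup>2 \<le> u * 1" unfolding power2_eq_square using u by (intro mult_left_mono) auto
    then show ?thesis using u by simp
  qed
  also have "\<dots> \<le> sin y" using s by (simp add: u_def)
  finally have "\<not> arsinh (sin y) < arsinh (sinh u)" unfolding arsinh_less_iff_real not_less .
  then show ?thesis unfolding arsinh_sinh_real u_def not_less .
qed

text \<open>Geometric decay in \<open>r\<close>, uniform in \<open>n\<close> and \<open>m\<close> as
  long as n / (m + 1) stays away from 0. The bound on \<open>r\<close> keeps the half angle within
  [0, pi/2].\<close>

lemma amplitude_bound:
  assumes "r \<le> m + 1"
  shows "amplitude n m r \<le> exp (- (pi / 4 * (real n / real (m + 1)) * real r))"
proof -
  have "real r / real (m + 1) \<le> 1" using assms by simp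
  then have "half_angle m r \<le> pi / 2 * 1"
    unfolding half_angle_def using mult_left_mono[of "real r / real (m + 1)" 1 "pi / 2"] by simp
  then have "half_angle m r / 4 \<le> arsinh (sin (half_angle m r))"
    by (intro arsinh_sin_lower_bound) (simp_all add: half_angle_def)
  then have "2 * real n * (half_angle m r / 4) \<le> 2 * real n * arsinh (sin (half_angle m r))"
    by (intro mult_left_mono) simp_all
  moreover have "2 * real n * (half_angle m r / 4) = pi / 4 * (real n / real (m + 1)) * real r"
    unfolding half_angle_def by (simp add: field_simps)
  ultimately have "pi / 4 * (real n / real (m + 1)) * real r \<le> 2 * real n * arsinh (sin (half_angle m r))"
    by (simp only:)
  then show ?thesis unfolding amplitude_def exp_le_cancel_iff neg_le_iff_le .
qed

section \<open>The limit for heights of fixed parity\<close>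

context
  fixes n m :: "nat \<Rightarrow> nat" and \<tau> :: real
  assumes m_pos: "\<And>i. 0 < m i" and m_top: "filterlim m at_top sequentially"
    and \<tau>: "0 < \<tau>" and ratio: "(\<lambda>i. real (n i) / real (m i)) \<longlonglongrightarrow> \<tau>"
begin

text \<open>The angles have denominator m + 1 rather than m.\<close>

lemma ratio_Suc: "(\<lambda>i. real (n i) / real (m i + 1)) \<longlonglongrightarrow> \<tau>"
proof -
  have inv: "(\<lambda>i. inverse (real (Suc (m i)))) \<longlonglongrightarrow> 0"
    by (rule filterlim_compose[OF LIMSEQ_inverse_real_of_nat m_top])
  have "(\<lambda>i. real (n i) / real (m i) * (1 - inverse (real (Suc (m i))))) \<longlonglongrightarrow> \<tau> * (1 - 0)"
    by (intro tendsto_intros ratio inv)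
  moreover have "real (n i) / real (m i) * (1 - inverse (real (Suc (m i)))) = real (n i) / real (m i + 1)" for i
    using m_pos[of i] by (simp add: field_simps)
  ultimately show ?thesis by simp
qed

text \<open>The half angle tends to 0, where arsinh (sin y) / y tends to 1, and 2 n times the half
  angle is pi r n / (m + 1). The case r = 0 is separate because of the division by the half
  angle.\<close>

lemma amplitude_tendsto: "(\<lambda>i. amplitude (n i) (m i) r) \<longlonglongrightarrow> exp (- \<tau> * pi) ^ r"
proof (cases "r = 0")
  case True
  then show ?thesis by (simp add: amplitude_def half_angle_def)
next
  case False
  have "((\<lambda>y. arsinh (sin y)) has_real_derivative (1 / sqrt ((sin 0)\<^sup>2 + 1)) * cos 0) (at 0)"
    by (rule DERIV_chain2[OF arsinh_real_has_field_derivative DERIV_sin])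
  then have d: "((\<lambda>y. arsinh (sin y)) has_real_derivative 1) (at 0)" by simp
  have q: "((\<lambda>y. arsinh (sin y) / y) \<longlongrightarrow> 1) (at (0::real))"
    using d by (simp add: has_field_derivative_iff)
  have inv: "(\<lambda>i. inverse (real (Suc (m i)))) \<longlonglongrightarrow> 0"
    by (rule filterlim_compose[OF LIMSEQ_inverse_real_of_nat m_top])
  have ha: "half_angle (m i) r = pi * real r / 2 * inverse (real (Suc (m i)))" for i
    by (simp add: half_angle_def field_simps)
  have "(\<lambda>i. half_angle (m i) r) \<longlonglongrightarrow> pi * real r / 2 * 0"
    unfolding ha by (intro tendsto_intros inv)
  moreover have h0: "half_angle (m i) r \<noteq> 0" for i using False by (simp add: half_angle_def)
  ultimately have "filterlim (\<lambda>i. half_angle (m i) r) (at 0) sequentially"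
    unfolding filterlim_at by simp
  then have "(\<lambda>i. arsinh (sin (half_angle (m i) r)) / half_angle (m i) r) \<longlonglongrightarrow> 1"
    by (rule filterlim_compose[OF q])
  then have "(\<lambda>i. exp (- (arsinh (sin (half_angle (m i) r)) / half_angle (m i) r * (pi * real r * (real (n i) / real (m i + 1))))))
      \<longlonglongrightarrow> exp (- (1 * (pi * real r * \<tau>)))"
    by (intro tendsto_intros ratio_Suc)
  moreover have "arsinh (sin (half_angle (m i) r)) / half_angle (m i) r * (pi * real r * (real (n i) / real (m i + 1)))
      = 2 * real (n i) * arsinh (sin (half_angle (m i) r))" for i
  proof -
    have "pi * real r * (real (n i) / real (m i + 1)) = half_angle (m i) r * (2 * real (n i))"
      unfolding half_angle_def by (simp add: field_simps)
    then show ?thesis using h0[of i] by simp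
  qed
  moreover have "exp (- (1 * (pi * real r * \<tau>))) = exp (- \<tau> * pi) ^ r"
    by (simp add: exp_of_nat_mult[symmetric] mult_ac)
  ultimately show ?thesis by (simp add: amplitude_def)
qed

text \<open>With the parity of \<open>m i\<close> fixed, the wave numbers do not depend on
  \<open>i\<close>, so each factor has a limit by \<open>amplitude_tendsto\<close>. The factors are
  padded by 1 beyond the middle and dominated geometrically by
  \<open>amplitude_bound\<close>.\<close>

lemma ratio_product_tendsto:
  fixes c :: real and X :: complex and s :: nat
  defines "q \<equiv> complex_of_real (exp (- \<tau> * pi))"
  assumes c: "0 < c" and s: "\<And>i. m i mod 2 = s"
  shows "(\<lambda>i. \<Prod>j<m i div 2. ((1 + of_real (amplitude (n i) (m i) (wave_number (m i) j)) * (of_real c * X) + (of_real (amplitude (n i) (m i) (wave_number (m i) j)))\<^sup>2)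
          / (1 + of_real (amplitude (n i) (m i) (wave_number (m i) j)) * of_real c + (of_real (amplitude (n i) (m i) (wave_number (m i) j)))\<^sup>2))\<^sup>2)
    \<longlonglongrightarrow> (\<Prod>j. (1 + q ^ (2 * j + 1 + s) * (of_real c * X) + q ^ (2 * (2 * j + 1 + s)))\<^sup>2 / (1 + q ^ (2 * j + 1 + s) * of_real c + q ^ (2 * (2 * j + 1 + s)))\<^sup>2)"
proof -
  define A where "A i j = amplitude (n i) (m i) (wave_number (m i) j)" for i j
  define D where "D = c * cmod (X - 1)"
  \<comment> \<open>The rate pi / 4 of \<open>amplitude_bound\<close> times \<tau> / 2, which n / (m
    + 1) eventually exceeds.\<close>
  define \<rho> where "\<rho> = exp (- (pi * \<tau> / 8))"
  define f where "f i j = (if j < m i div 2 then ((1 + of_real (A i j) * (of_real c * X) + (of_real (A i j))\<^sup>2)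
          / (1 + of_real (A i j) * of_real c + (of_real (A i j))\<^sup>2))\<^sup>2 else 1)" for i j
  \<comment> \<open>From the bound D a (2 + D a) in \<open>fbound\<close>, with a \<le> \<rho>^j in
    the first factor and a \<le> 1 in the second.\<close>
  define M where "M j = D * (2 + D) * \<rho> ^ j" for j
  have wn: "wave_number (m i) j = 2 * j + 1 + s" for i j by (simp add: wave_number_def s)
  have A0: "0 < A i j" for i j by (simp add: A_def amplitude_def)
  have D0: "0 \<le> D" using c by (simp add: D_def)
  have \<rho>: "0 < \<rho>" "\<rho> < 1" using \<tau> by (simp_all add: \<rho>_def)
  have den: "1 \<le> cmod (1 + of_real a * of_real c + (of_real a)\<^sup>2)" if "0 < a" for a :: real
  proof -
    have "1 + of_real a * of_real c + (of_real a)\<^sup>2 = complex_of_real (1 + a * c + a\<^sup>2)" by simp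
    moreover have "1 \<le> \<bar>1 + a * c + a\<^sup>2\<bar>" using that c by simp
    ultimately show ?thesis by (simp only: norm_of_real)
  qed
  have den0: "1 + of_real a * of_real c + (of_real a)\<^sup>2 \<noteq> (0::complex)" if "0 < a" for a :: real
    using den[OF that] by (metis norm_zero not_one_le_zero)
  \<comment> \<open>For the quotient B, the difference B - 1 is a c (X - 1) over a denominator of
    modulus at least 1, and B^2 - 1 = (B - 1) (B + 1).\<close>
  have fbound: "cmod (((1 + of_real a * (of_real c * X) + (of_real a)\<^sup>2) / (1 + of_real a * of_real c + (of_real a)\<^sup>2))\<^sup>2 - 1) \<le> D * a * (2 + D * a)"
    if a: "0 < a" for a
  proof -
    define B where "B = (1 + of_real a * (of_real c * X) + (of_real a)\<^sup>2) / (1 + of_real a * of_real c + (of_real a)\<^sup>2)"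
    have "B - 1 = of_real a * of_real c * (X - 1) / (1 + of_real a * of_real c + (of_real a)\<^sup>2)"
      unfolding B_def using den0[OF a] by (simp add: field_simps)
    then have "cmod (B - 1) = a * c * cmod (X - 1) / cmod (1 + of_real a * of_real c + (of_real a)\<^sup>2)"
      using a c by (simp add: norm_divide norm_mult)
    also have "\<dots> \<le> a * c * cmod (X - 1) / 1"
      using den[OF a] a c by (intro divide_left_mono) auto
    finally have B: "cmod (B - 1) \<le> D * a" by (simp add: D_def mult_ac)
    have "cmod (B + 1) = cmod ((B - 1) + 2)" by (rule arg_cong[of _ _ cmod]) simp
    also have "\<dots> \<le> cmod (B - 1) + cmod 2" by (rule norm_triangle_ineq)
    finally have B': "cmod (B + 1) \<le> 2 + D * a" using B by simp
    have "B\<^sup>2 - 1 = (B - 1) * (B + 1)" by (simp only: power2_eq_square square_diff_one_factored mult.commute)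
    then have "cmod (B\<^sup>2 - 1) = cmod (B - 1) * cmod (B + 1)" by (simp only: norm_mult)
    also have "\<dots> \<le> D * a * (2 + D * a)"
      using B B' D0 a by (intro mult_mono) auto
    finally show ?thesis by (simp add: B_def)
  qed
  have lim: "(\<lambda>i. f i j) \<longlonglongrightarrow> (1 + q ^ (2 * j + 1 + s) * (of_real c * X) + q ^ (2 * (2 * j + 1 + s)))\<^sup>2 / (1 + q ^ (2 * j + 1 + s) * of_real c + q ^ (2 * (2 * j + 1 + s)))\<^sup>2" for j
  proof -
    define Q where "Q = exp (- \<tau> * pi) ^ (2 * j + 1 + s)"
    have Q0: "0 < Q" by (simp add: Q_def)
    have "(\<lambda>i. A i j) \<longlonglongrightarrow> Q" unfolding A_def wn Q_def by (rule amplitude_tendsto)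
    then have "(\<lambda>i. ((1 + of_real (A i j) * (of_real c * X) + (of_real (A i j))\<^sup>2)
          / (1 + of_real (A i j) * of_real c + (of_real (A i j))\<^sup>2))\<^sup>2)
       \<longlonglongrightarrow> ((1 + of_real Q * (of_real c * X) + (of_real Q)\<^sup>2) / (1 + of_real Q * of_real c + (of_real Q)\<^sup>2))\<^sup>2"
      using den0[OF Q0] by (intro tendsto_intros) auto
    moreover have "eventually (\<lambda>i. ((1 + of_real (A i j) * (of_real c * X) + (of_real (A i j))\<^sup>2)
          / (1 + of_real (A i j) * of_real c + (of_real (A i j))\<^sup>2))\<^sup>2 = f i j) sequentially"
    proof -
      have "eventually (\<lambda>i. 2 * j + 2 \<le> m i) sequentially" using m_top by (simp add: filterlim_at_top)
      then show ?thesis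
      proof eventually_elim
        case (elim i)
        then have "j < m i div 2" by linarith
        then show ?case by (simp add: f_def)
      qed
    qed
    ultimately have "(\<lambda>i. f i j) \<longlonglongrightarrow> ((1 + of_real Q * (of_real c * X) + (of_real Q)\<^sup>2) / (1 + of_real Q * of_real c + (of_real Q)\<^sup>2))\<^sup>2"
      by (rule Lim_transform_eventually)
    moreover have "complex_of_real Q = q ^ (2 * j + 1 + s)" by (simp add: Q_def q_def)
    moreover have "(q ^ (2 * j + 1 + s))\<^sup>2 = q ^ (2 * (2 * j + 1 + s))" by (simp only: power_mult[symmetric] mult.commute)
    ultimately show ?thesis by (simp only: power_divide)
  qed
  have "eventually (\<lambda>i. \<tau> / 2 < real (n i) / real (m i + 1)) sequentially"
    using ratio_Suc \<tau> by (intro order_tendstoD) auto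
  then have bound: "eventually (\<lambda>i. \<forall>j. norm (f i j - 1) \<le> M j) sequentially"
  proof eventually_elim
    case (elim i)
    show ?case
    proof
      fix j
      show "norm (f i j - 1) \<le> M j"
      proof (cases "j < m i div 2")
        case False
        then show ?thesis using D0 \<rho> by (simp add: f_def M_def)
      next
        case True
        have s1: "s \<le> 1" using s[of i] by linarith
        have wm: "wave_number (m i) j \<le> m i + 1" using True s1 unfolding wn by linarith
        have "pi * \<tau> / 8 * real j \<le> pi / 4 * (real (n i) / real (m i + 1)) * real (wave_number (m i) j)"
        proof (rule mult_mono)
          show "pi * \<tau> / 8 \<le> pi / 4 * (real (n i) / real (m i + 1))"
            using mult_left_mono[of "\<tau> / 2" "real (n i) / real (m i + 1)" "pi / 4"] elim by simp
        qed (simp_all add: wn)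
        then have "A i j \<le> exp (- (pi * \<tau> / 8 * real j))"
          using amplitude_bound[OF wm, of "n i"] unfolding A_def by (elim order_trans) simp
        also have "\<dots> = \<rho> ^ j" by (simp add: \<rho>_def exp_of_nat_mult[symmetric] mult_ac)
        finally have A\<rho>: "A i j \<le> \<rho> ^ j" .
        have "\<rho> ^ j \<le> 1" using \<rho> by (intro power_le_one) auto
        then have A1: "A i j \<le> 1" using A\<rho> by linarith
        have "norm (f i j - 1) \<le> D * A i j * (2 + D * A i j)"
          using fbound[OF A0[of i j]] True by (simp add: f_def)
        also have "\<dots> \<le> D * \<rho> ^ j * (2 + D * 1)"
          using A\<rho> A1 D0 A0[of i j] \<rho> by (intro mult_mono add_mono mult_left_mono) auto
        finally show ?thesis by (simp add: M_def mult_ac)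
      qed
    qed
  qed
  have "summable M" unfolding M_def using \<rho> by (intro summable_mult summable_geometric) auto
  moreover have "f i j = 1" if "m i div 2 \<le> j" for i j using that by (simp add: f_def)
  ultimately have "(\<lambda>i. \<Prod>j<m i div 2. f i j) \<longlonglongrightarrow> (\<Prod>j. (1 + q ^ (2 * j + 1 + s) * (of_real c * X) + q ^ (2 * (2 * j + 1 + s)))\<^sup>2 / (1 + q ^ (2 * j + 1 + s) * of_real c + q ^ (2 * (2 * j + 1 + s)))\<^sup>2)"
    by (rule tendsto_prod_dominated[OF lim bound])
  moreover have "(\<Prod>j<m i div 2. f i j) = (\<Prod>j<m i div 2. ((1 + of_real (A i j) * (of_real c * X) + (of_real (A i j))\<^sup>2)
          / (1 + of_real (A i j) * of_real c + (of_real (A i j))\<^sup>2))\<^sup>2)" for i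
    by (rule prod.cong) (simp_all add: f_def)
  ultimately show ?thesis by (simp only: A_def)
qed

lemma loop_partition_ratio_tendsto:
  fixes c :: real and X :: complex and s :: nat
  defines "q \<equiv> complex_of_real (exp (- \<tau> * pi))"
  assumes n: "\<And>i. odd (n i)" "filterlim n at_top sequentially" and c: "0 < c" and s: "\<And>i. m i mod 2 = s"
  shows "(\<lambda>i. loop_partition (n i) (m i) (of_real c * X) / loop_partition (n i) (m i) (of_real c))
    \<longlonglongrightarrow> (if s = 1 then (2 + of_real c * X) / (2 + of_real c) else 1)
      * (\<Prod>j. (1 + q ^ (2 * j + 1 + s) * (of_real c * X) + q ^ (2 * (2 * j + 1 + s)))\<^sup>2 / (1 + q ^ (2 * j + 1 + s) * of_real c + q ^ (2 * (2 * j + 1 + s)))\<^sup>2)"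
proof (rule Lim_transform_eventually)
  show "(\<lambda>i. (if s = 1 then (2 + of_real c * X) / (2 + of_real c) else 1)
      * (\<Prod>j<m i div 2. ((1 + of_real (amplitude (n i) (m i) (wave_number (m i) j)) * (of_real c * X) + (of_real (amplitude (n i) (m i) (wave_number (m i) j)))\<^sup>2)
          / (1 + of_real (amplitude (n i) (m i) (wave_number (m i) j)) * of_real c + (of_real (amplitude (n i) (m i) (wave_number (m i) j)))\<^sup>2))\<^sup>2))
    \<longlonglongrightarrow> (if s = 1 then (2 + of_real c * X) / (2 + of_real c) else 1)
      * (\<Prod>j. (1 + q ^ (2 * j + 1 + s) * (of_real c * X) + q ^ (2 * (2 * j + 1 + s)))\<^sup>2 / (1 + q ^ (2 * j + 1 + s) * of_real c + q ^ (2 * (2 * j + 1 + s)))\<^sup>2)"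
    unfolding q_def by (rule tendsto_mult[OF tendsto_const ratio_product_tendsto[OF c s]])
  have "eventually (\<lambda>i. 2 \<le> n i) sequentially" using n(2) by (simp add: filterlim_at_top)
  then show "eventually (\<lambda>i. (if s = 1 then (2 + of_real c * X) / (2 + of_real c) else 1)
      * (\<Prod>j<m i div 2. ((1 + of_real (amplitude (n i) (m i) (wave_number (m i) j)) * (of_real c * X) + (of_real (amplitude (n i) (m i) (wave_number (m i) j)))\<^sup>2)
          / (1 + of_real (amplitude (n i) (m i) (wave_number (m i) j)) * of_real c + (of_real (amplitude (n i) (m i) (wave_number (m i) j)))\<^sup>2))\<^sup>2)
      = loop_partition (n i) (m i) (of_real c * X) / loop_partition (n i) (m i) (of_real c)) sequentially"
  proof eventually_elim
    case (elim i)
    have "s = 1 \<longleftrightarrow> odd (m i)" using s[of i] by (simp add: odd_iff_mod_2_eq_one)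
    then show ?case unfolding loop_partition_ratio[OF n(1) elim c] by simp
  qed
qed

lemma limiting_pgfs:
  fixes s :: nat
  defines "q \<equiv> complex_of_real (exp (- \<tau> * pi))"
  assumes n: "\<And>i. odd (n i)" "filterlim n at_top sequentially" and s: "\<And>i. m i mod 2 = s"
  shows "has_limiting_pgf (\<lambda>i. double_dimer_prob (n i) (m i))
      (\<lambda>X. (if s = 1 then (2 + 2 * X) / 4 else 1)
        * (\<Prod>j. (1 + q ^ (2 * j + 1 + s) * (2 * X) + q ^ (2 * (2 * j + 1 + s)))\<^sup>2 / (1 + q ^ (2 * j + 1 + s) * 2 + q ^ (2 * (2 * j + 1 + s)))\<^sup>2))"
    and "has_limiting_pgf (\<lambda>i. trace_prob (n i) (m i))
      (\<lambda>X. (if s = 1 then (2 + X) / 3 else 1)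
        * (\<Prod>j. (1 + q ^ (2 * j + 1 + s) * X + q ^ (2 * (2 * j + 1 + s)))\<^sup>2 / (1 + q ^ (2 * j + 1 + s) + q ^ (2 * (2 * j + 1 + s)))\<^sup>2))"
proof -
  obtain i0 where i0: "\<And>i. i0 \<le> i \<Longrightarrow> 2 \<le> n i"
    using n(2) unfolding filterlim_at_top eventually_sequentially by blast
  have c1: "0 < (1::real)" and c2: "0 < (2::real)" by simp_all
  have three: "2 + 1 = (3::complex)" and four: "2 + 2 = (4::complex)" by simp_all
  show "has_limiting_pgf (\<lambda>i. trace_prob (n i) (m i))
      (\<lambda>X. (if s = 1 then (2 + X) / 3 else 1)
        * (\<Prod>j. (1 + q ^ (2 * j + 1 + s) * X + q ^ (2 * (2 * j + 1 + s)))\<^sup>2 / (1 + q ^ (2 * j + 1 + s) + q ^ (2 * (2 * j + 1 + s)))\<^sup>2))"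
  proof (rule has_limiting_pgfI)
    show "0 \<le> trace_prob (n i) (m i) k" for i k by (rule trace_prob_nonneg)
    show "(\<lambda>k. of_real (trace_prob (n i) (m i) k) * X ^ k) sums (loop_partition (n i) (m i) X / loop_partition (n i) (m i) 1)" for i X
      by (rule trace_prob_sums)
    show "(\<lambda>i. loop_partition (n i) (m i) X / loop_partition (n i) (m i) 1) \<longlonglongrightarrow> (if s = 1 then (2 + X) / 3 else 1)
        * (\<Prod>j. (1 + q ^ (2 * j + 1 + s) * X + q ^ (2 * (2 * j + 1 + s)))\<^sup>2 / (1 + q ^ (2 * j + 1 + s) + q ^ (2 * (2 * j + 1 + s)))\<^sup>2)" for X
      using loop_partition_ratio_tendsto[OF n(1) n(2) c1 s, of X] unfolding q_def
      by (simp only: of_real_1 mult_1 mult_1_right three)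
  qed
  show "has_limiting_pgf (\<lambda>i. double_dimer_prob (n i) (m i))
      (\<lambda>X. (if s = 1 then (2 + 2 * X) / 4 else 1)
        * (\<Prod>j. (1 + q ^ (2 * j + 1 + s) * (2 * X) + q ^ (2 * (2 * j + 1 + s)))\<^sup>2 / (1 + q ^ (2 * j + 1 + s) * 2 + q ^ (2 * (2 * j + 1 + s)))\<^sup>2))"
  proof (rule has_limiting_pgfI)
    show "0 \<le> double_dimer_prob (n i) (m i) k" for i k by (simp add: double_dimer_prob_def)
    show "(\<lambda>k. of_real (double_dimer_prob (n i) (m i) k) * X ^ k) sums (loop_partition (n i) (m i) (2 * X) / loop_partition (n i) (m i) 2)"
      if "i0 \<le> i" for i X
      by (rule double_dimer_prob_sums[OF i0[OF that] dimer_covers_nonempty[OF n(1) i0[OF that]]])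
    show "(\<lambda>i. loop_partition (n i) (m i) (2 * X) / loop_partition (n i) (m i) 2) \<longlonglongrightarrow> (if s = 1 then (2 + 2 * X) / 4 else 1)
        * (\<Prod>j. (1 + q ^ (2 * j + 1 + s) * (2 * X) + q ^ (2 * (2 * j + 1 + s)))\<^sup>2 / (1 + q ^ (2 * j + 1 + s) * 2 + q ^ (2 * (2 * j + 1 + s)))\<^sup>2)" for X
      using loop_partition_ratio_tendsto[OF n(1) n(2) c2 s, of X] unfolding q_def
      by (simp only: of_real_numeral four)
  qed
qed

end

text \<open>The products with X and normalisation at X = 1 belong to the weights of
  \<open>trace_prob\<close>. In the double-dimer law a noncontractible loop also weighs 2, so there
  X is replaced by 2 X and the normalisation is the value at 2. The index \<open>j\<close> starts at
  0, so 2 j + 1 and 2 j + 2 run through the odd and the positive even numbers.\<close>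

theorem mainTheorem4:
  fixes n m :: "nat \<Rightarrow> nat" and \<tau> :: real and q :: complex
  assumes "\<And>i. odd (n i)" and "\<And>i. 0 < m i"
    and "filterlim n at_top sequentially" and "filterlim m at_top sequentially"
    and "0 < \<tau>" and "(\<lambda>i. real (n i) / real (m i)) \<longlonglongrightarrow> \<tau>"
    and "q = of_real (exp (- \<tau> * pi))"
  shows
    "((\<forall>i. even (m i)) \<longrightarrow>
        has_limiting_pgf (\<lambda>i. double_dimer_prob (n i) (m i))
          (\<lambda>X. \<Prod>j. (1 + q ^ (2*j+1) * (2 * X) + q ^ (2 * (2*j+1))) ^ 2
                    / (1 + q ^ (2*j+1) * 2 + q ^ (2 * (2*j+1))) ^ 2)
      \<and> has_limiting_pgf (\<lambda>i. trace_prob (n i) (m i))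
          (\<lambda>X. \<Prod>j. (1 + q ^ (2*j+1) * X + q ^ (2 * (2*j+1))) ^ 2
                    / (1 + q ^ (2*j+1) + q ^ (2 * (2*j+1))) ^ 2))
   \<and> ((\<forall>i. odd (m i)) \<longrightarrow>
        has_limiting_pgf (\<lambda>i. double_dimer_prob (n i) (m i))
          (\<lambda>X. (2 + 2 * X) / 4
             * (\<Prod>j. (1 + q ^ (2*j+2) * (2 * X) + q ^ (2 * (2*j+2))) ^ 2
                    / (1 + q ^ (2*j+2) * 2 + q ^ (2 * (2*j+2))) ^ 2))
      \<and> has_limiting_pgf (\<lambda>i. trace_prob (n i) (m i))
          (\<lambda>X. (2 + X) / 3
             * (\<Prod>j. (1 + q ^ (2*j+2) * X + q ^ (2 * (2*j+2))) ^ 2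
                    / (1 + q ^ (2*j+2) + q ^ (2 * (2*j+2))) ^ 2)))"
proof (intro conjI impI)
  assume "\<forall>i. even (m i)"
  then have s: "m i mod 2 = 0" for i by (simp add: even_iff_mod_2_eq_zero)
  note lim = limiting_pgfs[OF assms(2,4,5,6,1,3) s, folded assms(7)]
  have r: "2 * j + 1 + 0 = 2 * j + (1::nat)" for j by simp
  have f: "((0::nat) = 1) = False" by simp
  show "has_limiting_pgf (\<lambda>i. double_dimer_prob (n i) (m i))
          (\<lambda>X. \<Prod>j. (1 + q ^ (2*j+1) * (2 * X) + q ^ (2 * (2*j+1))) ^ 2
                    / (1 + q ^ (2*j+1) * 2 + q ^ (2 * (2*j+1))) ^ 2)"
    using lim(1) unfolding r f if_False mult_1 .
  show "has_limiting_pgf (\<lambda>i. trace_prob (n i) (m i))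
          (\<lambda>X. \<Prod>j. (1 + q ^ (2*j+1) * X + q ^ (2 * (2*j+1))) ^ 2
                    / (1 + q ^ (2*j+1) + q ^ (2 * (2*j+1))) ^ 2)"
    using lim(2) unfolding r f if_False mult_1 .
next
  assume "\<forall>i. odd (m i)"
  then have s: "m i mod 2 = 1" for i by (simp add: odd_iff_mod_2_eq_one)
  note lim = limiting_pgfs[OF assms(2,4,5,6,1,3) s, folded assms(7)]
  have r: "2 * j + 1 + 1 = 2 * j + (2::nat)" for j by simp
  have t: "((1::nat) = 1) = True" by simp
  show "has_limiting_pgf (\<lambda>i. double_dimer_prob (n i) (m i))
          (\<lambda>X. (2 + 2 * X) / 4
             * (\<Prod>j. (1 + q ^ (2*j+2) * (2 * X) + q ^ (2 * (2*j+2))) ^ 2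
                    / (1 + q ^ (2*j+2) * 2 + q ^ (2 * (2*j+2))) ^ 2))"
    using lim(1) unfolding r t if_True .
  show "has_limiting_pgf (\<lambda>i. trace_prob (n i) (m i))
          (\<lambda>X. (2 + X) / 3
             * (\<Prod>j. (1 + q ^ (2*j+2) * X + q ^ (2 * (2*j+2))) ^ 2
                    / (1 + q ^ (2*j+2) + q ^ (2 * (2*j+2))) ^ 2))"
    using lim(2) unfolding r t if_True .
qed

end
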